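(* Let $k\ge 2$ and $r$ be positive integers. (i) Let $s>1$ and let $F$ be a graph consisting of $s$ connected components of chromatic number $k+1$, each of which has a color-critical edge, together with any number of connected components of chromatic number at most $k$. Then for all sufficiently large $n$, $\mathrm{ex}_r(n,F)=e_r(T)$ for some $n$-vertex complete $(s+k-1)$-partite graph $T$ having $s-1$ parts of order $1$. (ii) Let $a$ be a positive integer and $F=K_{1,a,\dots,a}$ the complete $(k+1)$-partite graph with one part of order $1$ and $k$ parts of order $a$. Then for all sufficiently large $n$, $\mathrm{ex}_r(n,F)=e_r(T)$ for some $T\in\mathcal{T}_0(n,k,a-1)$. (iii) For all sufficiently large $n$, $\mathrm{ex}_r(n,B_{k+1,1})=e_r(T')$ for some $n$-vertex graph $T'$ obtained from a complete $k$-partite graph by adding one edge inside one of its parts.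
   Context: For a graph $G$ with degree sequence $d_1,\dots,d_n$, $e_r(G)=\sum_i d_i^r$; $\mathrm{ex}_r(n,F)$ is the maximum of $e_r(G)$ over $n$-vertex $F$-free graphs $G$. An edge of a graph is color-critical if deleting it decreases the chromatic number. A graph is almost $\ell$-regular if either every vertex has degree $\ell$, or one vertex has degree $\ell-1$ and all other vertices have degree $\ell$. $\mathcal{T}_0(n,k,a-1)$ is the family of $n$-vertex graphs obtained from a complete $k$-partite graph by adding an almost $(a-1)$-regular graph inside each part. $B_{k+1,1}$ denotes two copies of $K_{k+1}$ sharing exactly one vertex. *)

theory Defs
  imports "Graph_Theory.Graph_Theory" "HOL-Library.Disjoint_Sets"
begin

text \<open>
  A finite simple graph is a \<^locale>\<open>pair_graph\<close>: a finite, loop-free, symmetric digraph whose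
  arcs are pairs of vertices. An undirected edge \<open>uv\<close> is the pair of arcs \<open>(u,v)\<close>, \<open>(v,u)\<close>, so
  the degree of a vertex is its out-degree.
\<close>

definition deg :: "'a pair_pre_digraph \<Rightarrow> 'a \<Rightarrow> nat" where
  "deg G v = out_degree (with_proj G) v"

definition degree_power_sum :: "nat \<Rightarrow> 'a pair_pre_digraph \<Rightarrow> nat" where
  "degree_power_sum r G = (\<Sum>v\<in>pverts G. deg G v ^ r)"

text \<open>Containment means containment as a subgraph that need not be induced.\<close>

definition contains_copy :: "'a pair_pre_digraph \<Rightarrow> 'b pair_pre_digraph \<Rightarrow> bool" where
  "contains_copy G F \<longleftrightarrow>
     (\<exists>H :: 'a pair_pre_digraph. subgraph (with_proj H) (with_proj G) \<and>
        digraph_iso (with_proj F) (with_proj H))"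

lemma contains_copy_iff:
  assumes "pair_wf_digraph F" "pair_wf_digraph G"
  shows "contains_copy G F \<longleftrightarrow>
    (\<exists>f. inj_on f (pverts F) \<and> f ` pverts F \<subseteq> pverts G \<and>
      (\<forall>(u,v)\<in>parcs F. (f u, f v) \<in> parcs G))" (is "?L = ?R")
proof
  assume ?L
  then obtain H f where H: "subgraph (with_proj H) (with_proj G)" and f: "pre_digraph.digraph_isomorphism (with_proj F) f" "with_proj H = app_iso f (with_proj F)"
    unfolding contains_copy_def digraph_iso_def by blast
  have e: "iso_tail f = fst" "iso_head f = snd" "pverts H = iso_verts f ` pverts F" "parcs H = iso_arcs f ` parcs F"
    using f(2) by (auto simp: with_proj_def app_iso_def)
  have "(iso_verts f u, iso_verts f v) \<in> parcs G" if "(u,v) \<in> parcs F" for u v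
  proof -
    have "iso_arcs f (u,v) = (iso_verts f u, iso_verts f v)"
      using f(1) that e unfolding pre_digraph.digraph_isomorphism_def by (auto simp: prod_eq_iff)
    then show ?thesis using that e H by (metis imageI subgraph_def subsetD with_proj_simps(2))
  qed
  moreover have "inj_on (iso_verts f) (pverts F)" using f(1) unfolding pre_digraph.digraph_isomorphism_def by auto
  moreover have "pverts H \<subseteq> pverts G" using H by (auto simp: subgraph_def)
  ultimately show ?R using e by auto
next
  assume ?R
  then obtain f where f: "inj_on f (pverts F)" "f ` pverts F \<subseteq> pverts G" "\<forall>(u,v)\<in>parcs F. (f u, f v) \<in> parcs G" by blast
  interpret F: pair_wf_digraph F by fact
  let ?i = "\<lparr>iso_verts = f, iso_arcs = map_prod f f, iso_head = snd, iso_tail = fst\<rparr>"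
  let ?H = "\<lparr>pverts = f ` pverts F, parcs = map_prod f f ` parcs F\<rparr>"
  have "pre_digraph.digraph_isomorphism (with_proj F) ?i"
    unfolding pre_digraph.digraph_isomorphism_def
    using f F.in_arcsD1 F.in_arcsD2 F.wf_digraph_axioms
    by (auto simp: inj_on_def)
  moreover have "with_proj ?H = app_iso ?i (with_proj F)" by (auto simp: with_proj_def app_iso_def)
  moreover have "subgraph (with_proj ?H) (with_proj G)"
    using f assms F.in_arcsD1 F.in_arcsD2 unfolding subgraph_def wf_digraph_wp_iff
    by (auto simp: pair_wf_digraph_def dest: F.in_arcsD1 F.in_arcsD2)
  ultimately show ?L unfolding contains_copy_def digraph_iso_def by blast
qed

definition F_free :: "'b pair_pre_digraph \<Rightarrow> 'a pair_pre_digraph \<Rightarrow> bool" where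
  "F_free F G \<longleftrightarrow> \<not> contains_copy G F"

text \<open>
  Every finite graph is isomorphic to one with vertices in \<^typ>\<open>nat\<close>, so it suffices to let the
  maximum range over these.
\<close>

definition ex_power :: "nat \<Rightarrow> nat \<Rightarrow> 'b pair_pre_digraph \<Rightarrow> nat" where
  "ex_power r n F =
     Max {degree_power_sum r G | G :: nat pair_pre_digraph.
            pair_graph G \<and> card (pverts G) = n \<and> F_free F G}"

lemma finite_degree_power_sums:
  "finite {degree_power_sum r G | G :: nat pair_pre_digraph.
            pair_graph G \<and> card (pverts G) = n \<and> F_free F G}"
proof (rule finite_subset[of _ "{..n * n^r}"], safe, simp)
  fix G :: "nat pair_pre_digraph" assume g: "pair_graph G" "n = card (pverts G)" 
  then interpret pair_graph G by simp
  have "deg G v \<le> card (pverts G)" for v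
  proof -
    have "out_arcs (with_proj G) v \<subseteq> (Pair v) ` pverts G" by (auto simp: out_arcs_def image_iff dest: in_arcsD2)
    then show ?thesis unfolding deg_def out_degree_def
      by (metis card_image_le card_mono finite_imageI le_trans pair_finite_verts)
  qed
  then show "degree_power_sum r G \<le> card (pverts G) * card (pverts G) ^ r"
    unfolding degree_power_sum_def by (metis (no_types, lifting) sum_bounded_above power_mono zero_le of_nat_id)
qed

definition proper_coloring :: "'a pair_pre_digraph \<Rightarrow> nat \<Rightarrow> ('a \<Rightarrow> nat) \<Rightarrow> bool" where
  "proper_coloring G q c \<longleftrightarrow>
     (\<forall>v\<in>pverts G. c v < q) \<and> (\<forall>(u, v)\<in>parcs G. c u \<noteq> c v)"

definition chromatic_number :: "'a pair_pre_digraph \<Rightarrow> nat" where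
  "chromatic_number G = (LEAST q. \<exists>c. proper_coloring G q c)"

definition delete_edge :: "'a pair_pre_digraph \<Rightarrow> 'a \<Rightarrow> 'a \<Rightarrow> 'a pair_pre_digraph" where
  "delete_edge G u v = \<lparr>pverts = pverts G, parcs = parcs G - {(u, v), (v, u)}\<rparr>"

definition has_color_critical_edge :: "'a pair_pre_digraph \<Rightarrow> bool" where
  "has_color_critical_edge G \<longleftrightarrow>
     (\<exists>(u, v)\<in>parcs G. chromatic_number (delete_edge G u v) < chromatic_number G)"

definition components :: "'a pair_pre_digraph \<Rightarrow> 'a pair_pre_digraph set" where
  "components G =
     {C. pre_digraph.max_subgraph (with_proj G) Digraph_Component.connected (with_proj C)}"

text \<open>
  The complete multipartite graph with set of parts \<open>P\<close>. The parts are nonempty and pairwise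
  disjoint whenever \<^term>\<open>partition_on V P\<close> holds.
\<close>

definition complete_multipartite :: "'a set set \<Rightarrow> 'a pair_pre_digraph" where
  "complete_multipartite P =
     \<lparr>pverts = \<Union>P, parcs = {(u, v). \<exists>A\<in>P. \<exists>B\<in>P. A \<noteq> B \<and> u \<in> A \<and> v \<in> B}\<rparr>"

definition almost_regular :: "nat \<Rightarrow> 'a pair_pre_digraph \<Rightarrow> bool" where
  "almost_regular l G \<longleftrightarrow>
     (\<forall>v\<in>pverts G. deg G v = l) \<or>
     (\<exists>w\<in>pverts G. deg G w + 1 = l \<and> (\<forall>v\<in>pverts G - {w}. deg G v = l))"

text \<open>The family \<open>T\<^sub>0(n,k,l)\<close>; \<open>H A\<close> is the almost \<open>l\<close>-regular graph put inside the part \<open>A\<close>.\<close>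

definition T0_family :: "nat \<Rightarrow> nat \<Rightarrow> nat \<Rightarrow> 'a pair_pre_digraph set" where
  "T0_family n k l =
     {G. \<exists>V P H. finite V \<and> card V = n \<and> partition_on V P \<and> card P = k \<and>
        (\<forall>A\<in>P. pair_graph (H A) \<and> pverts (H A) = A \<and> almost_regular l (H A)) \<and>
        G = \<lparr>pverts = V,
             parcs = parcs (complete_multipartite P) \<union> (\<Union>A\<in>P. parcs (H A))\<rparr>}"

text \<open>\<open>F\<close> is a copy of \<open>K\<^bsub>1,a,\<dots>,a\<^esub>\<close> with \<open>k\<close> parts of order \<open>a\<close>.\<close>

definition is_K1_a :: "nat \<Rightarrow> nat \<Rightarrow> 'a pair_pre_digraph \<Rightarrow> bool" where
  "is_K1_a k a F \<longleftrightarrow>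
     (\<exists>P. finite (pverts F) \<and> partition_on (pverts F) P \<and> card P = k + 1 \<and>
        (\<exists>A\<in>P. card A = 1 \<and> (\<forall>B\<in>P - {A}. card B = a)) \<and>
        F = complete_multipartite P)"

text \<open>\<open>F\<close> is a copy of \<open>B\<^bsub>m,1\<^esub>\<close>, two copies of \<open>K\<^sub>m\<close> with exactly one common vertex.\<close>

definition is_B1 :: "nat \<Rightarrow> 'a pair_pre_digraph \<Rightarrow> bool" where
  "is_B1 m F \<longleftrightarrow>
     (\<exists>H1 H2 :: 'a pair_pre_digraph.
        complete_digraph m (with_proj H1) \<and> complete_digraph m (with_proj H2) \<and>
        card (pverts H1 \<inter> pverts H2) = 1 \<and>
        F = \<lparr>pverts = pverts H1 \<union> pverts H2, parcs = parcs H1 \<union> parcs H2\<rparr>)"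

definition add_edge :: "'a pair_pre_digraph \<Rightarrow> 'a \<Rightarrow> 'a \<Rightarrow> 'a pair_pre_digraph" where
  "add_edge G u v = \<lparr>pverts = pverts G, parcs = parcs G \<union> {(u, v), (v, u)}\<rparr>"

end

theory Submission
  imports Defs Complex_Main
begin

text \<open>
  Let \<open>G\<close> be an extremal graph. Few vertices lie in many copies of \<open>K\<^bsub>k+1\<^esub>\<close>, since a positive density of
  these gives a blow-up of \<open>K\<^bsub>k+1\<^esub>\<close> and hence a copy of \<open>F\<close>. Choosing repeatedly a vertex \<open>y\<close> of maximum
  degree among the remaining ones, splitting off its non-neighbours as a class and continuing inside its
  neighbourhood (Erdos's proof of Turan's theorem) yields a complete \<open>k\<close>-partite graph that majorises the
  degrees of \<open>G\<close> up to \<open>o(n)\<close>. As \<open>G\<close> is extremal, the two degree sequences almost agree, and Furedi's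
  counting then shows that \<open>G\<close> differs from the \<open>k\<close>-partite graph in \<open>o(n\<^sup>2)\<close> pairs; no regularity lemma
  is needed.

  All classes are linear in \<open>n\<close>, for otherwise moving a quarter of the largest class into a small one would
  increase the degree power sum. A vertex \<open>v\<close> with few neighbours in some class could be joined to the good
  vertices of all other classes without creating \<open>F\<close>, so by extremality it misses only few vertices there. Hence
  every vertex either is of this typical kind or has many neighbours in all classes (an apex). In
  this structure any graph that is \<open>k\<close>-colorable apart from a few prescribed vertices can be embedded greedily.
  This bounds the number of apices and the edges inside the classes in each of the three cases, and
  comparing degrees with the claimed extremal graph finishes the proof.
\<close>

text \<open>For \<open>r > 1\<close> the power sum is not determined by the number of edges, so edge
  counting alone gives no stability; pointwise majorisation of degrees is what lets one argument
  serve all exponents. Edges are ordered pairs, so each edge is counted twice.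

  The constants are fixed in the order \<kappa>, \<tau>, \<beta>, \<gamma>, \<epsilon>. The class
  size \<kappa> depends on \<open>k\<close> and \<open>r\<close> alone, and the defect \<tau> of a
  typical vertex is left to the caller, because the color-critical case balances a loss of order
  \<open>\<tau> * n ^ r\<close> against a gain of order \<open>(\<kappa> * n) ^ r\<close>.

  The graphs compared with the extremal graph at the end keep its colour classes, up to a bounded
  number of vertices. Class sizes are therefore never optimised, in accordance with the theorem,
  which asserts only that some partition occurs. In (ii) the competitor must itself be shown to be
  free: an arbitrary regular filling of the classes may contain \<open>F\<close>, so fillings
  without triangles and 4-cycles are constructed.\<close>

section \<open>Finite simple graphs as symmetric relations, and greedy embedding\<close>

locale sgraph =
  fixes V :: "'a set" and E :: "'a rel"
  assumes finite_V: "finite V" and E_subset: "E \<subseteq> V \<times> V" and sym_E: "sym E" and irrefl_E: "irrefl E"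
begin

lemma nbrs_subset: "E `` {v} \<subseteq> V"
  using E_subset by auto

lemma finite_nbrs [simp, intro]: "finite (E `` {v})"
  using nbrs_subset finite_V finite_subset by blast

lemma finite_E: "finite E"
  using E_subset finite_V finite_subset by blast

lemma degree_le: "card (E `` {v}) \<le> card V"
  by (simp add: card_mono finite_V nbrs_subset)

lemma E_sym: "(u, v) \<in> E \<Longrightarrow> (v, u) \<in> E"
  using sym_E by (auto dest: symD)

lemma E_irrefl: "(u, u) \<notin> E"
  using irrefl_E by (auto simp: irrefl_def)

end

text \<open>Choosing an image \<open>x\<close> removes from every other candidate set at most
  \<open>x\<close> itself and \<mu> non-neighbours of \<open>x\<close>, that is
  \<open>\<mu> + 1\<close> points, which is exactly the slack that the size hypothesis grants per
  vertex. Candidate sets may overlap, and the adjacency hypothesis is inherited by subsets, so the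
  induction can shrink them.\<close>

lemma greedy_embedding:
  fixes X :: "'b \<Rightarrow> 'a set" and \<mu> :: real
  assumes "finite Z" "sym E" "sym D" "irrefl D" "0 \<le> \<mu>"
    and "\<And>z. z \<in> Z \<Longrightarrow> finite (X z)"
    and "\<And>z. z \<in> Z \<Longrightarrow> card Z * (\<mu> + 1) \<le> card (X z)"
    and "\<And>z w x. \<lbrakk>z \<in> Z; w \<in> Z; (z, w) \<in> D; x \<in> X z\<rbrakk> \<Longrightarrow> card (X w - E `` {x}) \<le> \<mu>"
  shows "\<exists>f. inj_on f Z \<and> (\<forall>z\<in>Z. f z \<in> X z) \<and> (\<forall>z\<in>Z. \<forall>w\<in>Z. (z, w) \<in> D \<longrightarrow> (f z, f w) \<in> E)"
  using assms(1,6-8)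
proof (induction Z arbitrary: X rule: finite_induct)
  case empty
  then show ?case by auto
next
  case (insert z Z)
  have "0 < card (X z)"
  proof -
    have "0 < real (card (insert z Z)) * (\<mu> + 1)"
      using insert.hyps \<open>0 \<le> \<mu>\<close> by simp
    then show ?thesis using insert.prems(2)[of z] by simp
  qed
  then obtain x where x: "x \<in> X z" by (metis card_gt_0_iff ex_in_conv)
  define X' where "X' w = X w - ({x} \<union> (if (z, w) \<in> D then X w - E `` {x} else {}))" for w
  have "\<exists>f. inj_on f Z \<and> (\<forall>z\<in>Z. f z \<in> X' z) \<and> (\<forall>z\<in>Z. \<forall>w\<in>Z. (z, w) \<in> D \<longrightarrow> (f z, f w) \<in> E)"
  proof (rule insert.IH)
    fix w assume w: "w \<in> Z"
    show "finite (X' w)" using insert.prems(1)[of w] w by (auto simp: X'_def)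
    let ?R = "{x} \<union> (if (z, w) \<in> D then X w - E `` {x} else {})"
    have "finite ?R" using insert.prems(1)[of w] w by auto
    have "real (card ?R) \<le> 1 + \<mu>"
    proof -
      have "card ?R \<le> 1 + card (if (z, w) \<in> D then X w - E `` {x} else {})"
        using card_Un_le[of "{x}"] by (metis card_1_singleton_iff One_nat_def)
      moreover have "real (card (if (z, w) \<in> D then X w - E `` {x} else {})) \<le> \<mu>"
        using insert.prems(3)[of z w x] w x \<open>0 \<le> \<mu>\<close> by auto
      ultimately show ?thesis by linarith
    qed
    moreover have "card (X w) - card ?R \<le> card (X' w)"
      unfolding X'_def using \<open>finite ?R\<close> by (rule diff_card_le_card_Diff)
    ultimately have "real (card (X w)) - (1 + \<mu>) \<le> card (X' w)" by linarith
    moreover have "real (card Z + 1) * (\<mu> + 1) \<le> card (X w)"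
      using insert.prems(2)[of w] w insert.hyps by simp
    ultimately show "real (card Z) * (\<mu> + 1) \<le> card (X' w)"
      by (simp add: algebra_simps)
  next
    fix w1 w2 y assume a: "w1 \<in> Z" "w2 \<in> Z" "(w1, w2) \<in> D" "y \<in> X' w1"
    have "card (X' w2 - E `` {y}) \<le> card (X w2 - E `` {y})"
      using insert.prems(1)[of w2] a by (intro card_mono) (auto simp: X'_def)
    also have "real \<dots> \<le> \<mu>" using insert.prems(3)[of w1 w2 y] a by (auto simp: X'_def)
    finally show "real (card (X' w2 - E `` {y})) \<le> \<mu>" by simp
  qed
  then obtain f where f: "inj_on f Z" "\<forall>z\<in>Z. f z \<in> X' z"
    "\<forall>z\<in>Z. \<forall>w\<in>Z. (z, w) \<in> D \<longrightarrow> (f z, f w) \<in> E" by blast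
  let ?g = "f(z := x)"
  have x_adj: "(x, f w) \<in> E" if "w \<in> Z" "(z, w) \<in> D" for w
    using f(2) that by (auto simp: X'_def)
  have "inj_on ?g (insert z Z)"
    using f insert.hyps by (auto simp: X'_def inj_on_def)
  moreover have "\<forall>w\<in>insert z Z. ?g w \<in> X w"
    using f x by (auto simp: X'_def)
  moreover have "\<forall>w1\<in>insert z Z. \<forall>w2\<in>insert z Z. (w1, w2) \<in> D \<longrightarrow> (?g w1, ?g w2) \<in> E"
    using f(3) x_adj insert.hyps assms(2-4) unfolding sym_def irrefl_def
    by (metis fun_upd_apply insert_iff)
  ultimately show ?case by blast
qed

section \<open>Cliques and blow-ups\<close>

text \<open>Cliques are ordered: \<open>sorted_wrt\<close> relates each entry to all later ones, and
  lists, unlike sets, split uniquely into a head and a tail, so that counts become sums.\<close>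

definition cliques :: "'a rel \<Rightarrow> nat \<Rightarrow> 'a set \<Rightarrow> 'a list set" where
  "cliques E k U = {xs. length xs = k \<and> set xs \<subseteq> U \<and> sorted_wrt (\<lambda>x y. (x, y) \<in> E) xs}"

lemma finite_cliques: "finite U \<Longrightarrow> finite (cliques E k U)"
  by (rule finite_subset[OF _ finite_lists_length_eq[of U k]]) (auto simp: cliques_def)

lemma card_cliques_le: "finite U \<Longrightarrow> card (cliques E k U) \<le> card U ^ k"
  using card_mono[OF finite_lists_length_eq[of U k], of "cliques E k U"]
  by (auto simp: cliques_def card_lists_length_eq)

lemma cliques_Suc:
  "cliques E (Suc k) U = (\<lambda>(v, xs). v # xs) ` (SIGMA v:U. cliques E k (U \<inter> E `` {v}))"
proof (intro set_eqI iffI)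
  fix xs assume "xs \<in> cliques E (Suc k) U"
  then show "xs \<in> (\<lambda>(v, xs). v # xs) ` (SIGMA v:U. cliques E k (U \<inter> E `` {v}))"
    by (cases xs) (auto simp: cliques_def image_iff)
qed (auto simp: cliques_def)

lemma card_cliques_Suc:
  assumes "finite U"
  shows "card (cliques E (Suc k) U) = (\<Sum>v\<in>U. card (cliques E k (U \<inter> E `` {v})))"
  unfolding cliques_Suc
  by (subst card_image) (auto simp: inj_on_def assms finite_cliques)

text \<open>The same lists split by tail: each tail is counted with the vertices that extend it.
  Peeling off the head suits the recursion of \<open>rich\<close>; this form suits double counting
  against \<open>t\<close>-sets of extensions.\<close>

lemma card_cliques_Suc':
  assumes "finite U"
  shows "card (cliques E (Suc k) U) = (\<Sum>xs\<in>cliques E k U. card {v \<in> U. set xs \<subseteq> E `` {v}})"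
proof -
  have "cliques E (Suc k) U = (\<lambda>(xs, v). v # xs) ` (SIGMA xs:cliques E k U. {v \<in> U. set xs \<subseteq> E `` {v}})"
  proof (intro set_eqI iffI)
    fix xs assume "xs \<in> cliques E (Suc k) U"
    then show "xs \<in> (\<lambda>(xs, v). v # xs) ` (SIGMA xs:cliques E k U. {v \<in> U. set xs \<subseteq> E `` {v}})"
      by (cases xs) (auto simp: cliques_def image_iff)
  qed (auto simp: cliques_def)
  then show ?thesis
    by (simp only:) (subst card_image, auto simp: inj_on_def assms finite_cliques)
qed

text \<open>Erdos's double counting: there are so many pairs of a \<open>k\<close>-clique and a
  \<open>t\<close>-set of vertices extending it that one \<open>t\<close>-set \<open>Y\<close>
  extends at least \<open>\<delta>' * n ^ k\<close> cliques. \<open>Y\<close> is one part, and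
  induction in its common neighbourhood yields the others. The density is measured against
  \<open>card V\<close> and not \<open>card U\<close>, so that passing to a subset costs
  nothing.\<close>

lemma blowup_of_many_cliques:
  fixes \<delta> :: real
  assumes "0 < \<delta>" "0 < t"
  shows "\<exists>n0. \<forall>(V :: 'a set) E U. sgraph V E \<longrightarrow> U \<subseteq> V \<longrightarrow> n0 \<le> card V \<longrightarrow>
     \<delta> * real (card V) ^ k \<le> card (cliques E k U) \<longrightarrow>
     (\<exists>B. (\<forall>i<k. B i \<subseteq> U \<and> card (B i) = t) \<and> (\<forall>i<k. \<forall>j<k. i \<noteq> j \<longrightarrow> B i \<times> B j \<subseteq> E))"
  using assms(1)
proof (induction k arbitrary: \<delta>)
  case 0
  then show ?case by auto
next
  case (Suc k)
  \<comment> \<open>At least \<open>\<delta> / 2 * n ^ k\<close> cliques have at least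
    \<open>\<delta> * n / 2\<close> extensions, and each of these contributes
    \<open>(\<delta> * n / (2 * t)) ^ t\<close> sets \<open>Y\<close>, by
    \<open>(x / t) ^ t \<le> x choose t\<close>. At most \<open>n ^ t\<close> sets share
    them.\<close>
  define \<delta>' where "\<delta>' = \<delta> / 2 * (\<delta> / (2 * t)) ^ t"
  have "0 < \<delta>'" using Suc.prems \<open>0 < t\<close> by (simp add: \<delta>'_def)
  from Suc.IH[OF this] obtain n1 where n1: "\<And>(V :: 'a set) E U. sgraph V E \<Longrightarrow> U \<subseteq> V \<Longrightarrow> n1 \<le> card V \<Longrightarrow>
     \<delta>' * real (card V) ^ k \<le> card (cliques E k U) \<Longrightarrow>
     (\<exists>B. (\<forall>i<k. B i \<subseteq> U \<and> card (B i) = t) \<and> (\<forall>i<k. \<forall>j<k. i \<noteq> j \<longrightarrow> B i \<times> B j \<subseteq> E))"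
    by blast
  define n0 where "n0 = max 1 (max n1 (nat \<lceil>2 * t / \<delta>\<rceil>))"
  show ?case
  proof (intro exI[of _ n0] allI impI)
    fix V :: "'a set" and E U
    assume a: "sgraph V E" "U \<subseteq> V" "n0 \<le> card V" "\<delta> * real (card V) ^ Suc k \<le> card (cliques E (Suc k) U)"
    interpret sgraph V E by fact
    let ?n = "real (card V)"
    have n: "1 \<le> ?n" "n1 \<le> card V" "2 * t / \<delta> \<le> ?n"
      using a(3) unfolding n0_def by (auto simp: le_nat_iff)
    have finU: "finite U" using a(2) finite_V finite_subset by blast
    have cardU: "card U \<le> card V" using a(2) finite_V card_mono by blast
    define ext where "ext xs = {v \<in> U. set xs \<subseteq> E `` {v}}" for xs
    have finext: "finite (ext xs)" for xs using finU by (simp add: ext_def)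
    have ext_le: "real (card (ext xs)) \<le> ?n" for xs
      using card_mono[OF finU, of "ext xs"] cardU by (force simp: ext_def)
    define C where "C = cliques E k U"
    have finC: "finite C" using finU by (simp add: C_def finite_cliques)
    have "card C \<le> card V ^ k"
      using card_cliques_le[OF finU, of E k] power_mono[OF cardU, of k] by (simp add: C_def)
    then have cardC: "real (card C) \<le> ?n ^ k" by (metis of_nat_le_iff of_nat_power)
    \<comment> \<open>Cliques outside \<open>C1\<close> account for at most half of the count, and a
      clique in \<open>C1\<close> has at most \<open>n\<close> extensions; this bounds
      \<open>card C1\<close> from below.\<close>
    define C1 where "C1 = {xs \<in> C. \<delta> / 2 * ?n \<le> card (ext xs)}"
    have C1: "C1 \<subseteq> C" "finite C1" using finC by (auto simp: C1_def)
    have "\<delta> * ?n ^ Suc k \<le> (\<Sum>xs\<in>C. real (card (ext xs)))"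
      using a(4) unfolding card_cliques_Suc'[OF finU] C_def ext_def by simp
    also have "\<dots> = (\<Sum>xs\<in>C1. real (card (ext xs))) + (\<Sum>xs\<in>C - C1. real (card (ext xs)))"
      using C1 finC by (metis add.commute sum.subset_diff)
    also have "(\<Sum>xs\<in>C1. real (card (ext xs))) \<le> real (card C1) * ?n"
      using sum_bounded_above[of C1 "\<lambda>xs. real (card (ext xs))" ?n] ext_le by simp
    also have "(\<Sum>xs\<in>C - C1. real (card (ext xs))) \<le> real (card (C - C1)) * (\<delta> / 2 * ?n)"
      by (rule sum_bounded_above) (auto simp: C1_def)
    also have "\<dots> \<le> ?n ^ k * (\<delta> / 2 * ?n)"
      using cardC card_mono[OF finC, of "C - C1"] Suc.prems
      by (intro mult_right_mono) (auto intro: order_trans[of _ "real (card C)"])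
    finally have "(\<delta> / 2 * ?n ^ k) * ?n \<le> real (card C1) * ?n"
      by (simp add: algebra_simps)
    then have C1_ge: "\<delta> / 2 * ?n ^ k \<le> card C1" using n(1) by simp
    define \<Y> where "\<Y> = {Y. Y \<subseteq> U \<and> card Y = t}"
    have fin\<Y>: "finite \<Y>" using finU by (simp add: \<Y>_def)
    have "card \<Y> = card U choose t" unfolding \<Y>_def using n_subsets[OF finU] by simp
    also have "\<dots> \<le> card U ^ t"
      by (cases "t \<le> card U") (auto simp: binomial_le_pow binomial_eq_0)
    also have "\<dots> \<le> card V ^ t" using cardU by (simp add: power_mono)
    finally have card\<Y>: "real (card \<Y>) \<le> ?n ^ t" by (metis of_nat_le_iff of_nat_power)
    define nb where "nb Y = U \<inter> (\<Inter>v\<in>Y. E `` {v})" for Y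
    have "\<exists>Y\<in>\<Y>. \<delta>' * ?n ^ k \<le> card (cliques E k (nb Y))"
    proof (rule ccontr)
      assume "\<not> ?thesis"
      then have less: "\<And>Y. Y \<in> \<Y> \<Longrightarrow> real (card (cliques E k (nb Y))) < \<delta>' * ?n ^ k" by force
      have "real (card C1) * (\<delta> * ?n / (2 * t)) ^ t \<le> (\<Sum>xs\<in>C1. real (card {Y. Y \<subseteq> ext xs \<and> card Y = t}))"
      proof (rule sum_bounded_below)
        fix xs assume xs: "xs \<in> C1"
        have b: "\<delta> / 2 * ?n \<le> card (ext xs)" using xs by (simp add: C1_def)
        have "real t \<le> \<delta> / 2 * ?n" using n(3) Suc.prems by (simp add: field_simps)
        then have "t \<le> card (ext xs)" using b by linarith
        then have "(real (card (ext xs)) / t) ^ t \<le> real (card (ext xs) choose t)"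
          using binomial_ge_n_over_k_pow_k[of t "card (ext xs)", where 'a = real] by simp
        moreover have "(\<delta> * ?n / (2 * t)) ^ t \<le> (real (card (ext xs)) / t) ^ t"
          using b Suc.prems \<open>0 < t\<close> by (intro power_mono) (auto simp: field_simps)
        ultimately show "(\<delta> * ?n / (2 * t)) ^ t \<le> real (card {Y. Y \<subseteq> ext xs \<and> card Y = t})"
          using n_subsets[OF finext, of xs t] by simp
      qed
      also have "\<dots> = real (card (SIGMA xs:C1. {Y. Y \<subseteq> ext xs \<and> card Y = t}))"
        using C1 finext by (simp add: card_SigmaI)
      also have "\<dots> \<le> real (card (SIGMA Y:\<Y>. cliques E k (nb Y)))"
      proof -
        have "prod.swap ` (SIGMA xs:C1. {Y. Y \<subseteq> ext xs \<and> card Y = t}) \<subseteq> (SIGMA Y:\<Y>. cliques E k (nb Y))"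
        proof (rule image_subsetI)
          fix p assume "p \<in> (SIGMA xs:C1. {Y. Y \<subseteq> ext xs \<and> card Y = t})"
          then obtain xs Y where p: "p = (xs, Y)" "xs \<in> C1" "Y \<subseteq> ext xs" "card Y = t" by auto
          then have "set xs \<subseteq> nb Y" "Y \<subseteq> U" "xs \<in> C"
            unfolding C1_def C_def cliques_def nb_def ext_def by blast+
          then show "prod.swap p \<in> (SIGMA Y:\<Y>. cliques E k (nb Y))"
            using p by (simp add: \<Y>_def C_def cliques_def)
        qed
        moreover have "finite (SIGMA Y:\<Y>. cliques E k (nb Y))"
          using fin\<Y> finU by (intro finite_SigmaI finite_cliques) (auto simp: nb_def)
        ultimately have "card (prod.swap ` (SIGMA xs:C1. {Y. Y \<subseteq> ext xs \<and> card Y = t})) \<le> card (SIGMA Y:\<Y>. cliques E k (nb Y))"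
          by (intro card_mono)
        then show ?thesis
          by (subst (asm) card_image) (auto intro: inj_on_subset[OF inj_swap])
      qed
      also have "\<dots> = (\<Sum>Y\<in>\<Y>. real (card (cliques E k (nb Y))))"
        using fin\<Y> finU by (subst card_SigmaI) (auto simp: nb_def intro: finite_cliques)
      finally have le: "real (card C1) * (\<delta> * ?n / (2 * t)) ^ t \<le> (\<Sum>Y\<in>\<Y>. real (card (cliques E k (nb Y))))" .
      have pos: "0 < (\<delta> / 2 * ?n ^ k) * (\<delta> * ?n / (2 * t)) ^ t"
        using Suc.prems n(1) \<open>0 < t\<close> by simp
      have eq: "(\<delta> / 2 * ?n ^ k) * (\<delta> * ?n / (2 * t)) ^ t = ?n ^ t * (\<delta>' * ?n ^ k)"
        by (simp add: \<delta>'_def power_divide power_mult_distrib)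
      have le2: "(\<delta> / 2 * ?n ^ k) * (\<delta> * ?n / (2 * t)) ^ t \<le> real (card C1) * (\<delta> * ?n / (2 * t)) ^ t"
        using C1_ge Suc.prems by (intro mult_right_mono) auto
      then have "\<Y> \<noteq> {}" using le pos by auto
      then have "(\<Sum>Y\<in>\<Y>. real (card (cliques E k (nb Y)))) < (\<Sum>Y\<in>\<Y>. \<delta>' * ?n ^ k)"
        using less fin\<Y> by (intro sum_strict_mono) auto
      also have "\<dots> \<le> ?n ^ t * (\<delta>' * ?n ^ k)"
        using card\<Y> \<open>0 < \<delta>'\<close> by (auto intro!: mult_right_mono)
      finally show False using le le2 eq by linarith
    qed
    then obtain Y where Y: "Y \<subseteq> U" "card Y = t" "\<delta>' * ?n ^ k \<le> card (cliques E k (nb Y))"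
      by (auto simp: \<Y>_def)
    have "nb Y \<subseteq> V" using a(2) by (auto simp: nb_def)
    from n1[OF a(1) this n(2) Y(3)] obtain B where
      B: "\<forall>i<k. B i \<subseteq> nb Y \<and> card (B i) = t" "\<forall>i<k. \<forall>j<k. i \<noteq> j \<longrightarrow> B i \<times> B j \<subseteq> E"
      by blast
    have YB: "Y \<times> B i \<subseteq> E" if "i < k" for i using B(1) that by (auto simp: nb_def)
    then have BY: "B i \<times> Y \<subseteq> E" if "i < k" for i using that E_sym by blast
    show "\<exists>B. (\<forall>i<Suc k. B i \<subseteq> U \<and> card (B i) = t) \<and> (\<forall>i<Suc k. \<forall>j<Suc k. i \<noteq> j \<longrightarrow> B i \<times> B j \<subseteq> E)"
    proof (intro exI[of _ "case_nat Y B"] conjI allI impI)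
      fix i assume "i < Suc k"
      then show "case_nat Y B i \<subseteq> U" "card (case_nat Y B i) = t"
        using Y B(1) by (auto simp: nb_def split: nat.splits)
      fix j assume "j < Suc k" "i \<noteq> j"
      then show "case_nat Y B i \<times> case_nat Y B j \<subseteq> E"
        using \<open>i < Suc k\<close> YB BY B(2) by (cases i; cases j; simp)
    qed
  qed
qed

section \<open>Hereditary richness\<close>

text \<open>A recursive substitute for having many \<open>k\<close>-cliques. If \<open>U\<close> is
  not rich at level \<open>k + 1\<close>, then deleting fewer than \<open>m\<close> vertices leaves
  only vertices whose neighbourhoods in \<open>U\<close> are not rich at level \<open>k\<close>,
  with the same \<open>m\<close>; a bare bound on the number of cliques would lose density in each
  such step.\<close>

primrec rich :: "'a rel \<Rightarrow> real \<Rightarrow> nat \<Rightarrow> 'a set \<Rightarrow> bool" where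
  "rich E m 0 U \<longleftrightarrow> True"
| "rich E m (Suc k) U \<longleftrightarrow> m \<le> card {v \<in> U. rich E m k (U \<inter> E `` {v})}"

lemma rich_mono:
  assumes "rich E m k U" "U \<subseteq> U'" "finite U'"
  shows "rich E m k U'"
  using assms
proof (induction k arbitrary: U U')
  case (Suc k)
  have "{v \<in> U. rich E m k (U \<inter> E `` {v})} \<subseteq> {v \<in> U'. rich E m k (U' \<inter> E `` {v})}"
    using Suc.prems Suc.IH[of "U \<inter> E `` {v}" "U' \<inter> E `` {v}" for v] by auto
  then have "card {v \<in> U. rich E m k (U \<inter> E `` {v})} \<le> card {v \<in> U'. rich E m k (U' \<inter> E `` {v})}"
    using Suc.prems by (intro card_mono) auto
  then show ?case using Suc.prems(1) by simp
qed simp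

lemma rich_imp_many_cliques:
  assumes "rich E m k U" "finite U" "0 \<le> m"
  shows "m ^ k \<le> card (cliques E k U)"
  using assms(1,2)
proof (induction k arbitrary: U)
  case 0
  have "cliques E 0 U = {[]}" by (auto simp: cliques_def)
  then show ?case by simp
next
  case (Suc k)
  let ?R = "{v \<in> U. rich E m k (U \<inter> E `` {v})}"
  have "m ^ Suc k \<le> card ?R * m ^ k"
    using Suc.prems assms(3) by (auto intro: mult_right_mono)
  also have "\<dots> \<le> (\<Sum>v\<in>?R. real (card (cliques E k (U \<inter> E `` {v}))))"
    using Suc.IH Suc.prems by (intro sum_bounded_below) auto
  also have "\<dots> \<le> (\<Sum>v\<in>U. real (card (cliques E k (U \<inter> E `` {v}))))"
    using Suc.prems by (intro sum_mono2) auto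
  finally show ?case by (simp add: card_cliques_Suc[OF Suc.prems(2)])
qed

section \<open>Stability\<close>

context sgraph
begin

text \<open>Let \<open>y\<close> have maximum degree in \<open>U\<close> among the unspoilt
  vertices. Its non-neighbours \<open>A\<close> form a class: their degrees are at most that of
  \<open>y\<close>, which is at most \<open>card U - card A\<close>. The rest lies in the
  neighbourhood of \<open>y\<close>, which fails to be rich one level lower. The last conclusion is
  Furedi's inequality between edges inside classes and missing edges across them. Each passage from
  \<open>k\<close> to \<open>k + 1\<close> adds \<open>2 * (k + 2)\<close> to its error coefficient,
  which sums to \<open>(k + 1) * (k + 2)\<close>.\<close>

lemma greedy_partition:
  fixes m :: real
  assumes "0 \<le> m" "U \<subseteq> V" "\<not> rich E m (Suc k) U"
  shows "\<exists>X c. X \<subseteq> U \<and> (\<forall>v\<in>X. c v < k) \<and> card (U - X) \<le> (real k + 1) * m \<and>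
     (\<forall>v\<in>X. card (U \<inter> E `` {v}) + card {u\<in>X. c u = c v} \<le> card U + real k * m) \<and>
     2 * card {(u, v) \<in> E. u \<in> X \<and> v \<in> X \<and> c u = c v}
       \<le> card {(u, v). u \<in> X \<and> v \<in> X \<and> c u \<noteq> c v \<and> (u, v) \<notin> E} + (real k + 1) * (real k + 2) * m * card V"
  using assms(2,3)
proof (induction k arbitrary: U)
  case 0
  then show ?case using assms(1) by (intro exI[of _ "{}"]) auto
next
  case (Suc k)
  have finU: "finite U" using Suc.prems(1) finite_V finite_subset by blast
  \<comment> \<open>Spoilt vertices: there are fewer than \<open>m\<close>, and the partition leaves
    them out.\<close>
  define D where "D = {v \<in> U. rich E m (Suc k) (U \<inter> E `` {v})}"
  have cardD: "card D < m" using Suc.prems(2) by (simp add: D_def)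
  have finD: "finite D" using finU by (simp add: D_def)
  show ?case
  proof (cases "U - D = {}")
    \<comment> \<open>If all vertices are spoilt, \<open>U\<close> itself is small enough to be left
      over.\<close>
    case True
    then have "U = D" by (auto simp: D_def)
    then have "card U \<le> (real (Suc k) + 1) * m"
      using cardD assms(1) by (simp add: algebra_simps add_increasing)
    then show ?thesis using assms(1) by (intro exI[of _ "{}"]) auto
  next
    case False
    define d where "d v = card (U \<inter> E `` {v})" for v
    have "Max (d ` (U - D)) \<in> d ` (U - D)" using False finU by (intro Max_in) auto
    then obtain y where y: "y \<in> U" "y \<notin> D" "d y = Max (d ` (U - D))" by force
    have dy: "d v \<le> d y" if "v \<in> U - D" for v
      unfolding y(3) using that finU by (intro Max_ge) auto
    define A where "A = U - D - E `` {y}"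
    define U' where "U' = U \<inter> E `` {y} - D"
    have finA: "finite A" "finite U'" using finU by (auto simp: A_def U'_def)
    have "\<not> rich E m (Suc k) (U \<inter> E `` {y})" using y by (simp add: D_def)
    then have "\<not> rich E m (Suc k) U'"
      using rich_mono[of E m "Suc k" U' "U \<inter> E `` {y}"] finU by (auto simp: U'_def)
    moreover have "U' \<subseteq> V" using Suc.prems(1) by (auto simp: U'_def)
    ultimately obtain X' c' where IH: "X' \<subseteq> U'" "\<forall>v\<in>X'. c' v < k" "card (U' - X') \<le> (real k + 1) * m"
      "\<forall>v\<in>X'. card (U' \<inter> E `` {v}) + card {u\<in>X'. c' u = c' v} \<le> card U' + real k * m"
      "2 * card {(u, v) \<in> E. u \<in> X' \<and> v \<in> X' \<and> c' u = c' v}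
       \<le> card {(u, v). u \<in> X' \<and> v \<in> X' \<and> c' u \<noteq> c' v \<and> (u, v) \<notin> E} + (real k + 1) * (real k + 2) * m * card V"
      using Suc.IH[of U'] by blast
    define X where "X = A \<union> X'"
    define c where "c v = (if v \<in> A then 0 else Suc (c' v))" for v
    have disj: "A \<inter> U' = {}" "A \<inter> X' = {}" using IH(1) by (auto simp: A_def U'_def)
    have finX': "finite X'" using IH(1) finA finite_subset by blast
    have sub: "X \<subseteq> U" using IH(1) by (auto simp: X_def A_def U'_def)
    have cX': "c v = Suc (c' v)" if "v \<in> X'" for v using that disj by (auto simp: c_def)
    have cA: "c v = 0" if "v \<in> A" for v using that by (simp add: c_def)
    have cardAU: "card A + card U' \<le> card U"
    proof -
      have "A \<union> U' \<subseteq> U" by (auto simp: A_def U'_def)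
      then have "card (A \<union> U') \<le> card U" using finU by (intro card_mono)
      then show ?thesis using disj finA by (simp add: card_Un_disjoint)
    qed
    have 1: "card (U - X) \<le> (real (Suc k) + 1) * m"
    proof -
      have "U - X = D \<union> (U' - X')" using IH(1) by (auto simp: X_def A_def U'_def D_def)
      then have "card (U - X) \<le> card D + card (U' - X')" by (simp add: card_Un_le)
      then show ?thesis using IH(3) cardD by (simp add: algebra_simps)
    qed
    have 2: "card (U \<inter> E `` {v}) + card {u\<in>X. c u = c v} \<le> card U + real (Suc k) * m" if "v \<in> X" for v
    proof (cases "v \<in> A")
      case True
      then have eq: "{u\<in>X. c u = c v} = A" using cX' by (auto simp: X_def cA)
      have "card (U \<inter> E `` {v}) \<le> card (U \<inter> E `` {y})"
        using dy[of v] True by (simp add: d_def A_def)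
      moreover have "card (U \<inter> E `` {y}) + card A \<le> card U"
        using card_mono[of U "(U \<inter> E `` {y}) \<union> A"] finU finA
        by (subst card_Un_disjoint[symmetric]) (auto simp: A_def)
      moreover have "0 \<le> real (Suc k) * m" using assms(1) by simp
      ultimately show ?thesis unfolding eq by linarith
    next
      case False
      then have v: "v \<in> X'" using that by (simp add: X_def)
      then have eq: "{u\<in>X. c u = c v} = {u\<in>X'. c' u = c' v}" using cX' by (auto simp: X_def cA)
      have "card (U \<inter> E `` {v}) \<le> card (U' \<inter> E `` {v}) + card A + card D"
      proof -
        have "U \<inter> E `` {v} \<subseteq> (U' \<inter> E `` {v}) \<union> A \<union> D" by (auto simp: A_def U'_def)
        then have "card (U \<inter> E `` {v}) \<le> card ((U' \<inter> E `` {v}) \<union> A \<union> D)"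
          using finA finD by (intro card_mono) auto
        also have "\<dots> \<le> card (U' \<inter> E `` {v}) + card A + card D"
          by (meson add_mono_thms_linordered_semiring(3) card_Un_le order_trans)
        finally show ?thesis .
      qed
      moreover have "card (U' \<inter> E `` {v}) + card {u\<in>X'. c' u = c' v} \<le> card U' + real k * m"
        using IH(4) v by blast
      moreover have "real (Suc k) * m = real k * m + m" by (simp add: algebra_simps)
      ultimately show ?thesis unfolding eq using cardAU cardD by linarith
    qed
    define In0 In' M1 M' where "In0 = E \<inter> A \<times> A" and "In' = {(u, v) \<in> E. u \<in> X' \<and> v \<in> X' \<and> c' u = c' v}"
      and "M1 = A \<times> X' - E" and "M' = {(u, v). u \<in> X' \<and> v \<in> X' \<and> c' u \<noteq> c' v \<and> (u, v) \<notin> E}"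
    have finM: "finite M1" "finite M'"
      using finA finX' by (auto simp: M1_def M'_def intro: finite_subset[of _ "X' \<times> X'"])
    have "{(u, v) \<in> E. u \<in> X \<and> v \<in> X \<and> c u = c v} = In0 \<union> In'"
      using cX' disj by (auto simp: X_def In0_def In'_def cA)
    then have in_le: "card {(u, v) \<in> E. u \<in> X \<and> v \<in> X \<and> c u = c v} \<le> card In0 + card In'"
      by (simp add: card_Un_le)
    have "{(u, v). u \<in> X \<and> v \<in> X \<and> c u \<noteq> c v \<and> (u, v) \<notin> E} = M1 \<union> M1\<inverse> \<union> M'"
      using cX' disj E_sym by (auto simp: X_def M1_def M'_def cA)
    moreover have "card (M1 \<union> M1\<inverse> \<union> M') = card (M1 \<union> M1\<inverse>) + card M'"
      using finM disj by (intro card_Un_disjoint) (auto simp: M1_def M'_def)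
    moreover have "card (M1 \<union> M1\<inverse>) = card M1 + card (M1\<inverse>)"
      using finM disj by (intro card_Un_disjoint) (auto simp: M1_def)
    ultimately have miss_eq: "card {(u, v). u \<in> X \<and> v \<in> X \<and> c u \<noteq> c v \<and> (u, v) \<notin> E} = 2 * card M1 + card M'"
      by simp
    \<comment> \<open>The degrees of \<open>A\<close> sum to at most \<open>card A * d y\<close>,
      which is about \<open>card A * card X'\<close>. They count the ordered pairs inside
      \<open>A\<close> and the edges from \<open>A\<close> to \<open>X'\<close>, so pairs inside
      \<open>A\<close> are paid for by missing pairs between \<open>A\<close> and \<open>X'\<close>.
      The factor 2 in the claim comes from \<open>M1\<close> occurring in both directions.\<close>
    have in0: "card In0 \<le> card M1 + (real k + 2) * m * card V"
    proof -
      have "card In0 + card (E \<inter> A \<times> X') = card (In0 \<union> (E \<inter> A \<times> X'))"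
        using finA finX' disj by (intro card_Un_disjoint[symmetric]) (auto simp: In0_def)
      also have "\<dots> \<le> card (SIGMA v:A. U \<inter> E `` {v})"
        using finA finU IH(1) by (intro card_mono finite_SigmaI) (auto simp: In0_def A_def U'_def)
      also have "\<dots> = (\<Sum>v\<in>A. d v)" using finA finU by (simp add: card_SigmaI d_def)
      also have "\<dots> \<le> card A * d y"
        using sum_bounded_above[of A d "d y"] dy by (auto simp: A_def)
      finally have a: "real (card In0) + card (E \<inter> A \<times> X') \<le> card A * real (d y)"
        by (metis of_nat_add of_nat_le_iff of_nat_mult)
      have "U \<inter> E `` {y} \<subseteq> X' \<union> (U' - X') \<union> D" by (auto simp: U'_def)
      then have "d y \<le> card (X' \<union> (U' - X') \<union> D)"
        using finX' finA finD by (auto simp: d_def intro: card_mono)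
      also have "\<dots> \<le> card X' + card (U' - X') + card D"
        by (meson add_mono_thms_linordered_semiring(3) card_Un_le order_trans)
      finally have "d y \<le> card X' + (real k + 2) * m"
        using IH(3) cardD by (simp add: algebra_simps)
      then have "card A * real (d y) \<le> card A * (card X' + (real k + 2) * m)"
        by (intro mult_left_mono) auto
      also have "\<dots> = card (A \<times> X') + card A * ((real k + 2) * m)"
        by (simp add: card_cartesian_product algebra_simps)
      also have "A \<times> X' = M1 \<union> (E \<inter> A \<times> X')" by (auto simp: M1_def)
      also have "card (M1 \<union> (E \<inter> A \<times> X')) = card M1 + card (E \<inter> A \<times> X')"
        using finM finA finX' by (intro card_Un_disjoint) (auto simp: M1_def)
      finally have "card A * real (d y) \<le> card M1 + card (E \<inter> A \<times> X') + card A * ((real k + 2) * m)"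
        by simp
      moreover have "card A * ((real k + 2) * m) \<le> card V * ((real k + 2) * m)"
      proof (intro mult_right_mono)
        show "real (card A) \<le> real (card V)"
          using Suc.prems(1) finite_V by (auto simp: A_def intro: card_mono)
      qed (use assms(1) in auto)
      ultimately show ?thesis using a by (simp add: algebra_simps)
    qed
    have 3: "2 * card {(u, v) \<in> E. u \<in> X \<and> v \<in> X \<and> c u = c v}
       \<le> card {(u, v). u \<in> X \<and> v \<in> X \<and> c u \<noteq> c v \<and> (u, v) \<notin> E} + (real (Suc k) + 1) * (real (Suc k) + 2) * m * card V"
      using in_le in0 IH(5) unfolding miss_eq In'_def[symmetric] M'_def[symmetric]
      by (simp add: algebra_simps)
    show ?thesis
    proof (intro exI[of _ X] exI[of _ c] conjI)
      show "\<forall>v\<in>X. c v < Suc k" using IH(2) cX' by (auto simp: X_def cA)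
    qed (use sub 1 2 3 in auto)
  qed
qed

end

section \<open>Embeddings, colourings and degree power sums\<close>

definition embeds :: "'b set \<Rightarrow> 'b rel \<Rightarrow> 'a set \<Rightarrow> 'a rel \<Rightarrow> bool" where
  "embeds VF EF V E \<longleftrightarrow> (\<exists>f. inj_on f VF \<and> f ` VF \<subseteq> V \<and> (\<forall>(u, v)\<in>EF. (f u, f v) \<in> E))"

definition colorable :: "'b set \<Rightarrow> 'b rel \<Rightarrow> nat \<Rightarrow> bool" where
  "colorable VF EF q \<longleftrightarrow> (\<exists>c. (\<forall>v\<in>VF. c v < q) \<and> (\<forall>(u, v)\<in>EF. c u \<noteq> c v))"

definition power_sum :: "nat \<Rightarrow> 'a set \<Rightarrow> 'a rel \<Rightarrow> nat" where
  "power_sum r V E = (\<Sum>v\<in>V. card (E `` {v}) ^ r)"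

definition multipartite :: "'a set \<Rightarrow> ('a \<Rightarrow> nat) \<Rightarrow> 'a rel" where
  "multipartite V c = {(u, v). u \<in> V \<and> v \<in> V \<and> c u \<noteq> c v}"

definition wrong_pairs :: "'a set \<Rightarrow> 'a rel \<Rightarrow> ('a \<Rightarrow> nat) \<Rightarrow> 'a rel" where
  "wrong_pairs V E c = (multipartite V c - E) \<union> (E - multipartite V c)"

lemma sgraph_multipartite: "finite V \<Longrightarrow> sgraph V (multipartite V c)"
  by unfold_locales (auto simp: multipartite_def sym_def irrefl_def)

lemma multipartite_nbrs: "v \<in> V \<Longrightarrow> multipartite V c `` {v} = {u \<in> V. c u \<noteq> c v}"
  by (auto simp: multipartite_def)

text \<open>The mean value bound for the \<open>r\<close>-th power between 0 and \<open>n\<close>;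
  it charges a change of \<open>M\<close> in a degree.\<close>

lemma power_diff_le:
  fixes a b M n :: real
  assumes "0 \<le> a" "a \<le> n" "0 \<le> b" "b \<le> n" "a \<le> b + M" "0 \<le> M" "1 \<le> r"
  shows "a ^ r \<le> b ^ r + r * M * n ^ (r - 1)"
proof -
  have "a ^ Suc q \<le> b ^ Suc q + Suc q * M * n ^ q" for q
  proof (induction q)
    case (Suc q)
    have "a ^ Suc (Suc q) \<le> a * (b ^ Suc q + Suc q * M * n ^ q)"
      using Suc assms(1) by (simp add: mult_left_mono)
    also have "\<dots> = a * b ^ Suc q + a * (Suc q * M * n ^ q)" by (simp add: algebra_simps)
    also have "a * (Suc q * M * n ^ q) \<le> n * (Suc q * M * n ^ q)"
      using assms by (intro mult_right_mono) auto
    also have "a * b ^ Suc q \<le> (b + M) * b ^ Suc q"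
      using assms by (intro mult_right_mono) auto
    also have "(b + M) * b ^ Suc q = b ^ Suc (Suc q) + M * b ^ Suc q" by (simp add: algebra_simps)
    also have "M * b ^ Suc q \<le> M * n ^ Suc q"
      using assms by (intro mult_left_mono power_mono) auto
    finally show ?case by (simp add: algebra_simps)
  qed (use assms in auto)
  from this[of "r - 1"] show ?thesis using assms(7) by simp
qed

lemma power_add_ge:
  fixes b h :: real
  assumes "0 \<le> b" "0 \<le> h" "1 \<le> r"
  shows "b ^ r + h ^ r \<le> (b + h) ^ r"
proof -
  have "b ^ Suc q + h ^ Suc q \<le> (b + h) ^ Suc q" for q
  proof (induction q)
    case (Suc q)
    have "b ^ Suc (Suc q) + h ^ Suc (Suc q) \<le> (b + h) * (b ^ Suc q + h ^ Suc q)"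
      using assms by (simp add: algebra_simps)
    also have "\<dots> \<le> (b + h) * (b + h) ^ Suc q"
      using assms Suc by (intro mult_left_mono) auto
    finally show ?case by simp
  qed simp
  from this[of "r - 1"] show ?thesis using assms(3) by simp
qed

lemma (in sgraph) sum_degree: "(\<Sum>v\<in>V. card (E `` {v})) = card E"
proof -
  have "E = (SIGMA v:V. E `` {v})" using E_subset by auto
  then have "card E = card (SIGMA v:V. E `` {v})" by (rule arg_cong)
  also have "\<dots> = (\<Sum>v\<in>V. card (E `` {v}))" using finite_V by (intro card_SigmaI) auto
  finally show ?thesis by simp
qed

text \<open>Richness would give a positive density of \<open>(k + 1)\<close>-cliques and hence a
  blow-up of a clique with parts larger than \<open>VF\<close>. In it a
  \<open>(k + 1)\<close>-colouring of \<open>F\<close> prescribes the part of each image, and greedy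
  embedding works with \<open>\<mu> = 0\<close>.\<close>

lemma not_rich_if_free:
  fixes \<delta> :: real
  assumes F: "sgraph VF EF" "colorable VF EF (Suc k)" and "0 < \<delta>"
  shows "\<exists>n0. \<forall>(V :: 'a set) E. sgraph V E \<longrightarrow> n0 \<le> card V \<longrightarrow> \<not> embeds VF EF V E \<longrightarrow>
     \<not> rich E (\<delta> * card V) (Suc k) V"
proof -
  interpret F: sgraph VF EF by fact
  \<comment> \<open>The successor keeps \<open>t\<close> positive also for empty
    \<open>VF\<close>.\<close>
  define t where "t = Suc (card VF)"
  obtain n0 where n0: "\<And>(V :: 'a set) E U. sgraph V E \<Longrightarrow> U \<subseteq> V \<Longrightarrow> n0 \<le> card V \<Longrightarrow>
     \<delta> ^ Suc k * real (card V) ^ Suc k \<le> card (cliques E (Suc k) U) \<Longrightarrow>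
     (\<exists>B. (\<forall>i<Suc k. B i \<subseteq> U \<and> card (B i) = t) \<and> (\<forall>i<Suc k. \<forall>j<Suc k. i \<noteq> j \<longrightarrow> B i \<times> B j \<subseteq> E))"
  proof -
    have "0 < \<delta> ^ Suc k" "0 < t" using \<open>0 < \<delta>\<close> by (simp_all add: t_def)
    from blowup_of_many_cliques[OF this, of "Suc k", where 'a = 'a] show ?thesis using that by blast
  qed
  show ?thesis
  proof (intro exI[of _ n0] allI impI notI)
    fix V :: "'a set" and E
    assume a: "sgraph V E" "n0 \<le> card V" "\<not> embeds VF EF V E" "rich E (\<delta> * card V) (Suc k) V"
    interpret sgraph V E by fact
    have "\<delta> ^ Suc k * real (card V) ^ Suc k \<le> card (cliques E (Suc k) V)"
      using rich_imp_many_cliques[OF a(4) finite_V] \<open>0 < \<delta>\<close> unfolding power_mult_distrib by simp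
    from n0[OF a(1) subset_refl a(2) this] obtain B where
      B: "\<forall>i<Suc k. B i \<subseteq> V \<and> card (B i) = t" "\<forall>i<Suc k. \<forall>j<Suc k. i \<noteq> j \<longrightarrow> B i \<times> B j \<subseteq> E" by blast
    obtain c where c: "\<forall>v\<in>VF. c v < Suc k" "\<forall>(u, v)\<in>EF. c u \<noteq> c v"
      using F(2) by (auto simp: colorable_def)
    have "\<exists>f. inj_on f VF \<and> (\<forall>z\<in>VF. f z \<in> B (c z)) \<and> (\<forall>z\<in>VF. \<forall>w\<in>VF. (z, w) \<in> EF \<longrightarrow> (f z, f w) \<in> E)"
    proof (rule greedy_embedding[where \<mu> = 0])
      show "finite (B (c z))" if "z \<in> VF" for z
        using B(1) c(1) that finite_V finite_subset by blast
      show "real (card VF) * (0 + 1) \<le> card (B (c z))" if "z \<in> VF" for z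
        using B(1) c(1) that by (auto simp: t_def)
      show "real (card (B (c w) - E `` {x})) \<le> 0" if "z \<in> VF" "w \<in> VF" "(z, w) \<in> EF" "x \<in> B (c z)" for z w x
      proof -
        have "B (c z) \<times> B (c w) \<subseteq> E" using B(2) c that by blast
        then have eq: "B (c w) - E `` {x} = {}" using that by auto
        show ?thesis unfolding eq by simp
      qed
    qed (auto intro: F.finite_V sym_E F.sym_E F.irrefl_E)
    then obtain f where f: "inj_on f VF" "\<forall>z\<in>VF. f z \<in> B (c z)"
      "\<forall>z\<in>VF. \<forall>w\<in>VF. (z, w) \<in> EF \<longrightarrow> (f z, f w) \<in> E" by blast
    have "f ` VF \<subseteq> V" using f(2) B(1) c(1) by blast
    moreover have "\<forall>(u, v)\<in>EF. (f u, f v) \<in> E" using f(3) F.E_subset by blast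
    ultimately have "embeds VF EF V E" using f(1) by (auto simp: embeds_def)
    then show False using a(3) by blast
  qed
qed

text \<open>On all but few vertices the degree \<open>d\<close> exceeds the partite degree
  \<open>dT\<close> by at most \<open>M\<close>. As \<open>E\<close> has at least the power sum of
  the partite graph, few vertices can have a deficit above \<open>\<beta> * n\<close>, since each of
  them costs \<open>(\<beta> * n) ^ r\<close>. Hence missing minus inner pairs is at most some
  \<eta>, and Furedi's inequality turns this bound on a difference into a bound on the sum.\<close>

lemma (in sgraph) stability_not_rich:
  fixes m \<beta> :: real
  assumes "0 \<le> m" "\<not> rich E m (Suc k) V" "1 \<le> k" "1 \<le> r" "0 < \<beta>" "V \<noteq> {}"
    and max: "\<And>c. \<forall>v\<in>V. c v < k \<Longrightarrow> power_sum r V (multipartite V c) \<le> power_sum r V E"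
  shows "\<exists>c. (\<forall>v\<in>V. c v < k) \<and>
    card (wrong_pairs V E c) \<le> 3 * \<beta> * (real (card V))\<^sup>2 +
      (3 * ((real r + 1) / \<beta> ^ r + 1) * (2 * real k + 1) + 2 * (real k + 1) * (real k + 6)) * m * real (card V)"
proof -
  let ?n = "real (card V)"
  have n: "1 \<le> ?n" using assms(6) finite_V by (metis One_nat_def Suc_leI card_gt_0_iff of_nat_1 of_nat_le_iff)
  obtain X c0 where X: "X \<subseteq> V" "\<forall>v\<in>X. c0 v < k" "card (V - X) \<le> (real k + 1) * m"
     "\<forall>v\<in>X. card (V \<inter> E `` {v}) + card {u\<in>X. c0 u = c0 v} \<le> card V + real k * m"
     "2 * card {(u, v) \<in> E. u \<in> X \<and> v \<in> X \<and> c0 u = c0 v}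
       \<le> card {(u, v). u \<in> X \<and> v \<in> X \<and> c0 u \<noteq> c0 v \<and> (u, v) \<notin> E} + (real k + 1) * (real k + 2) * m * card V"
    using greedy_partition[OF assms(1) subset_refl assms(2)] by blast
  \<comment> \<open>The leftover vertices \<open>L\<close> are put into class 0.\<close>
  define c where "c v = (if v \<in> X then c0 v else 0)" for v
  define L where "L = V - X"
  \<comment> \<open>\<open>k * m\<close> comes from the degree bound, \<open>(k + 1) * m\<close>
    from the leftover vertices.\<close>
  define M where "M = (2 * real k + 1) * m"
  have M0: "0 \<le> M" using assms(1) by (simp add: M_def)
  have finX: "finite X" "finite L" using X(1) finite_V finite_subset by (auto simp: L_def)
  have cardL: "card L \<le> (real k + 1) * m" using X(3) by (simp add: L_def)
  have LM: "card L \<le> M"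
  proof -
    have "(real k + 1) * m \<le> M" unfolding M_def using assms(1) by (intro mult_right_mono) auto
    then show ?thesis using cardL by linarith
  qed
  have ck: "\<forall>v\<in>V. c v < k" using X(2) assms(3) by (auto simp: c_def)
  define mp where "mp = multipartite V c"
  interpret mp: sgraph V mp unfolding mp_def using finite_V by (rule sgraph_multipartite)
  define d where "d v = real (card (E `` {v}))" for v
  define dT where "dT v = real (card (mp `` {v}))" for v
  have dn: "0 \<le> d v" "d v \<le> ?n" "0 \<le> dT v" "dT v \<le> ?n" for v
    using degree_le mp.degree_le by (auto simp: d_def dT_def)
  have d_le: "d v \<le> dT v + M" if v: "v \<in> X" for v
  proof -
    have "card V \<le> card (mp `` {v} \<union> {u\<in>X. c0 u = c0 v} \<union> L)"
      using v X(1) finX finite_V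
      by (intro card_mono) (auto simp: mp_def multipartite_def c_def L_def)
    also have "\<dots> \<le> card (mp `` {v}) + card {u\<in>X. c0 u = c0 v} + card L"
      by (meson add_mono_thms_linordered_semiring(3) card_Un_le order_trans)
    finally have "?n \<le> dT v + card {u\<in>X. c0 u = c0 v} + card L" by (simp add: dT_def)
    moreover have "V \<inter> E `` {v} = E `` {v}" using nbrs_subset by blast
    then have "d v + card {u\<in>X. c0 u = c0 v} \<le> ?n + real k * m"
      using X(4) v by (auto simp: d_def)
    ultimately show ?thesis using cardL by (simp add: M_def algebra_simps)
  qed
  define In Ms where "In = E - mp" and "Ms = mp - E"
  have fin: "finite E" "finite mp" "finite In" "finite Ms"
    using finite_E mp.finite_E by (auto simp: In_def Ms_def)
  have sum_eq: "(\<Sum>v\<in>V. dT v - d v) = real (card Ms) - real (card In)"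
  proof -
    have "(\<Sum>v\<in>V. dT v - d v) = real (card mp) - real (card E)"
      unfolding sum_subtractf d_def dT_def using sum_degree mp.sum_degree by (metis of_nat_sum)
    moreover have "card mp = card (mp \<inter> E) + card Ms"
      unfolding Ms_def using fin by (metis add.commute card_Diff_subset_Int card_mono finite_Int inf_le1 le_add_diff_inverse2)
    moreover have "card E = card (mp \<inter> E) + card In"
      unfolding In_def using fin by (metis Int_commute add.commute card_Diff_subset_Int card_mono finite_Int inf_le1 le_add_diff_inverse2)
    ultimately show ?thesis by simp
  qed
  have cardVL: "card (V \<times> L) \<le> ?n * ((real k + 1) * m)" "card (L \<times> V) \<le> ?n * ((real k + 1) * m)"
    using cardL mult_left_mono[OF cardL, of ?n] by (simp_all add: card_cartesian_product mult.commute)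
  \<comment> \<open>Inner pairs that are not within \<open>X\<close> meet \<open>L\<close>; this
    adds \<open>4 * (k + 1)\<close> to the coefficient \<open>(k + 1) * (k + 2)\<close>.\<close>
  have in_le: "2 * card In \<le> card Ms + (real k + 1) * (real k + 6) * m * ?n"
  proof -
    have "In \<subseteq> {(u, v) \<in> E. u \<in> X \<and> v \<in> X \<and> c0 u = c0 v} \<union> V \<times> L \<union> L \<times> V"
      using E_subset by (auto simp: In_def mp_def multipartite_def c_def L_def)
    then have "card In \<le> card ({(u, v) \<in> E. u \<in> X \<and> v \<in> X \<and> c0 u = c0 v} \<union> V \<times> L \<union> L \<times> V)"
      using finX finite_V fin
      by (intro card_mono) (auto intro: finite_subset[of "{(u, v) \<in> E. u \<in> X \<and> v \<in> X \<and> c0 u = c0 v}" E])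
    also have "\<dots> \<le> card {(u, v) \<in> E. u \<in> X \<and> v \<in> X \<and> c0 u = c0 v} + card (V \<times> L) + card (L \<times> V)"
      by (meson add_mono_thms_linordered_semiring(3) card_Un_le order_trans)
    finally have "card In \<le> card {(u, v) \<in> E. u \<in> X \<and> v \<in> X \<and> c0 u = c0 v} + 2 * (?n * ((real k + 1) * m))"
      using cardVL by simp
    moreover have "card {(u, v). u \<in> X \<and> v \<in> X \<and> c0 u \<noteq> c0 v \<and> (u, v) \<notin> E} \<le> card Ms"
      using fin X(1) by (intro card_mono) (auto simp: Ms_def mp_def multipartite_def c_def)
    ultimately have "2 * card In \<le> card Ms + (real k + 1) * (real k + 2) * m * ?n + 4 * (?n * ((real k + 1) * m))"
      using X(5) by linarith
    then show ?thesis by (simp add: algebra_simps)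
  qed
  \<comment> \<open>Vertices with a large deficit; extremality bounds their number through their
    loss in the power sum.\<close>
  define S where "S = {v \<in> X. dT v - d v > \<beta> * ?n}"
  have finS: "finite S" using finX by (simp add: S_def)
  have nr: "?n * ?n ^ (r - 1) = ?n ^ r" using assms(4) by (cases r) auto
  have "0 \<le> (\<Sum>v\<in>V. d v ^ r - dT v ^ r)"
  proof -
    have "real (power_sum r V mp) \<le> power_sum r V E" using max[OF ck] by (simp add: mp_def)
    then show ?thesis by (simp add: power_sum_def d_def dT_def sum_subtractf)
  qed
  also have "\<dots> = (\<Sum>v\<in>S. d v ^ r - dT v ^ r) + (\<Sum>v\<in>X - S. d v ^ r - dT v ^ r) + (\<Sum>v\<in>L. d v ^ r - dT v ^ r)"
  proof -
    have "S \<subseteq> X" by (auto simp: S_def)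
    then show ?thesis unfolding L_def
      using sum.subset_diff[OF X(1) finite_V, of "\<lambda>v. d v ^ r - dT v ^ r"]
        sum.subset_diff[of S X "\<lambda>v. d v ^ r - dT v ^ r"] finX by simp
  qed
  also have "(\<Sum>v\<in>S. d v ^ r - dT v ^ r) \<le> of_nat (card S) * (- ((\<beta> * ?n) ^ r))"
  proof (rule sum_bounded_above)
    fix v assume "v \<in> S"
    then have "d v + \<beta> * ?n \<le> dT v" by (simp add: S_def)
    then have "(d v + \<beta> * ?n) ^ r \<le> dT v ^ r"
      using dn assms(5) by (intro power_mono) auto
    then show "d v ^ r - dT v ^ r \<le> - ((\<beta> * ?n) ^ r)"
      using power_add_ge[OF dn(1)[of v] _ assms(4), of "\<beta> * ?n"] assms(5) by simp
  qed
  also have "(\<Sum>v\<in>X - S. d v ^ r - dT v ^ r) \<le> of_nat (card (X - S)) * (r * M * ?n ^ (r - 1))"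
  proof (rule sum_bounded_above)
    fix v assume "v \<in> X - S"
    then show "d v ^ r - dT v ^ r \<le> r * M * ?n ^ (r - 1)"
      using power_diff_le[of "d v" ?n "dT v" M r] dn d_le M0 assms(4) by auto
  qed
  also have "of_nat (card (X - S)) * (r * M * ?n ^ (r - 1)) \<le> ?n * (r * M * ?n ^ (r - 1))"
  proof (rule mult_right_mono)
    show "real (card (X - S)) \<le> ?n" using X(1) finite_V by (auto intro: card_mono)
  qed (use M0 in auto)
  also have "?n * (r * M * ?n ^ (r - 1)) = r * M * ?n ^ r" using nr by (simp add: algebra_simps)
  also have "(\<Sum>v\<in>L. d v ^ r - dT v ^ r) \<le> of_nat (card L) * ?n ^ r"
  proof (rule sum_bounded_above)
    fix v assume "v \<in> L"
    have "d v ^ r \<le> ?n ^ r" using dn by (intro power_mono) auto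
    then show "d v ^ r - dT v ^ r \<le> ?n ^ r" using dn(3)[of v] by (smt (verit) zero_le_power)
  qed
  also have "of_nat (card L) * ?n ^ r \<le> M * ?n ^ r" using LM by (intro mult_right_mono) auto
  finally have "real (card S) * (\<beta> * ?n) ^ r \<le> (r + 1) * M * ?n ^ r" by (simp add: algebra_simps)
  then have "(real (card S) * \<beta> ^ r) * ?n ^ r \<le> ((r + 1) * M) * ?n ^ r" by (simp add: algebra_simps power_mult_distrib)
  then have "real (card S) * \<beta> ^ r \<le> (r + 1) * M" using n by simp
  then have cardS: "card S \<le> (r + 1) / \<beta> ^ r * M" using assms(5) by (simp add: field_simps)
  define \<eta> where "\<eta> = \<beta> * ?n\<^sup>2 + ((r + 1) / \<beta> ^ r + 1) * M * ?n"
  have ms_le: "real (card Ms) - real (card In) \<le> \<eta>"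
  proof -
    have "(\<Sum>v\<in>V. dT v - d v) \<le> (\<Sum>v\<in>V. \<beta> * ?n + (if v \<in> S \<union> L then ?n else 0))"
    proof (rule sum_mono)
      fix v assume v: "v \<in> V"
      have "dT v - d v \<le> ?n" using dn[of v] by linarith
      moreover have "0 \<le> \<beta> * ?n" using assms(5) by simp
      ultimately show "dT v - d v \<le> \<beta> * ?n + (if v \<in> S \<union> L then ?n else 0)"
        using v by (auto simp: S_def L_def)
    qed
    also have "\<dots> = ?n * (\<beta> * ?n) + (\<Sum>v\<in>S \<union> L. ?n)"
    proof -
      have "V \<inter> (S \<union> L) = S \<union> L" using X(1) by (auto simp: S_def L_def)
      then have "(\<Sum>v\<in>V. if v \<in> S \<union> L then ?n else 0) = (\<Sum>v\<in>S \<union> L. ?n)"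
        using sum.inter_restrict[OF finite_V, of "\<lambda>_. ?n" "S \<union> L"] by simp
      then show ?thesis by (simp only: sum.distrib) simp
    qed
    also have "(\<Sum>v\<in>S \<union> L. ?n) \<le> (card S + card L) * ?n"
      using card_Un_le[of S L] by (simp add: mult_right_mono flip: of_nat_add)
    also have "(card S + card L) * ?n \<le> (((r + 1) / \<beta> ^ r + 1) * M) * ?n"
      using cardS LM by (intro mult_right_mono) (auto simp: algebra_simps)
    finally show ?thesis using sum_eq by (simp add: \<eta>_def power2_eq_square algebra_simps)
  qed
  let ?K = "(real k + 1) * (real k + 6) * m * ?n"
  have "card (wrong_pairs V E c) \<le> card Ms + card In"
    unfolding wrong_pairs_def mp_def[symmetric] Ms_def In_def by (rule card_Un_le)
  \<comment> \<open>Adding \<open>Ms - In \<le> \<eta>\<close> and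
    \<open>2 * In \<le> Ms + ?K\<close> gives \<open>In \<le> \<eta> + ?K\<close>, and then
    \<open>Ms \<le> 2 * \<eta> + ?K\<close>, where the names stand for cardinalities.\<close>
  moreover have "real (card Ms) + real (card In) \<le> 3 * \<eta> + 2 * ?K"
    using ms_le in_le by linarith
  ultimately have "real (card (wrong_pairs V E c)) \<le> 3 * \<eta> + 2 * ?K" by linarith
  also have "\<dots> = 3 * \<beta> * (real (card V))\<^sup>2 +
      (3 * ((real r + 1) / \<beta> ^ r + 1) * (2 * real k + 1) + 2 * (real k + 1) * (real k + 6)) * m * real (card V)"
  proof -
    define R where "R = (real r + 1) / \<beta> ^ r"
    show ?thesis unfolding \<eta>_def M_def of_nat_add of_nat_1 R_def[symmetric]
      by (simp add: algebra_simps power2_eq_square)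
  qed
  finally show ?thesis using ck by blast
qed

lemma stability:
  fixes \<epsilon> :: real
  assumes F: "sgraph VF EF" "colorable VF EF (Suc k)" and "1 \<le> k" "1 \<le> r" "0 < \<epsilon>"
  shows "\<exists>n0. \<forall>(V :: 'a set) E. sgraph V E \<longrightarrow> n0 \<le> card V \<longrightarrow> \<not> embeds VF EF V E \<longrightarrow>
     (\<forall>c. (\<forall>v\<in>V. c v < k) \<longrightarrow> power_sum r V (multipartite V c) \<le> power_sum r V E) \<longrightarrow>
     (\<exists>c. (\<forall>v\<in>V. c v < k) \<and> card (wrong_pairs V E c) \<le> \<epsilon> * (real (card V))\<^sup>2)"
proof -
  \<comment> \<open>\<open>3 * \<beta>\<close> is half of \<epsilon>. The other half is provided by
    \<delta>, which is chosen afterwards because \<open>K\<close> grows with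
    \<open>1 / \<beta> ^ r\<close>.\<close>
  define \<beta> where "\<beta> = \<epsilon> / 6"
  define K where "K = 3 * ((real r + 1) / \<beta> ^ r + 1) * (2 * real k + 1) + 2 * (real k + 1) * (real k + 6)"
  have \<beta>: "0 < \<beta>" using assms(5) by (simp add: \<beta>_def)
  have "0 < K" unfolding K_def using \<beta> assms(3,4)
    by (intro add_pos_pos mult_pos_pos divide_pos_pos zero_less_power) auto
  define \<delta> where "\<delta> = \<epsilon> / (2 * K)"
  have \<delta>: "0 < \<delta>" "K * \<delta> = \<epsilon> / 2" using \<open>0 < K\<close> assms(5) by (auto simp: \<delta>_def)
  obtain n0 where n0: "\<And>(V :: 'a set) E. sgraph V E \<Longrightarrow> n0 \<le> card V \<Longrightarrow> \<not> embeds VF EF V E \<Longrightarrow>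
     \<not> rich E (\<delta> * card V) (Suc k) V"
    using not_rich_if_free[OF F \<delta>(1), where 'a = 'a] by blast
  show ?thesis
  proof (intro exI[of _ "max 1 n0"] allI impI)
    fix V :: "'a set" and E
    assume a: "sgraph V E" "max 1 n0 \<le> card V" "\<not> embeds VF EF V E"
      "\<forall>c. (\<forall>v\<in>V. c v < k) \<longrightarrow> power_sum r V (multipartite V c) \<le> power_sum r V E"
    interpret sgraph V E by fact
    have "V \<noteq> {}" using a(2) by auto
    then obtain c where c: "\<forall>v\<in>V. c v < k"
      "card (wrong_pairs V E c) \<le> 3 * \<beta> * (real (card V))\<^sup>2 + K * (\<delta> * card V) * real (card V)"
    proof -
      have "0 \<le> \<delta> * card V" "\<not> rich E (\<delta> * card V) (Suc k) V"
        using \<delta>(1) n0[OF a(1) _ a(3)] a(2) by auto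
      from stability_not_rich[OF this assms(3,4) \<beta> \<open>V \<noteq> {}\<close>] a(4)
      show ?thesis using that unfolding K_def by blast
    qed
    have "3 * \<beta> * (real (card V))\<^sup>2 + K * (\<delta> * card V) * real (card V) = \<epsilon> / 2 * (real (card V))\<^sup>2 + (K * \<delta>) * (real (card V))\<^sup>2"
      by (simp add: \<beta>_def power2_eq_square algebra_simps)
    also have "\<dots> = \<epsilon> * (real (card V))\<^sup>2" by (simp add: \<delta>(2))
    finally show "\<exists>c. (\<forall>v\<in>V. c v < k) \<and> card (wrong_pairs V E c) \<le> \<epsilon> * (real (card V))\<^sup>2"
      using c by auto
  qed
qed

section \<open>Structure of extremal graphs\<close>

lemma embedsI:
  assumes "inj_on f VF" "f ` VF \<subseteq> V" "\<And>x y. (x, y) \<in> EF \<Longrightarrow> (f x, f y) \<in> E"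
  shows "embeds VF EF V E"
  unfolding embeds_def using assms by blast

lemma embedsE:
  assumes "embeds VF EF V E"
  obtains f where "inj_on f VF" "f ` VF \<subseteq> V" "\<And>x y. (x, y) \<in> EF \<Longrightarrow> (f x, f y) \<in> E"
proof -
  from assms obtain f where "inj_on f VF \<and> f ` VF \<subseteq> V \<and> (\<forall>(u, v)\<in>EF. (f u, f v) \<in> E)"
    unfolding embeds_def ..
  then show thesis by (intro that[of f]) auto
qed

definition extremal :: "nat \<Rightarrow> 'b set \<Rightarrow> 'b rel \<Rightarrow> 'a set \<Rightarrow> 'a rel \<Rightarrow> bool" where
  "extremal r VF EF V E \<longleftrightarrow> sgraph V E \<and> \<not> embeds VF EF V E \<and>
     (\<forall>E'. sgraph V E' \<longrightarrow> \<not> embeds VF EF V E' \<longrightarrow> power_sum r V E' \<le> power_sum r V E)"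

section \<open>Linear lower bound for the classes\<close>

text \<open>Moving \<open>q \<ge> n / (8 * k)\<close> vertices gains at least
  \<open>q ^ (r + 1)\<close>, which is at least twice this constant times
  \<open>n ^ (r + 1)\<close>. One half pays for the old members of the small class, the other
  exceeds the stability error \<open>r * \<epsilon> * n ^ (r + 1)\<close>.\<close>

definition class_const :: "nat \<Rightarrow> nat \<Rightarrow> real" where
  "class_const k r = (1 / (8 * real k)) ^ Suc r / 2"

text \<open>When \<open>q\<close> vertices move from the largest class \<open>A i\<close> to class
  \<open>j\<close>, those that stay gain \<open>q\<close> neighbours, and those that move do not
  lose, since the enlarged class \<open>j\<close> is no larger than \<open>A i\<close> was. Only the
  old members of class \<open>j\<close> can lose, at most \<open>n ^ r\<close> each. As
  \<open>E\<close> exceeds the power sum of the old partite graph by at most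
  \<open>r * \<epsilon> * n ^ (r + 1)\<close>, the new partite graph would beat
  \<open>E\<close>.\<close>

lemma (in sgraph) class_size_ge:
  fixes \<epsilon> :: real
  assumes "1 \<le> k" "1 \<le> r" "8 * k \<le> card V" and c: "\<forall>v\<in>V. c v < k"
    and wrong: "card (wrong_pairs V E c) \<le> \<epsilon> * (real (card V))\<^sup>2" and \<epsilon>: "r * \<epsilon> < class_const k r"
    and max: "\<And>c. \<forall>v\<in>V. c v < k \<Longrightarrow> power_sum r V (multipartite V c) \<le> power_sum r V E"
    and j: "j < k"
  shows "class_const k r * card V \<le> card {v \<in> V. c v = j}"
proof (rule ccontr)
  assume neg: "\<not> ?thesis"
  let ?n = "real (card V)" and ?cc = "class_const k r"
  define A where "A i = {v \<in> V. c v = i}" for i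
  have finA: "finite (A i)" for i using finite_V by (simp add: A_def)
  have nj: "card (A j) < ?cc * ?n" using neg by (simp add: A_def)
  define mp where "mp = multipartite V c"
  interpret mp: sgraph V mp unfolding mp_def using finite_V by (rule sgraph_multipartite)
  interpret In: sgraph V "E - mp"
    using finite_V E_subset sym_E irrefl_E mp.sym_E
    by unfold_locales (auto simp: sym_def irrefl_def)
  have nr: "?n * ?n * ?n ^ (r - 1) = ?n ^ Suc r" using assms(2) by (cases r) auto
  have up: "real (power_sum r V E) \<le> power_sum r V mp + r * \<epsilon> * ?n ^ Suc r"
  proof -
    have "real (power_sum r V E) \<le> (\<Sum>v\<in>V. real (card (mp `` {v})) ^ r + real r * card ((E - mp) `` {v}) * ?n ^ (r - 1))"
      unfolding power_sum_def of_nat_sum of_nat_power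
    proof (rule sum_mono)
      fix v
      have "E `` {v} \<subseteq> mp `` {v} \<union> (E - mp) `` {v}" by auto
      then have "card (E `` {v}) \<le> card (mp `` {v} \<union> (E - mp) `` {v})" by (intro card_mono) auto
      also have "\<dots> \<le> card (mp `` {v}) + card ((E - mp) `` {v})" by (rule card_Un_le)
      finally show "real (card (E `` {v})) ^ r \<le> real (card (mp `` {v})) ^ r + real r * card ((E - mp) `` {v}) * ?n ^ (r - 1)"
        using degree_le[of v] mp.degree_le[of v] assms(2) by (intro power_diff_le) auto
    qed
    also have "\<dots> = power_sum r V mp + real r * card (E - mp) * ?n ^ (r - 1)"
      unfolding In.sum_degree[symmetric]
      by (simp add: power_sum_def sum.distrib sum_distrib_left sum_distrib_right)
    also have "real r * card (E - mp) * ?n ^ (r - 1) \<le> real r * (\<epsilon> * ?n\<^sup>2) * ?n ^ (r - 1)"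
    proof -
      have "card (E - mp) \<le> card (wrong_pairs V E c)"
        using finite_E mp.finite_E by (intro card_mono) (auto simp: wrong_pairs_def mp_def)
      then have "real (card (E - mp)) \<le> \<epsilon> * ?n\<^sup>2" using wrong by linarith
      then show ?thesis by (intro mult_right_mono mult_left_mono) auto
    qed
    also have "real r * (\<epsilon> * ?n\<^sup>2) * ?n ^ (r - 1) = r * \<epsilon> * (?n * ?n * ?n ^ (r - 1))"
      by (simp add: power2_eq_square)
    finally show ?thesis unfolding nr by simp
  qed
  have "\<exists>i<k. card V \<le> k * card (A i)"
  proof (rule ccontr)
    assume "\<not> ?thesis"
    then have less: "\<And>i. i < k \<Longrightarrow> k * card (A i) < card V" by force
    have "V = (\<Union>i<k. A i)" using c by (auto simp: A_def)
    then have "card V = card (\<Union>i<k. A i)" by (rule arg_cong)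
    also have "\<dots> = (\<Sum>i<k. card (A i))"
      using finA by (intro card_UN_disjoint) (auto simp: A_def)
    finally have "card V = (\<Sum>i<k. card (A i))" .
    then have "k * card V = (\<Sum>i<k. k * card (A i))" by (simp add: sum_distrib_left)
    also have "\<dots> < (\<Sum>i<k. card V)" using less assms(1) by (intro sum_strict_mono) (auto simp: lessThan_empty_iff)
    finally show False by simp
  qed
  then obtain i where i: "i < k" "card V \<le> k * card (A i)" by blast
  \<comment> \<open>Class \<open>j\<close> has at most half the size of \<open>A i\<close>, so a
    quarter of \<open>A i\<close> still fits into it, and at least \<open>q\<close> vertices stay
    behind. \<open>8 \<le> card (A i)\<close> keeps the rounding loss within a factor 2.\<close>
  define q where "q = card (A i) div 4"
  have "8 \<le> card (A i)"
  proof -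
    have "8 * k \<le> card (A i) * k" using i(2) assms(3) unfolding mult.commute[of "card (A i)"] by linarith
    then show ?thesis using assms(1) by simp
  qed
  then have q: "card (A i) \<le> 8 * q" "4 * q \<le> card (A i)" unfolding q_def by linarith+
  have ni: "?n \<le> real k * card (A i)" using i(2) by (metis of_nat_le_iff of_nat_mult)
  have "?n \<le> 8 * real k * q"
  proof -
    have "real k * card (A i) \<le> real k * (8 * q)" using q(1) by (intro mult_left_mono) auto
    then show ?thesis using ni by linarith
  qed
  then have q_ge: "?n / (8 * k) \<le> q" using assms(1) by (simp add: field_simps)
  have cc_le: "?cc \<le> 1 / (2 * real k)"
  proof -
    have "(1 / (8 * real k)) ^ Suc r \<le> (1 / (8 * real k)) ^ 1"
      using assms(1) by (intro power_decreasing) (auto simp: field_simps)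
    also have "\<dots> \<le> 1 / real k" using assms(1) by (simp add: field_simps)
    finally show ?thesis by (simp add: class_const_def)
  qed
  have nj_ni: "2 * card (A j) \<le> card (A i)"
  proof -
    have "real (card (A j)) \<le> 1 / (2 * real k) * ?n"
      using nj mult_right_mono[OF cc_le, of ?n] by linarith
    also have "\<dots> \<le> 1 / (2 * real k) * (real k * card (A i))"
      using ni by (intro mult_left_mono) auto
    finally show ?thesis using assms(1) by simp
  qed
  have "i \<noteq> j"
  proof
    assume "i = j"
    then have "card (A i) = 0" using nj_ni by simp
    then show False using \<open>8 \<le> card (A i)\<close> by simp
  qed
  have "q \<le> card (A i)" using q(2) by simp
  then obtain M where M: "M \<subseteq> A i" "card M = q" using obtain_subset_with_card_n by metis
  have finM: "finite M" using M(1) finA finite_subset by blast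
  define c' where "c' v = (if v \<in> M then j else c v)" for v
  define dT where "dT v = real (card {u \<in> V. c u \<noteq> c v})" for v
  define dT' where "dT' v = real (card {u \<in> V. c' u \<noteq> c' v})" for v
  have comp: "card {u \<in> V. P u} + card {u \<in> V. \<not> P u} = card V" for P
    using finite_V by (subst card_Un_disjoint[symmetric]) (auto intro: arg_cong[where f = card])
  have dT_eq: "dT v = ?n - card (A (c v))" for v
    using comp[of "\<lambda>u. c u = c v"] unfolding dT_def A_def by linarith
  have dT'_eq: "dT' v = ?n - card {u \<in> V. c' u = c' v}" for v
    using comp[of "\<lambda>u. c' u = c' v"] unfolding dT'_def by linarith
  have dT_n: "0 \<le> dT v" "dT v \<le> ?n" for v
    using finite_V by (auto simp: dT_def intro: card_mono)
  have gain1: "dT v ^ r + real q ^ r \<le> dT' v ^ r" if "v \<in> A i - M" for v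
  proof -
    have "{u \<in> V. c' u = c' v} = A i - M" using that \<open>i \<noteq> j\<close> by (auto simp: c'_def A_def)
    then have "card {u \<in> V. c' u = c' v} = card (A i) - q" using M finM by (simp add: card_Diff_subset)
    then have "dT' v = dT v + q" using that \<open>q \<le> card (A i)\<close> by (simp add: dT_eq dT'_eq A_def)
    then show ?thesis using power_add_ge[of "dT v" "real q" r] dT_n assms(2) by simp
  qed
  have gain2: "dT v ^ r \<le> dT' v ^ r" if "v \<in> M" for v
  proof -
    have "{u \<in> V. c' u = c' v} \<subseteq> A j \<union> M" using that by (auto simp: c'_def A_def)
    then have "card {u \<in> V. c' u = c' v} \<le> card (A j \<union> M)" using finA finM by (intro card_mono) auto
    also have "\<dots> \<le> card (A j) + q" using card_Un_le[of "A j" M] M by simp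
    also have "\<dots> \<le> card (A i)" using nj_ni q by linarith
    also have "A i = A (c v)" using that M by (auto simp: A_def)
    finally have "dT v \<le> dT' v" by (simp add: dT_eq dT'_eq)
    then show ?thesis using dT_n by (intro power_mono) auto
  qed
  have gain3: "dT v ^ r - ?n ^ r \<le> dT' v ^ r" for v
  proof -
    have "dT v ^ r \<le> ?n ^ r" using dT_n by (intro power_mono) auto
    moreover have "0 \<le> dT' v ^ r" by (simp add: dT'_def)
    ultimately show ?thesis by linarith
  qed
  have gain4: "dT v ^ r \<le> dT' v ^ r" if "v \<in> V" "v \<notin> A i" "v \<notin> A j" for v
  proof -
    have "{u \<in> V. c' u = c' v} \<subseteq> A (c v)" using that M by (auto simp: c'_def A_def split: if_splits)
    then have "card {u \<in> V. c' u = c' v} \<le> card (A (c v))" using finA by (intro card_mono) auto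
    then have "dT v \<le> dT' v" by (simp add: dT_eq dT'_eq)
    then show ?thesis using dT_n by (intro power_mono) auto
  qed
  have ps: "real (power_sum r V mp) = (\<Sum>v\<in>V. dT v ^ r)" "real (power_sum r V (multipartite V c')) = (\<Sum>v\<in>V. dT' v ^ r)"
    by (auto simp: power_sum_def mp_def multipartite_nbrs dT_def dT'_def intro!: sum.cong)
  have "(\<Sum>v\<in>V. dT v ^ r + (if v \<in> A i - M then real q ^ r else 0) - (if v \<in> A j then ?n ^ r else 0)) \<le> (\<Sum>v\<in>V. dT' v ^ r)"
  proof (rule sum_mono)
    fix v assume v: "v \<in> V"
    have "\<not> (v \<in> A i \<and> v \<in> A j)" using \<open>i \<noteq> j\<close> by (auto simp: A_def)
    then show "dT v ^ r + (if v \<in> A i - M then real q ^ r else 0) - (if v \<in> A j then ?n ^ r else 0) \<le> dT' v ^ r"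
      using gain1[of v] gain2[of v] gain3[of v] gain4[of v] v M(1) by (cases "v \<in> A i"; cases "v \<in> A j"; cases "v \<in> M") auto
  qed
  also have "(\<Sum>v\<in>V. dT v ^ r + (if v \<in> A i - M then real q ^ r else 0) - (if v \<in> A j then ?n ^ r else 0)) =
    (\<Sum>v\<in>V. dT v ^ r) + card (A i - M) * real q ^ r - card (A j) * ?n ^ r"
  proof -
    have "V \<inter> (A i - M) = A i - M" "V \<inter> A j = A j" by (auto simp: A_def)
    then have "(\<Sum>v\<in>V. if v \<in> A i - M then real q ^ r else 0) = card (A i - M) * real q ^ r"
       "(\<Sum>v\<in>V. if v \<in> A j then ?n ^ r else 0) = card (A j) * ?n ^ r"
      using sum.inter_restrict[OF finite_V, of "\<lambda>_. real q ^ r" "A i - M"]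
        sum.inter_restrict[OF finite_V, of "\<lambda>_. ?n ^ r" "A j"] by simp_all
    then show ?thesis by (simp only: sum.distrib sum_subtractf)
  qed
  also have "(\<Sum>v\<in>V. dT' v ^ r) \<le> real (power_sum r V E)"
  proof -
    have "\<forall>v\<in>V. c' v < k" using c j by (simp add: c'_def)
    from max[OF this] show ?thesis by (simp add: ps[symmetric])
  qed
  finally have "card (A i - M) * real q ^ r - card (A j) * ?n ^ r \<le> r * \<epsilon> * ?n ^ Suc r"
    using up ps by linarith
  moreover have "real q ^ Suc r \<le> card (A i - M) * real q ^ r"
  proof -
    have "q \<le> card (A i - M)" using M finM q by (simp add: card_Diff_subset)
    then show ?thesis by (simp add: mult_right_mono)
  qed
  moreover have "card (A j) * ?n ^ r \<le> ?cc * ?n ^ Suc r"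
    using mult_right_mono[OF less_imp_le[OF nj], of "?n ^ r"] by (simp add: algebra_simps)
  moreover have "2 * ?cc * ?n ^ Suc r \<le> real q ^ Suc r"
  proof -
    have "(?n / (8 * k)) ^ Suc r \<le> real q ^ Suc r" using q_ge by (intro power_mono) auto
    moreover have "2 * ?cc * ?n ^ Suc r = (?n / (8 * k)) ^ Suc r"
      unfolding class_const_def by (simp only: power_divide) simp
    ultimately show ?thesis by simp
  qed
  ultimately have "?cc * ?n ^ Suc r \<le> r * \<epsilon> * ?n ^ Suc r" by linarith
  moreover have "0 < ?n" using \<open>8 \<le> card (A i)\<close> card_mono[OF finite_V, of "A i"] by (auto simp: A_def)
  ultimately have "?cc \<le> r * \<epsilon>" by simp
  then show False using \<epsilon> by simp
qed

text \<open>Joining \<open>v\<close> to well connected vertices outside class \<open>i\<close> creates no new copy, since in a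
  copy \<open>v\<close> could be replaced by a vertex of class \<open>i\<close>.\<close>

lemma (in sgraph) not_embeds_replace_nbrs:
  fixes \<mu> :: real
  assumes F: "sgraph VF EF" and free: "\<not> embeds VF EF V E" and v: "v \<in> V"
    and N': "N' \<subseteq> V - {v}" "0 \<le> \<mu>"
    and B: "B \<subseteq> V" "\<And>x. x \<in> N' \<Longrightarrow> card (B - E `` {x}) \<le> \<mu>" "card VF * (\<mu> + 1) < card B"
  defines "E' \<equiv> {(x, y) \<in> E. x \<noteq> v \<and> y \<noteq> v} \<union> {v} \<times> N' \<union> N' \<times> {v}"
  shows "sgraph V E'" "\<not> embeds VF EF V E'"
proof -
  interpret F: sgraph VF EF by fact
  show "sgraph V E'"
    using finite_V E_subset v N' E_irrefl unfolding E'_def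
    by unfold_locales (auto simp: sym_def irrefl_def dest: E_sym)
  show "\<not> embeds VF EF V E'"
  proof
    assume "embeds VF EF V E'"
    then obtain f where f: "inj_on f VF" "f ` VF \<subseteq> V" "\<And>x y. (x, y) \<in> EF \<Longrightarrow> (f x, f y) \<in> E'"
      by (rule embedsE) blast
    show False
    proof (cases "v \<in> f ` VF")
      case False
      have "(f x, f y) \<in> E" if "(x, y) \<in> EF" for x y
      proof -
        have "f x \<noteq> v" "f y \<noteq> v" using False that F.E_subset by auto
        then show ?thesis using f(3)[OF that] by (auto simp: E'_def)
      qed
      then show False using f free embedsI[of f VF V EF E] by blast
    next
      case True
      then obtain p where p: "p \<in> VF" "f p = v" by blast
      have nb: "f x \<in> N'" if "(p, x) \<in> EF" for x
      proof -
        have "x \<noteq> p" using that F.E_irrefl by auto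
        then have "f x \<noteq> v" using f(1) p that F.E_subset by (auto simp: inj_on_def)
        then show ?thesis using f(3)[OF that] p by (auto simp: E'_def)
      qed
      \<comment> \<open>Vertices that cannot replace \<open>v\<close>: those already used, and those
        of \<open>B\<close> not adjacent to the image of some neighbour of \<open>p\<close>.\<close>
      define X where "X = f ` VF \<union> (\<Union>x\<in>EF `` {p}. B - E `` {f x})"
      have finB: "finite B" using B(1) finite_V finite_subset by blast
      define S where "S = (\<Sum>x\<in>EF `` {p}. card (B - E `` {f x}))"
      have "card X \<le> card VF + card (\<Union>x\<in>EF `` {p}. B - E `` {f x})"
        unfolding X_def using card_Un_le[of "f ` VF"] card_image_le[OF F.finite_V, of f]
        by (meson add_le_mono1 order_trans)
      moreover have "card (\<Union>x\<in>EF `` {p}. B - E `` {f x}) \<le> S"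
        unfolding S_def by (rule card_UN_le) simp
      moreover have "real S \<le> card (EF `` {p}) * \<mu>"
        unfolding of_nat_sum S_def using B(2) nb by (intro sum_bounded_above) auto
      moreover have "card (EF `` {p}) * \<mu> \<le> card VF * \<mu>"
        using F.degree_le[of p] N'(2) by (intro mult_right_mono) auto
      ultimately have "card X \<le> card VF * (\<mu> + 1)" unfolding distrib_left mult_1_right by linarith
      then have "\<not> B \<subseteq> X" using B(3) card_mono[of X B] finB F.finite_V by (force simp: X_def)
      then obtain w where w: "w \<in> B" "w \<notin> f ` VF" "\<And>x. (p, x) \<in> EF \<Longrightarrow> (f x, w) \<in> E"
        by (auto simp: X_def)
      define g where "g = f(p := w)"
      have "inj_on g VF" using f(1) w(2) unfolding g_def by (intro inj_on_fun_updI) auto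
      moreover have "g ` VF \<subseteq> V" using f(2) w(1) B(1) by (auto simp: g_def)
      moreover have "(g x, g y) \<in> E" if xy: "(x, y) \<in> EF" for x y
      proof -
        have ne: "x \<noteq> y" using xy F.E_irrefl by auto
        consider "x = p" | "y = p" | "x \<noteq> p" "y \<noteq> p" by blast
        then show ?thesis
        proof cases
          case 1
          then show ?thesis using w(3)[of y] xy ne E_sym by (auto simp: g_def)
        next
          case 2
          then show ?thesis using w(3)[of x] F.E_sym[OF xy] ne by (auto simp: g_def)
        next
          case 3
          then have "f x \<noteq> v" "f y \<noteq> v"
            using f(1) p xy F.E_subset by (auto simp: inj_on_def)
          then show ?thesis using f(3)[OF xy] 3 by (auto simp: E'_def g_def)
        qed
      qed
      ultimately show False using free embedsI[of g VF V EF E] by blast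
    qed
  qed
qed

text \<open>Give \<open>v\<close> the neighbourhood \<open>N'\<close>. Each new neighbour gains at
  least \<open>D ^ (r - 1)\<close>, because \<open>(d + 1) ^ r \<ge> d ^ r + d ^ (r - 1)\<close>.
  Each of the at most \<open>b\<close> lost neighbours loses at most \<open>r * n ^ (r - 1)\<close>,
  and \<open>v\<close> itself loses at most \<open>r * b * n ^ (r - 1)\<close>; these two losses
  make the factor 2.\<close>

lemma (in sgraph) missing_nbrs_le:
  fixes b D :: real
  assumes "1 \<le> r" and v: "v \<in> V" and N': "N' \<subseteq> V - {v}"
    and le: "power_sum r V ({(x, y) \<in> E. x \<noteq> v \<and> y \<noteq> v} \<union> {v} \<times> N' \<union> N' \<times> {v}) \<le> power_sum r V E"
    and b: "card (E `` {v} - N') \<le> b" and D: "0 \<le> D" "\<And>u. u \<in> N' \<Longrightarrow> D \<le> card (E `` {u})"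
  shows "card (N' - E `` {v}) * D ^ (r - 1) \<le> 2 * r * b * real (card V) ^ (r - 1)"
proof -
  let ?n = "real (card V)"
  define N where "N = E `` {v}"
  define E' where "E' = {(x, y) \<in> E. x \<noteq> v \<and> y \<noteq> v} \<union> {v} \<times> N' \<union> N' \<times> {v}"
  have finN: "finite N" "finite N'" using N' finite_V finite_subset by (auto simp: N_def)
  have NV: "N \<subseteq> V - {v}" using nbrs_subset E_irrefl by (auto simp: N_def)
  define d where "d u = real (card (E `` {u}))" for u
  define d' where "d' u = real (card (E' `` {u}))" for u
  have dn: "0 \<le> d u" "d u \<le> ?n" for u using degree_le[of u] by (auto simp: d_def)
  have d'v: "d' v = card N'"
  proof -
    have "E' `` {v} = N'" using N' by (auto simp: E'_def)
    then show ?thesis by (simp add: d'_def)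
  qed
  have b0: "0 \<le> b" using b by linarith
  have dv: "d v ^ r \<le> d' v ^ r + r * b * ?n ^ (r - 1)"
  proof (rule power_diff_le)
    have "card N \<le> card (N' \<union> (N - N'))" using finN by (intro card_mono) auto
    also have "\<dots> \<le> card N' + card (N - N')" by (rule card_Un_le)
    finally show "d v \<le> d' v + b" using b by (simp add: d'v d_def N_def)
    show "d' v \<le> ?n" using N' finite_V by (auto simp: d'v intro!: card_mono)
  qed (use dn d'v assms(1) b0 in auto)
  have du: "d u ^ r + (if u \<in> N' - N then D ^ (r - 1) else 0) - (if u \<in> N - N' then r * ?n ^ (r - 1) else 0) \<le> d' u ^ r"
    if u: "u \<in> V - {v}" for u
  proof -
    have vN: "v \<in> E `` {u} \<longleftrightarrow> u \<in> N" using E_sym by (auto simp: N_def)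
    have E'u: "E' `` {u} = (if u \<in> N' then insert v (E `` {u} - {v}) else E `` {u} - {v})"
      using u N' E_sym by (auto simp: E'_def N_def)
    consider "u \<in> N' - N" | "u \<in> N - N'" | "u \<in> N \<inter> N'" | "u \<notin> N" "u \<notin> N'" by blast
    then show ?thesis
    proof cases
      case 1
      then have "E `` {u} - {v} = E `` {u}" "v \<notin> E `` {u}" using vN by auto
      then have "d' u = d u + 1" using E'u 1 by (simp add: d'_def d_def)
      moreover have "d u ^ r + d u ^ (r - 1) \<le> (d u + 1) ^ r"
      proof -
        have "(d u + 1) * d u ^ (r - 1) \<le> (d u + 1) * (d u + 1) ^ (r - 1)"
          using dn by (intro mult_left_mono power_mono) auto
        then show ?thesis using assms(1) by (cases r) (auto simp: algebra_simps)
      qed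
      moreover have "D ^ (r - 1) \<le> d u ^ (r - 1)" using 1 D by (intro power_mono) (auto simp: d_def)
      ultimately show ?thesis using 1 by auto
    next
      case 2
      then have "v \<in> E `` {u}" using vN by simp
      then have "0 < card (E `` {u})" using card_gt_0_iff[of "E `` {u}"] by blast
      moreover have "E' `` {u} = E `` {u} - {v}" using E'u 2 by simp
      ultimately have "d' u = d u - 1" "1 \<le> d u"
        using \<open>v \<in> E `` {u}\<close> by (simp_all add: d'_def d_def card_Diff_singleton)
      then show ?thesis using power_diff_le[of "d u" ?n "d u - 1" 1 r] dn[of u] assms(1) 2 by auto
    next
      case 3
      then have "v \<in> E `` {u}" using vN by simp
      then have "E' `` {u} = E `` {u}" using E'u 3 by auto
      then show ?thesis using 3 by (simp add: d'_def d_def)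
    next
      case 4
      then have "v \<notin> E `` {u}" using vN by simp
      then have "E' `` {u} = E `` {u}" using E'u 4 by auto
      then show ?thesis using 4 by (simp add: d'_def d_def)
    qed
  qed
  let ?U = "V - {v}"
  have "(\<Sum>u\<in>?U. d u ^ r + (if u \<in> N' - N then D ^ (r - 1) else 0) - (if u \<in> N - N' then r * ?n ^ (r - 1) else 0))
     \<le> (\<Sum>u\<in>?U. d' u ^ r)" by (intro sum_mono du)
  moreover have "(\<Sum>u\<in>?U. d u ^ r + (if u \<in> N' - N then D ^ (r - 1) else 0) - (if u \<in> N - N' then r * ?n ^ (r - 1) else 0))
    = (\<Sum>u\<in>?U. d u ^ r) + card (N' - N) * D ^ (r - 1) - card (N - N') * (r * ?n ^ (r - 1))"
  proof -
    have fU: "finite ?U" using finite_V by simp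
    have "?U \<inter> (N' - N) = N' - N" "?U \<inter> (N - N') = N - N'" using N' NV by auto
    then have "(\<Sum>u\<in>?U. if u \<in> N' - N then D ^ (r - 1) else 0) = card (N' - N) * D ^ (r - 1)"
       "(\<Sum>u\<in>?U. if u \<in> N - N' then r * ?n ^ (r - 1) else 0) = card (N - N') * (r * ?n ^ (r - 1))"
      using sum.inter_restrict[OF fU, of "\<lambda>_. D ^ (r - 1)" "N' - N"]
        sum.inter_restrict[OF fU, of "\<lambda>_. r * ?n ^ (r - 1)" "N - N'"] by simp_all
    then show ?thesis by (simp only: sum.distrib sum_subtractf)
  qed
  moreover have "(\<Sum>u\<in>?U. d' u ^ r) + d' v ^ r \<le> (\<Sum>u\<in>?U. d u ^ r) + d v ^ r"
  proof -
    have "(\<Sum>u\<in>V. d' u ^ r) \<le> (\<Sum>u\<in>V. d u ^ r)"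
      using le unfolding E'_def[symmetric] power_sum_def d_def d'_def by (simp flip: of_nat_power of_nat_sum)
    then show ?thesis using sum.remove[OF finite_V v] by (metis add.commute)
  qed
  ultimately have "card (N' - N) * D ^ (r - 1) \<le> card (N - N') * (r * ?n ^ (r - 1)) + r * b * ?n ^ (r - 1)"
    using dv by linarith
  moreover have "card (N - N') * (r * ?n ^ (r - 1)) \<le> b * (r * ?n ^ (r - 1))"
    using b by (intro mult_right_mono) (auto simp: N_def)
  ultimately show ?thesis by (simp add: N_def algebra_simps)
qed

lemma not_embeds_multipartite:
  assumes "\<not> colorable VF EF k" "\<forall>v\<in>V. c v < k"
  shows "\<not> embeds VF EF V (multipartite V c)"
proof
  assume "embeds VF EF V (multipartite V c)"
  then obtain f where f: "inj_on f VF" "f ` VF \<subseteq> V" "\<And>x y. (x, y) \<in> EF \<Longrightarrow> (f x, f y) \<in> multipartite V c"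
    by (rule embedsE) blast
  have "\<forall>v\<in>VF. (c \<circ> f) v < k" using f(2) assms(2) by auto
  moreover have "\<forall>(u, v)\<in>EF. (c \<circ> f) u \<noteq> (c \<circ> f) v"
    using f(3) by (fastforce simp: multipartite_def)
  ultimately show False using assms(1) unfolding colorable_def by blast
qed

section \<open>Graphs close to a complete partite graph\<close>

text \<open>\<kappa> measures the classes, \<tau> the defect of a typical vertex, \<beta> the
  threshold for an apex, \<gamma> the defect of a good vertex, and \<open>f\<close> bounds the order
  of the graphs to be embedded. \<open>Gd\<close> supplies the images of all vertices whose images
  are not prescribed. The room conditions say that a class, or the part of it seen by one apex,
  outlasts the defects of \<open>f\<close> vertices and the images already used.\<close>

locale near_partite = sgraph V E for V :: "'a set" and E +
  fixes k f :: nat and \<kappa> \<tau> \<beta> \<gamma> :: real and c :: "'a \<Rightarrow> nat" and Gd :: "'a set"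
  assumes c_less: "v \<in> V \<Longrightarrow> c v < k"
    and Gd_subset: "Gd \<subseteq> V"
    and class_ge: "i < k \<Longrightarrow> \<kappa> * card V \<le> card {v \<in> Gd. c v = i}"
    and Gd_missing: "v \<in> Gd \<Longrightarrow> card {u \<in> V. c u \<noteq> c v \<and> (v, u) \<notin> E} \<le> \<gamma> * card V"
    and typical: "v \<in> V \<Longrightarrow> (\<forall>i<k. \<beta> * card V \<le> card {u \<in> Gd. c u = i \<and> (v, u) \<in> E}) \<or>
      card {u \<in> V. c u = c v \<and> (v, u) \<in> E} \<le> \<tau> * card V \<and>
      card {u \<in> V. c u \<noteq> c v \<and> (v, u) \<notin> E} \<le> \<tau> * card V"
    and pos: "0 < \<kappa>" "0 < \<tau>" "0 < \<beta>" "0 < \<gamma>" "V \<noteq> {}"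
    and room: "f * (\<tau> + \<gamma>) * card V + 2 * f \<le> \<kappa> * card V"
    and room_apex: "f * \<gamma> * card V + 2 * f \<le> \<beta> * card V"
begin

definition apex :: "'a set" where
  "apex = {v \<in> V. \<forall>i<k. \<beta> * card V \<le> card {u \<in> Gd. c u = i \<and> (v, u) \<in> E}}"

lemma in_degree_le: "v \<in> V - apex \<Longrightarrow> card {u \<in> V. c u = c v \<and> (v, u) \<in> E} \<le> \<tau> * card V"
  and missing_le: "v \<in> V - apex \<Longrightarrow> card {u \<in> V. c u \<noteq> c v \<and> (v, u) \<notin> E} \<le> \<tau> * card V"
  using typical[of v] by (auto simp: apex_def)

text \<open>\<open>g\<close> prescribes images on \<open>S\<close>, and \<open>h\<close> properly
  colours the rest. A vertex outside \<open>S\<close> may see several typical images, since each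
  excludes only \<open>\<tau> * n\<close> of the \<open>\<kappa> * n\<close> vertices of a class. If
  an apex is involved, it may see at most one prescribed vertex: an apex is only known to have
  \<open>\<beta> * n\<close> neighbours in a class, and two such neighbourhoods may be
  disjoint.\<close>

lemma embeds_extend:
  assumes F: "sgraph VF EF" "card VF \<le> f"
    and S: "S \<subseteq> VF" "inj_on g S" "g ` S \<subseteq> V" "\<And>x y. \<lbrakk>(x, y) \<in> EF; x \<in> S; y \<in> S\<rbrakk> \<Longrightarrow> (g x, g y) \<in> E"
    and h: "\<And>z. z \<in> VF - S \<Longrightarrow> h z < k" "\<And>z w. \<lbrakk>(z, w) \<in> EF; z \<notin> S; w \<notin> S\<rbrakk> \<Longrightarrow> h z \<noteq> h w"
    and bd: "\<And>z. z \<in> VF - S \<Longrightarrow> (\<forall>s\<in>S. (s, z) \<in> EF \<longrightarrow> g s \<notin> apex \<and> c (g s) \<noteq> h z) \<or>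
       (\<exists>s\<in>S. g s \<in> apex \<and> (\<forall>s'\<in>S. (s', z) \<in> EF \<longrightarrow> s' = s))"
  shows "embeds VF EF V E"
proof -
  interpret F: sgraph VF EF by fact
  let ?n = "real (card V)"
  have finS: "finite S" using S(1) F.finite_V finite_subset by blast
  have finG: "finite Gd" using Gd_subset finite_V finite_subset by blast
  have cS: "card S \<le> f" using card_mono[OF F.finite_V S(1)] F(2) by simp
  have cgS: "card (g ` S) \<le> f" using card_image_le[OF finS, of g] cS by simp
  define X where "X z = {u \<in> Gd. c u = h z \<and> u \<notin> g ` S \<and> (\<forall>s\<in>S. (s, z) \<in> EF \<longrightarrow> (g s, u) \<in> E)}" for z
  have finX: "finite (X z)" for z using finG by (simp add: X_def)
  \<comment> \<open>The size that \<open>greedy_embedding\<close> demands for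
    \<open>\<mu> = \<gamma> * n\<close> and at most \<open>f\<close> vertices.\<close>
  have X_ge: "f * (\<gamma> * ?n + 1) \<le> card (X z)" if z: "z \<in> VF - S" for z
    using bd[OF z]
  proof
    assume a: "\<forall>s\<in>S. (s, z) \<in> EF \<longrightarrow> g s \<notin> apex \<and> c (g s) \<noteq> h z"
    let ?T = "{s \<in> S. (s, z) \<in> EF}"
    let ?m = "\<lambda>s. {u \<in> V. c u \<noteq> c (g s) \<and> (g s, u) \<notin> E}"
    define M where "M = (\<Union>s\<in>?T. ?m s)"
    have "{u \<in> Gd. c u = h z} \<subseteq> X z \<union> g ` S \<union> M"
      using a Gd_subset by (auto simp: X_def M_def)
    then have "card {u \<in> Gd. c u = h z} \<le> card (X z \<union> g ` S \<union> M)"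
      using finX finS finite_V by (intro card_mono) (auto simp: M_def)
    also have "\<dots> \<le> card (X z) + card (g ` S) + card M"
      by (meson add_mono_thms_linordered_semiring(3) card_Un_le order_trans)
    finally have 1: "card {u \<in> Gd. c u = h z} \<le> card (X z) + f + card M" using cgS by simp
    have "card M \<le> (\<Sum>s\<in>?T. card (?m s))" unfolding M_def using finS by (intro card_UN_le) auto
    then have "real (card M) \<le> (\<Sum>s\<in>?T. real (card (?m s)))" by (simp flip: of_nat_sum)
    also have "\<dots> \<le> of_nat (card ?T) * (\<tau> * ?n)"
      using a S(3) by (intro sum_bounded_above missing_le) auto
    also have "\<dots> \<le> f * (\<tau> * ?n)"
    proof -
      have "card ?T \<le> card S" using finS by (intro card_mono) auto
      then show ?thesis using cS pos by (intro mult_right_mono) auto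
    qed
    finally have "\<kappa> * ?n \<le> card (X z) + f + f * (\<tau> * ?n)"
      using 1 class_ge[OF h(1)[OF z]] by linarith
    then show ?thesis using room by (simp add: algebra_simps)
  next
    assume "\<exists>s\<in>S. g s \<in> apex \<and> (\<forall>s'\<in>S. (s', z) \<in> EF \<longrightarrow> s' = s)"
    then obtain s where s: "s \<in> S" "g s \<in> apex" "\<forall>s'\<in>S. (s', z) \<in> EF \<longrightarrow> s' = s" by blast
    have "{u \<in> Gd. c u = h z \<and> (g s, u) \<in> E} \<subseteq> X z \<union> g ` S" using s by (auto simp: X_def)
    then have "card {u \<in> Gd. c u = h z \<and> (g s, u) \<in> E} \<le> card (X z \<union> g ` S)"
      using finX finS by (intro card_mono) auto
    also have "\<dots> \<le> card (X z) + f" using card_Un_le[of "X z" "g ` S"] cgS by linarith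
    finally have "\<beta> * ?n \<le> card (X z) + f" using s(2) h(1)[OF z] by (auto simp: apex_def)
    then show ?thesis using room_apex by (simp add: algebra_simps)
  qed
  have "\<exists>e. inj_on e (VF - S) \<and> (\<forall>z\<in>VF - S. e z \<in> X z) \<and>
    (\<forall>z\<in>VF - S. \<forall>w\<in>VF - S. (z, w) \<in> EF \<longrightarrow> (e z, e w) \<in> E)"
  proof (rule greedy_embedding[where \<mu> = "\<gamma> * ?n"])
    fix z assume z: "z \<in> VF - S"
    have "card (VF - S) \<le> f" using F(2) card_mono[OF F.finite_V, of "VF - S"] by auto
    then have "card (VF - S) * (\<gamma> * ?n + 1) \<le> f * (\<gamma> * ?n + 1)"
      using pos by (intro mult_right_mono) auto
    then show "card (VF - S) * (\<gamma> * ?n + 1) \<le> card (X z)" using X_ge[OF z] by linarith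
  next
    fix z w x assume a: "z \<in> VF - S" "w \<in> VF - S" "(z, w) \<in> EF" "x \<in> X z"
    then have x: "x \<in> Gd" "c x = h z" by (auto simp: X_def)
    have "h z \<noteq> h w" using h(2)[OF a(3)] a by auto
    then have "X w - E `` {x} \<subseteq> {u \<in> V. c u \<noteq> c x \<and> (x, u) \<notin> E}"
      using Gd_subset x by (auto simp: X_def)
    then have "card (X w - E `` {x}) \<le> card {u \<in> V. c u \<noteq> c x \<and> (x, u) \<notin> E}"
      using finite_V by (intro card_mono) auto
    then show "card (X w - E `` {x}) \<le> \<gamma> * ?n" using Gd_missing[OF x(1)] by linarith
  qed (use finX F.finite_V sym_E F.sym_E F.irrefl_E pos in auto)
  then obtain e where e: "inj_on e (VF - S)" "\<And>z. z \<in> VF - S \<Longrightarrow> e z \<in> X z"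
    "\<And>z w. z \<in> VF - S \<Longrightarrow> w \<in> VF - S \<Longrightarrow> (z, w) \<in> EF \<Longrightarrow> (e z, e w) \<in> E" by blast
  define j where "j z = (if z \<in> S then g z else e z)" for z
  have ge: "g s \<noteq> e z" if "s \<in> S" "z \<in> VF - S" for s z   proof -
    have "e z \<notin> g ` S" using e(2)[OF that(2)] by (simp add: X_def)
    then show ?thesis using that(1) by (metis imageI)
  qed
  have "inj_on j VF"
  proof (rule inj_onI)
    fix x y assume xy: "x \<in> VF" "y \<in> VF" "j x = j y"
    show "x = y"
    proof (cases "x \<in> S"; cases "y \<in> S")
      assume "x \<in> S" "y \<in> S" then show ?thesis using xy S(2) by (auto simp: j_def inj_on_def)
    next
      assume "x \<in> S" "y \<notin> S" then show ?thesis using xy ge[of x y] by (auto simp: j_def)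
    next
      assume "x \<notin> S" "y \<in> S" then show ?thesis using xy ge[of y x] by (auto simp: j_def)
    next
      assume "x \<notin> S" "y \<notin> S" then show ?thesis using xy e(1) by (auto simp: j_def inj_on_def)
    qed
  qed
  moreover have "j ` VF \<subseteq> V"
    using S(3) e(2) Gd_subset by (auto simp: j_def X_def image_subset_iff)
  moreover have "(j x, j y) \<in> E" if xy: "(x, y) \<in> EF" for x y
  proof -
    have V: "x \<in> VF" "y \<in> VF" using xy F.E_subset by auto
    have cross: "(g s, e z) \<in> E" if "s \<in> S" "z \<in> VF - S" "(s, z) \<in> EF" for s z
      using e(2)[OF that(2)] that by (auto simp: X_def)
    show ?thesis
    proof (cases "x \<in> S"; cases "y \<in> S")
      assume "x \<in> S" "y \<in> S" then show ?thesis using S(4)[OF xy] by (auto simp: j_def)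
    next
      assume "x \<in> S" "y \<notin> S" then show ?thesis using cross[of x y] xy V by (auto simp: j_def)
    next
      assume "x \<notin> S" "y \<in> S" then show ?thesis using cross[of y x] F.E_sym[OF xy] V E_sym by (auto simp: j_def)
    next
      assume "x \<notin> S" "y \<notin> S" then show ?thesis using e(3)[of x y] xy V by (auto simp: j_def)
    qed
  qed
  ultimately show ?thesis by (rule embedsI)
qed

end

lemma ex_min_pos4:
  fixes a b c d :: real
  assumes "0 < a" "0 < b" "0 < c" "0 < d"
  shows "\<exists>g>0. g \<le> a \<and> g \<le> b \<and> g \<le> c \<and> g \<le> d"
  using assms by (intro exI[of _ "min (min a b) (min c d)"]) auto

section \<open>Extremal graphs are near partite\<close>

text \<open>Stability controls all vertices outside few wrong pairs directly. The remaining ones may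
  have to change their class or become apices, and for them extremality replaces counting. The
  quantifiers allow \<tau> to be arbitrarily small in terms of \<kappa>, which the color-critical
  case exploits.\<close>

theorem extremal_near_partite:
  assumes F: "sgraph VF EF" "colorable VF EF (Suc k)" "\<not> colorable VF EF k" and "2 \<le> k" "1 \<le> r"
  shows "\<exists>\<kappa> :: real. 0 < \<kappa> \<and> (\<forall>\<tau> :: real. 0 < \<tau> \<longrightarrow> 2 * real (card VF) * \<tau> \<le> \<kappa> \<longrightarrow> (\<exists>n0. \<forall>(V :: 'a set) E. extremal r VF EF V E \<longrightarrow> n0 \<le> card V \<longrightarrow>
     (\<exists>\<beta> \<gamma> c Gd. near_partite V E k (card VF) \<kappa> \<tau> \<beta> \<gamma> c Gd)))"
proof -
  define \<kappa>\<^sub>0 where "\<kappa>\<^sub>0 = class_const k r"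
  have \<kappa>\<^sub>0: "0 < \<kappa>\<^sub>0" using assms(4) by (simp add: \<kappa>\<^sub>0_def class_const_def)
  define f where "f = card VF"
  show ?thesis
  proof (intro exI[of _ "\<kappa>\<^sub>0 / 2"] conjI allI impI)
    show "0 < \<kappa>\<^sub>0 / 2" using \<kappa>\<^sub>0 by simp
    fix \<tau> :: real assume \<tau>: "0 < \<tau>" "2 * real (card VF) * \<tau> \<le> \<kappa>\<^sub>0 / 2"
    \<comment> \<open>The factor that results from \<open>missing_nbrs_le\<close> with
      \<open>D = \<kappa>\<^sub>0 / 2 * n\<close>.\<close>
    define C where "C = 2 * real r * (2 / \<kappa>\<^sub>0) ^ (r - 1)"
    have C: "0 \<le> C" using \<kappa>\<^sub>0 by (simp add: C_def)
    \<comment> \<open>Chosen so that the missing neighbours of a vertex that is not full, at most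
      \<open>2 * C * \<beta>\<^sub>1 * n\<close> up to bad vertices, and its neighbours in its own
      class, at most \<open>2 * \<beta>\<^sub>1 * n\<close>, both stay within
      \<open>\<tau> * n\<close>.\<close>
    define \<beta>\<^sub>1 where "\<beta>\<^sub>1 = \<tau> / (2 * C + 2)"
    have \<beta>\<^sub>1: "0 < \<beta>\<^sub>1" "(2 * C + 2) * \<beta>\<^sub>1 = \<tau>" using \<tau> C by (auto simp: \<beta>\<^sub>1_def)
    define \<beta> where "\<beta> = \<beta>\<^sub>1 / 2"
    have \<beta>: "0 < \<beta>" using \<beta>\<^sub>1 by (simp add: \<beta>_def)
    obtain \<gamma> where \<gamma>: "0 < \<gamma>" "\<gamma> \<le> \<beta> / (2 * (f + 1))" "\<gamma> \<le> \<kappa>\<^sub>0 / (16 * (f + 1))"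
      using ex_min_pos4[of "\<beta> / (2 * (f + 1))" "\<kappa>\<^sub>0 / (16 * (f + 1))" 1 1] \<beta> \<kappa>\<^sub>0 by auto
    obtain g where g: "0 < g" "g \<le> \<gamma> / 2" "g \<le> \<beta>\<^sub>1 / 2" "g \<le> \<kappa>\<^sub>0 / 2" "g \<le> \<kappa>\<^sub>0 / (4 * (f + 1))"
      using ex_min_pos4[of "\<gamma> / 2" "\<beta>\<^sub>1 / 2" "\<kappa>\<^sub>0 / 2" "\<kappa>\<^sub>0 / (4 * (f + 1))"] \<beta>\<^sub>1 \<kappa>\<^sub>0 \<gamma> by auto
    \<comment> \<open>The square serves Markov's inequality: with at most
      \<open>g\<^sup>2 * n\<^sup>2\<close> wrong pairs, at most \<open>g * n\<close> vertices lie in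
      more than \<open>g * n\<close> of them.\<close>
    define \<epsilon> where "\<epsilon> = min (g\<^sup>2) (\<kappa>\<^sub>0 / (2 * r))"
    have \<epsilon>: "0 < \<epsilon>" "\<epsilon> \<le> g\<^sup>2" "r * \<epsilon> < \<kappa>\<^sub>0"
    proof -
      show "0 < \<epsilon>" "\<epsilon> \<le> g\<^sup>2" using g \<kappa>\<^sub>0 assms(5) by (auto simp: \<epsilon>_def)
      have "r * \<epsilon> \<le> r * (\<kappa>\<^sub>0 / (2 * r))" by (intro mult_left_mono) (auto simp: \<epsilon>_def)
      then show "r * \<epsilon> < \<kappa>\<^sub>0" using \<kappa>\<^sub>0 assms(5) by simp
    qed
    have k1: "1 \<le> k" using assms(4) by simp
    obtain n1 where n1: "\<And>(V :: 'a set) E. sgraph V E \<Longrightarrow> n1 \<le> card V \<Longrightarrow> \<not> embeds VF EF V E \<Longrightarrow>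
     (\<forall>c. (\<forall>v\<in>V. c v < k) \<longrightarrow> power_sum r V (multipartite V c) \<le> power_sum r V E) \<Longrightarrow>
     (\<exists>c. (\<forall>v\<in>V. c v < k) \<and> card (wrong_pairs V E c) \<le> \<epsilon> * (real (card V))\<^sup>2)"
      using stability[OF F(1,2) k1 assms(5) \<epsilon>(1), where 'a = 'a] by blast
    obtain n2 :: nat where n2: "16 * f / \<kappa>\<^sub>0 \<le> n2" using real_arch_simple by blast
    obtain n3 :: nat where n3: "4 * f / \<beta> \<le> n3" using real_arch_simple by blast
    define n0 where "n0 = max (max n1 n2) (max n3 (8 * k))"
    show "\<exists>n0. \<forall>(V :: 'a set) E. extremal r VF EF V E \<longrightarrow> n0 \<le> card V \<longrightarrow>
     (\<exists>\<beta> \<gamma> c Gd. near_partite V E k (card VF) (\<kappa>\<^sub>0 / 2) \<tau> \<beta> \<gamma> c Gd)"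
    proof (intro exI[of _ n0] allI impI)
      fix V :: "'a set" and E
      assume ex: "extremal r VF EF V E" and nn: "n0 \<le> card V"
      interpret sgraph V E using ex by (simp add: extremal_def)
      let ?n = "real (card V)"
      have free: "\<not> embeds VF EF V E" using ex by (simp add: extremal_def)
      have max: "power_sum r V E' \<le> power_sum r V E" if "sgraph V E'" "\<not> embeds VF EF V E'" for E'
        using ex that by (simp add: extremal_def)
      have maxc: "power_sum r V (multipartite V c) \<le> power_sum r V E" if "\<forall>v\<in>V. c v < k" for c
        using that by (intro max sgraph_multipartite not_embeds_multipartite[OF F(3)]) (auto simp: finite_V)
      have n: "n1 \<le> card V" "real n2 \<le> ?n" "real n3 \<le> ?n" "8 * k \<le> card V"
        using nn by (auto simp: n0_def)
      have n_pos: "0 < ?n" using n(4) assms(4) by simp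
      have fn: "16 * f \<le> \<kappa>\<^sub>0 * ?n" "4 * f \<le> \<beta> * ?n"
        using order_trans[OF n2 n(2)] order_trans[OF n3 n(3)] \<kappa>\<^sub>0 \<beta> by (auto simp: field_simps)
      obtain c0 where c0: "\<forall>v\<in>V. c0 v < k" and wr: "card (wrong_pairs V E c0) \<le> \<epsilon> * ?n\<^sup>2"
        using n1[OF sgraph_axioms n(1) free] maxc by blast
      define A where "A i = {v \<in> V. c0 v = i}" for i
      have A_ge: "\<kappa>\<^sub>0 * ?n \<le> card (A i)" if "i < k" for i
        using class_size_ge[OF k1 assms(5) n(4) c0 wr _ maxc that] \<epsilon>(3) by (simp add: \<kappa>\<^sub>0_def A_def)
      define W where "W = wrong_pairs V E c0"
      interpret W: sgraph V W
        using finite_V E_subset E_irrefl unfolding W_def wrong_pairs_def multipartite_def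
        by unfold_locales (auto simp: sym_def irrefl_def dest: E_sym)
      define Gd where "Gd = {v \<in> V. card (W `` {v}) \<le> g * ?n}"
      have Gd_sub: "Gd \<subseteq> V" by (auto simp: Gd_def)
      have fin: "finite Gd" "finite (V - Gd)" using finite_V by (auto simp: Gd_def)
      have bad: "card (V - Gd) \<le> g * ?n"
      proof -
        have "card (V - Gd) * (g * ?n) \<le> (\<Sum>v\<in>V - Gd. real (card (W `` {v})))"
          by (rule sum_bounded_below) (auto simp: Gd_def)
        also have "\<dots> \<le> (\<Sum>v\<in>V. real (card (W `` {v})))"
          using finite_V by (intro sum_mono2) auto
        also have "\<dots> = real (card W)" using W.sum_degree by (metis of_nat_sum)
        also have "\<dots> \<le> g\<^sup>2 * ?n\<^sup>2" using wr mult_right_mono[OF \<epsilon>(2), of "?n\<^sup>2"] by (simp add: W_def)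
        also have "\<dots> = (g * ?n) * (g * ?n)" by (simp add: power2_eq_square)
        finally show ?thesis using g(1) n_pos by simp
      qed
      have le_bad: "card P \<le> card Q + g * ?n" if "P \<subseteq> Q \<union> (V - Gd)" "finite Q" for P Q
      proof -
        have "card P \<le> card (Q \<union> (V - Gd))" using that fin by (intro card_mono) auto
        also have "\<dots> \<le> card Q + card (V - Gd)" by (rule card_Un_le)
        finally show ?thesis using bad by linarith
      qed
      define p where "p v i = {u \<in> V. c0 u = i \<and> (v, u) \<in> E}" for v i
      have finp: "finite (p v i)" for v i using finite_V by (simp add: p_def)
      define full where "full v \<longleftrightarrow> (\<forall>i<k. \<beta>\<^sub>1 * ?n \<le> card (p v i))" for v
      \<comment> \<open>A vertex with many neighbours in its own class but few in some other one
        moves to such a class. Vertices that see much of every class keep their colour and become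
        apices. Good vertices keep theirs too, so classes lose at most the bad vertices.\<close>
      define c where "c v = (if card (p v (c0 v)) < \<beta>\<^sub>1 * ?n \<or> full v then c0 v
         else SOME i. i < k \<and> card (p v i) < \<beta>\<^sub>1 * ?n)" for v
      have g\<beta>: "g * ?n < \<beta>\<^sub>1 * ?n" using g(3) \<beta>\<^sub>1 n_pos by simp
      have c_Gd: "c v = c0 v" if "v \<in> Gd" for v
      proof -
        have "p v (c0 v) \<subseteq> W `` {v}"
          using that by (auto simp: p_def W_def wrong_pairs_def multipartite_def)
        then have "card (p v (c0 v)) \<le> card (W `` {v})" by (intro card_mono) auto
        then have "card (p v (c0 v)) < \<beta>\<^sub>1 * ?n" using that g\<beta> by (simp add: Gd_def)
        then show ?thesis by (simp add: c_def)
      qed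
      have c_low: "c v < k \<and> card (p v (c v)) < \<beta>\<^sub>1 * ?n" if "v \<in> V" "\<not> full v" for v
      proof (cases "card (p v (c0 v)) < \<beta>\<^sub>1 * ?n")
        case True
        then show ?thesis using c0 that by (simp add: c_def)
      next
        case False
        have "\<exists>i. i < k \<and> card (p v i) < \<beta>\<^sub>1 * ?n" using that(2) by (auto simp: full_def not_le)
        from someI_ex[OF this] show ?thesis using False that(2) by (simp add: c_def)
      qed
      have gn: "2 * (g * ?n) \<le> \<gamma> * ?n" "2 * (g * ?n) \<le> \<beta>\<^sub>1 * ?n" "2 * (g * ?n) \<le> \<kappa>\<^sub>0 * ?n"
        using g n_pos by (auto simp flip: mult.assoc)
      have "near_partite V E k (card VF) (\<kappa>\<^sub>0 / 2) \<tau> \<beta> \<gamma> c Gd"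
      proof unfold_locales
        fix v assume v: "v \<in> V"
        show "c v < k" using c_low[OF v] c0 v by (cases "full v") (auto simp: c_def)
        show "(\<forall>i<k. \<beta> * ?n \<le> card {u \<in> Gd. c u = i \<and> (v, u) \<in> E}) \<or>
          card {u \<in> V. c u = c v \<and> (v, u) \<in> E} \<le> \<tau> * ?n \<and>
          card {u \<in> V. c u \<noteq> c v \<and> (v, u) \<notin> E} \<le> \<tau> * ?n"
        proof (cases "full v")
          case True
          have "\<beta> * ?n \<le> card {u \<in> Gd. c u = i \<and> (v, u) \<in> E}" if "i < k" for i
          proof -
            have "p v i \<subseteq> {u \<in> Gd. c u = i \<and> (v, u) \<in> E} \<union> (V - Gd)" using c_Gd by (auto simp: p_def)
            then have "card (p v i) \<le> card {u \<in> Gd. c u = i \<and> (v, u) \<in> E} + g * ?n"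
              using fin by (intro le_bad) auto
            moreover have "\<beta>\<^sub>1 * ?n \<le> card (p v i)" using True that by (simp add: full_def)
            ultimately show ?thesis using gn(2) by (simp add: \<beta>_def)
          qed
          then show ?thesis by blast
        next
          case False
          define i where "i = c v"
          have i: "i < k" "card (p v i) < \<beta>\<^sub>1 * ?n" using c_low[OF v False] by (auto simp: i_def)
          \<comment> \<open>\<open>v\<close> may be joined to all good vertices outside class
            \<open>i\<close>: each of them misses at most \<open>g * n\<close> vertices of
            \<open>A i\<close>, so \<open>A i\<close> can supply a substitute for \<open>v\<close>.
            The neighbours lost are bad or lie in class \<open>i\<close>, where \<open>v\<close> has
            few.\<close>
          define N' where "N' = {u \<in> Gd. c0 u \<noteq> i \<and> u \<noteq> v}"
          have N': "N' \<subseteq> V - {v}" using Gd_sub by (auto simp: N'_def)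
          have finN': "finite N'" using fin by (simp add: N'_def)
          have 1: "real (card (A i - E `` {x})) \<le> g * ?n" if "x \<in> N'" for x
          proof -
            have "A i - E `` {x} \<subseteq> W `` {x}"
              using that Gd_sub by (auto simp: A_def N'_def W_def wrong_pairs_def multipartite_def)
            then have "card (A i - E `` {x}) \<le> card (W `` {x})" by (intro card_mono) auto
            moreover have "card (W `` {x}) \<le> g * ?n" using that by (auto simp: N'_def Gd_def)
            ultimately show ?thesis by linarith
          qed
          have 2: "card VF * (g * ?n + 1) < card (A i)"
          proof -
            have "f * g \<le> (f + 1) * (\<kappa>\<^sub>0 / (4 * (f + 1)))" using g by (intro mult_mono) auto
            also have "\<dots> = \<kappa>\<^sub>0 / 4" by (simp add: field_simps)
            finally have "f * g * ?n \<le> \<kappa>\<^sub>0 / 4 * ?n" using n_pos by (intro mult_right_mono) auto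
            moreover have "0 < \<kappa>\<^sub>0 * ?n" using \<kappa>\<^sub>0 n_pos by simp
            ultimately show ?thesis using fn(1) A_ge[OF i(1)] unfolding f_def[symmetric] by (simp add: algebra_simps)
          qed
          define E' where "E' = {(x, y) \<in> E. x \<noteq> v \<and> y \<noteq> v} \<union> {v} \<times> N' \<union> N' \<times> {v}"
          have AV: "A i \<subseteq> V" by (auto simp: A_def)
          have gn0: "0 \<le> g * ?n" using g(1) by simp
          have "power_sum r V E' \<le> power_sum r V E"
            using not_embeds_replace_nbrs[OF F(1) free v N' gn0 AV 1 2] unfolding E'_def by (intro max)
          moreover have "real (card (E `` {v} - N')) \<le> (\<beta>\<^sub>1 + g) * ?n"
          proof -
            have "E `` {v} - N' \<subseteq> p v i \<union> (V - Gd)"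
              using nbrs_subset E_irrefl by (auto simp: N'_def p_def)
            from le_bad[OF this finp] show ?thesis using i(2) by (simp add: algebra_simps)
          qed
          moreover have "\<kappa>\<^sub>0 / 2 * ?n \<le> card (E `` {u})" if u: "u \<in> N'" for u
          proof -
            \<comment> \<open>A second class, available since \<open>2 \<le> k\<close>; the good
              vertex \<open>u\<close> sees almost all of it, so its degree is linear.\<close>
            define j where "j = (if c0 u = 0 then 1 else 0 :: nat)"
            have j: "j < k" "j \<noteq> c0 u" using assms(4) by (auto simp: j_def)
            have "A j \<subseteq> E `` {u} \<union> W `` {u}"
              using u j Gd_sub by (auto simp: A_def W_def wrong_pairs_def multipartite_def N'_def)
            then have "card (A j) \<le> card (E `` {u} \<union> W `` {u})" by (intro card_mono) auto
            also have "\<dots> \<le> card (E `` {u}) + card (W `` {u})" by (rule card_Un_le)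
            finally have "real (card (A j)) \<le> card (E `` {u}) + card (W `` {u})" by simp
            moreover have "card (W `` {u}) \<le> g * ?n" using u by (auto simp: N'_def Gd_def)
            ultimately show ?thesis using A_ge[OF j(1)] gn(3) by linarith
          qed
          ultimately have Q: "card (N' - E `` {v}) * (\<kappa>\<^sub>0 / 2 * ?n) ^ (r - 1) \<le> 2 * r * ((\<beta>\<^sub>1 + g) * ?n) * ?n ^ (r - 1)"
            using missing_nbrs_le[OF assms(5) v N', of "(\<beta>\<^sub>1 + g) * ?n" "\<kappa>\<^sub>0 / 2 * ?n"] \<kappa>\<^sub>0
            unfolding E'_def by simp
          have "card (N' - E `` {v}) \<le> C * ((\<beta>\<^sub>1 + g) * ?n)"
          proof -
            have "(card (N' - E `` {v}) * (\<kappa>\<^sub>0 / 2) ^ (r - 1)) * ?n ^ (r - 1) \<le> (2 * r * ((\<beta>\<^sub>1 + g) * ?n)) * ?n ^ (r - 1)"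
              using Q by (simp only: power_mult_distrib mult.assoc)
            then have "card (N' - E `` {v}) * (\<kappa>\<^sub>0 / 2) ^ (r - 1) \<le> 2 * r * ((\<beta>\<^sub>1 + g) * ?n)"
              using n_pos by (simp only: mult_le_cancel_right) simp
            then have "card (N' - E `` {v}) * (\<kappa>\<^sub>0 / 2) ^ (r - 1) * (2 / \<kappa>\<^sub>0) ^ (r - 1) \<le> 2 * r * ((\<beta>\<^sub>1 + g) * ?n) * (2 / \<kappa>\<^sub>0) ^ (r - 1)"
              using \<kappa>\<^sub>0 by (intro mult_right_mono) auto
            also have "\<dots> = C * ((\<beta>\<^sub>1 + g) * ?n)" by (simp add: C_def)
            finally have "card (N' - E `` {v}) * ((\<kappa>\<^sub>0 / 2) ^ (r - 1) * (2 / \<kappa>\<^sub>0) ^ (r - 1)) \<le> C * ((\<beta>\<^sub>1 + g) * ?n)"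
              by (simp only: mult.assoc)
            moreover have "(\<kappa>\<^sub>0 / 2) ^ (r - 1) * (2 / \<kappa>\<^sub>0) ^ (r - 1) = 1"
              using \<kappa>\<^sub>0 by (simp flip: power_mult_distrib)
            ultimately show ?thesis by simp
          qed
          also have "\<dots> \<le> C * (2 * \<beta>\<^sub>1 * ?n)"
            using C gn(2) g\<beta> by (intro mult_left_mono) (auto simp: algebra_simps)
          finally have Q': "card (N' - E `` {v}) \<le> C * (2 * \<beta>\<^sub>1 * ?n)" .
          have \<tau>_eq: "\<tau> * ?n = C * (2 * \<beta>\<^sub>1 * ?n) + 2 * (\<beta>\<^sub>1 * ?n)"
            using \<beta>\<^sub>1(2) by (simp add: algebra_simps flip: \<beta>\<^sub>1(2))
          have nn: "0 \<le> C * (2 * \<beta>\<^sub>1 * ?n)" "0 \<le> \<beta>\<^sub>1 * ?n" using C \<beta>\<^sub>1 by auto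
          have "{u \<in> V. c u = c v \<and> (v, u) \<in> E} \<subseteq> p v i \<union> (V - Gd)"
            using c_Gd by (auto simp: p_def i_def)
          from le_bad[OF this finp] have "card {u \<in> V. c u = c v \<and> (v, u) \<in> E} \<le> \<tau> * ?n"
            using i(2) g\<beta> nn \<tau>_eq by linarith
          moreover have "{u \<in> V. c u \<noteq> c v \<and> (v, u) \<notin> E} \<subseteq> (N' - E `` {v}) \<union> (V - Gd)"
            using c_Gd by (auto simp: N'_def i_def)
          from le_bad[OF this] have "card {u \<in> V. c u \<noteq> c v \<and> (v, u) \<notin> E} \<le> \<tau> * ?n"
            using Q' g\<beta> nn \<tau>_eq finN' by (smt (verit) finite_Diff)
          ultimately show ?thesis by blast
        qed
      next
        fix i assume i: "i < k"
        have "A i \<subseteq> {v \<in> Gd. c v = i} \<union> (V - Gd)" using c_Gd by (auto simp: A_def)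
        from le_bad[OF this] fin have "card (A i) \<le> card {v \<in> Gd. c v = i} + g * ?n" by simp
        then show "\<kappa>\<^sub>0 / 2 * ?n \<le> card {v \<in> Gd. c v = i}" using A_ge[OF i] gn(3) by linarith
      next
        fix v assume v: "v \<in> Gd"
        have "{u \<in> V. c u \<noteq> c v \<and> (v, u) \<notin> E} \<subseteq> W `` {v} \<union> (V - Gd)"
          using v c_Gd Gd_sub by (auto simp: W_def wrong_pairs_def multipartite_def)
        from le_bad[OF this] have "card {u \<in> V. c u \<noteq> c v \<and> (v, u) \<notin> E} \<le> card (W `` {v}) + g * ?n" by simp
        moreover have "card (W `` {v}) \<le> g * ?n" using v by (simp add: Gd_def)
        ultimately show "card {u \<in> V. c u \<noteq> c v \<and> (v, u) \<notin> E} \<le> \<gamma> * ?n" using gn(1) by linarith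
      next
        \<comment> \<open>In units of \<open>\<kappa>\<^sub>0 * n / 16\<close>, the term with \<tau>
          takes 4, the one with \<gamma> takes 1 and \<open>2 * f\<close> takes 2 of the 8
          available.\<close>
        have "f * \<gamma> \<le> (f + 1) * (\<kappa>\<^sub>0 / (16 * (f + 1)))" using \<gamma> by (intro mult_mono) auto
        also have "\<dots> = \<kappa>\<^sub>0 / 16" by (simp add: field_simps)
        finally have "f * (\<tau> + \<gamma>) \<le> 5 / 16 * \<kappa>\<^sub>0" using \<tau>(2) by (simp add: f_def algebra_simps)
        then have "f * (\<tau> + \<gamma>) * ?n \<le> 5 / 16 * \<kappa>\<^sub>0 * ?n" by (intro mult_right_mono) auto
        then show "real (card VF) * (\<tau> + \<gamma>) * ?n + real (2 * card VF) \<le> \<kappa>\<^sub>0 / 2 * ?n"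
          using fn(1) unfolding f_def[symmetric] by simp
      next
        have "f * \<gamma> \<le> (f + 1) * (\<beta> / (2 * (f + 1)))" using \<gamma> by (intro mult_mono) auto
        also have "\<dots> = \<beta> / 2" by (simp add: field_simps)
        finally have "f * \<gamma> * ?n \<le> \<beta> / 2 * ?n" by (intro mult_right_mono) auto
        then show "real (card VF) * \<gamma> * ?n + real (2 * card VF) \<le> \<beta> * ?n"
          using fn(2) unfolding f_def[symmetric] by simp
      qed (use Gd_sub \<kappa>\<^sub>0 \<tau> \<beta> \<gamma> n_pos in auto)
      then show "\<exists>\<beta> \<gamma> c Gd. near_partite V E k (card VF) (\<kappa>\<^sub>0 / 2) \<tau> \<beta> \<gamma> c Gd" by blast
    qed
  qed
qed

text \<open>For the two cases in which any admissible \<tau> will do and the classes have to exceed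
  a constant \<open>m\<close>.\<close>

corollary extremal_near_partite_classes:
  assumes "sgraph VF EF" "colorable VF EF (Suc k)" "\<not> colorable VF EF k" "2 \<le> k" "1 \<le> r"
  shows "\<exists>n0. \<forall>(V :: 'a set) E. extremal r VF EF V E \<longrightarrow> n0 \<le> card V \<longrightarrow>
    (\<exists>\<kappa> \<tau> \<beta> \<gamma> c Gd. near_partite V E k (card VF) \<kappa> \<tau> \<beta> \<gamma> c Gd \<and> (\<forall>i<k. m \<le> card {x \<in> V. c x = i}))"
proof -
  obtain \<kappa> :: real where \<kappa>: "0 < \<kappa>" and near: "\<And>\<tau>. 0 < \<tau> \<Longrightarrow> 2 * real (card VF) * \<tau> \<le> \<kappa> \<Longrightarrow>
     \<exists>n0. \<forall>(V :: 'a set) E. extremal r VF EF V E \<longrightarrow> n0 \<le> card V \<longrightarrow>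
     (\<exists>\<beta> \<gamma> c Gd. near_partite V E k (card VF) \<kappa> \<tau> \<beta> \<gamma> c Gd)"
    using extremal_near_partite[OF assms, where 'a = 'a] by blast
  define \<tau> where "\<tau> = \<kappa> / (2 * card VF + 1)"
  have "0 < \<tau>" "2 * real (card VF) * \<tau> \<le> \<kappa>" using \<kappa> by (auto simp: \<tau>_def field_simps)
  then obtain n1 where n1: "\<And>(V :: 'a set) E. extremal r VF EF V E \<Longrightarrow> n1 \<le> card V \<Longrightarrow>
     (\<exists>\<beta> \<gamma> c Gd. near_partite V E k (card VF) \<kappa> \<tau> \<beta> \<gamma> c Gd)" using near by blast
  obtain n2 :: nat where n2: "m / \<kappa> \<le> n2" using real_arch_simple by blast
  show ?thesis
  proof (intro exI[of _ "max n1 n2"] allI impI)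
    fix V :: "'a set" and E
    assume ex: "extremal r VF EF V E" and nn: "max n1 n2 \<le> card V"
    obtain \<beta> \<gamma> c Gd where np: "near_partite V E k (card VF) \<kappa> \<tau> \<beta> \<gamma> c Gd" using n1[OF ex] nn by auto
    then interpret near_partite V E k "card VF" \<kappa> \<tau> \<beta> \<gamma> c Gd .
    have "m \<le> card {x \<in> V. c x = i}" if i: "i < k" for i
    proof -
      have "m / \<kappa> \<le> card V" using n2 nn by linarith
      then have "m \<le> \<kappa> * card V" using \<kappa> by (simp add: field_simps)
      moreover have "card {x \<in> Gd. c x = i} \<le> card {x \<in> V. c x = i}"
        using Gd_subset finite_V by (intro card_mono) auto
      ultimately show ?thesis using class_ge[OF i] by linarith
    qed
    then show "\<exists>\<kappa> \<tau> \<beta> \<gamma> c Gd. near_partite V E k (card VF) \<kappa> \<tau> \<beta> \<gamma> c Gd \<and> (\<forall>i<k. m \<le> card {x \<in> V. c x = i})"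
      using np by blast
  qed
qed

section \<open>Nearly regular graphs without short cycles\<close>

text \<open>Triangles and 4-cycles are excluded, and loops too, as triangles with equal corners;
  closed walks of length 4 that repeat a vertex remain allowed. These are the cycles that
  \<open>not_embeds_T0\<close> finds inside a class.\<close>

definition girth_ge_5 :: "'a rel \<Rightarrow> bool" where
  "girth_ge_5 E \<longleftrightarrow> (\<forall>x y z. (x, y) \<in> E \<longrightarrow> (y, z) \<in> E \<longrightarrow> (z, x) \<notin> E) \<and>
    (\<forall>x y u w. (x, u) \<in> E \<longrightarrow> (u, y) \<in> E \<longrightarrow> (y, w) \<in> E \<longrightarrow> (w, x) \<in> E \<longrightarrow> x = y \<or> u = w)"

lemma girth_ge_5_mono: "girth_ge_5 E \<Longrightarrow> E' \<subseteq> E \<Longrightarrow> girth_ge_5 E'"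
  unfolding girth_ge_5_def subset_iff by meson

text \<open>A short cycle through the new edge would close a walk of length 2 or 3 from
  \<open>a\<close> to \<open>b\<close>.\<close>

lemma girth_ge_5_insert:
  assumes "girth_ge_5 E" "sym E" "a \<noteq> b" "(a, b) \<notin> E"
    and no2: "\<And>z. \<lbrakk>(a, z) \<in> E; (z, b) \<in> E\<rbrakk> \<Longrightarrow> False"
    and no3: "\<And>z w. \<lbrakk>(a, z) \<in> E; (z, w) \<in> E; (w, b) \<in> E\<rbrakk> \<Longrightarrow> False"
  shows "girth_ge_5 (E \<union> {(a, b), (b, a)})"
proof -
  have s: "\<And>x y. (x, y) \<in> E \<Longrightarrow> (y, x) \<in> E" using assms(2) by (auto dest: symD)
  have t3: "\<And>x y z. \<lbrakk>(x, y) \<in> E; (y, z) \<in> E; (z, x) \<in> E\<rbrakk> \<Longrightarrow> False"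
    and t4: "\<And>x y u w. \<lbrakk>(x, u) \<in> E; (u, y) \<in> E; (y, w) \<in> E; (w, x) \<in> E\<rbrakk> \<Longrightarrow> x = y \<or> u = w"
    using assms(1) unfolding girth_ge_5_def by blast+
  have n1: "(b, a) \<notin> E" "(a, b) \<notin> E" using assms(4) s by blast+
  have i: "(x, x) \<notin> E" for x using t3 by blast
  have m2: "\<And>z. \<lbrakk>(b, z) \<in> E; (z, a) \<in> E\<rbrakk> \<Longrightarrow> False" using no2 s by blast
  have m3: "\<And>z w. \<lbrakk>(b, z) \<in> E; (z, w) \<in> E; (w, a) \<in> E\<rbrakk> \<Longrightarrow> False" using no3 s by blast
  have e: "(x, y) \<in> E \<union> {(a, b), (b, a)} \<longleftrightarrow> (x, y) \<in> E \<or> x = a \<and> y = b \<or> x = b \<and> y = a" for x y by auto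
  show ?thesis unfolding girth_ge_5_def e
  proof (intro conjI allI impI notI)
    fix x y z
    assume "(x, y) \<in> E \<or> x = a \<and> y = b \<or> x = b \<and> y = a" "(y, z) \<in> E \<or> y = a \<and> z = b \<or> y = b \<and> z = a"
      "(z, x) \<in> E \<or> z = a \<and> x = b \<or> z = b \<and> x = a"
    then show False by (elim disjE conjE) (use assms(3) n1 i t3 no2 m2 in auto)
  next
    fix x y u w
    assume "(x, u) \<in> E \<or> x = a \<and> u = b \<or> x = b \<and> u = a" "(u, y) \<in> E \<or> u = a \<and> y = b \<or> u = b \<and> y = a"
      "(y, w) \<in> E \<or> y = a \<and> w = b \<or> y = b \<and> w = a" "(w, x) \<in> E \<or> w = a \<and> x = b \<or> w = b \<and> x = a"
    then show "x = y \<or> u = w"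
      using assms(3) n1 i[of a] i[of b] t4[of x u y w] no3[of y w] m3[of y w] no3[of w x] m3[of w x]
        no3[of x u] m3[of x u] no3[of u y] m3[of u y]
      by (smt (verit, best))
  qed
qed

lemma (in sgraph) card_Image_le:
  assumes "finite S" "\<And>v. card (E `` {v}) \<le> l"
  shows "card (S \<union> E `` S) \<le> (l + 1) * card S"
proof -
  have "E `` S = (\<Union>v\<in>S. E `` {v})" by blast
  then have "card (E `` S) \<le> (\<Sum>v\<in>S. card (E `` {v}))" using assms(1) by (simp only: card_UN_le)
  also have "\<dots> \<le> card S * l" using assms(2) sum_bounded_above[of S "\<lambda>v. card (E `` {v})" l] by simp
  finally show ?thesis using card_Un_le[of S "E `` S"] by (simp add: algebra_simps)
qed

lemma sgraph_switch:
  assumes "sgraph V E" "(x, y) \<in> E" "u \<in> V" "v \<in> V" "u \<noteq> x" "v \<noteq> y"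
  shows "sgraph V (E - {(x, y), (y, x)} \<union> {(u, x), (x, u)} \<union> {(v, y), (y, v)})"
proof -
  interpret sgraph V E by fact
  show ?thesis
    using finite_V E_subset assms(2-6) E_irrefl
    by unfold_locales (auto simp: sym_def irrefl_def dest: E_sym)
qed

definition nearly_regular :: "nat \<Rightarrow> 'a set \<Rightarrow> 'a rel \<Rightarrow> bool" where
  "nearly_regular l A H \<longleftrightarrow> (\<forall>x\<in>A. card (H `` {x}) = l) \<or>
    (\<exists>w\<in>A. card (H `` {w}) + 1 = l \<and> (\<forall>x\<in>A - {w}. card (H `` {x}) = l))"

text \<open>In an edge-maximal graph, two missing degrees at \<open>u\<close> and \<open>v\<close> could be filled by replacing a
  far away edge \<open>xy\<close> by \<open>ux\<close> and \<open>vy\<close>.\<close>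

lemma almost_regular_girth_ge_5_exists:
  fixes l :: nat
  assumes V: "finite V" "2 * (l + 1) ^ 4 + 2 \<le> card V"
  shows "\<exists>E. sgraph V E \<and> girth_ge_5 E \<and> (\<forall>v. card (E `` {v}) \<le> l) \<and> nearly_regular l V E"
proof -
  define P where "P E \<longleftrightarrow> sgraph V E \<and> girth_ge_5 E \<and> (\<forall>v. card (E `` {v}) \<le> l)" for E
  have "P {}" using V(1) by (auto simp: P_def girth_ge_5_def sym_def irrefl_def intro!: sgraph.intro)
  moreover have "\<forall>E. P E \<longrightarrow> card E < Suc (card (V \<times> V))"
  proof (intro allI impI le_imp_less_Suc card_mono)
    fix E assume "P E"
    then show "E \<subseteq> V \<times> V" unfolding P_def by (blast dest: sgraph.E_subset)
  qed (use V(1) in simp)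
  ultimately have "\<exists>E. P E \<and> (\<forall>E'. P E' \<longrightarrow> card E' \<le> card E)"
    by (rule ex_has_greatest_nat)
  then obtain E where E: "P E" and max: "\<And>E'. P E' \<Longrightarrow> card E' \<le> card E" by blast
  interpret sgraph V E using E by (simp add: P_def)
  have g5: "girth_ge_5 E" and deg: "\<And>v. card (E `` {v}) \<le> l" using E by (auto simp: P_def)
  show ?thesis
  proof (rule ccontr)
    assume "\<not> ?thesis"
    then have no: "\<not> nearly_regular l V E" using E unfolding P_def by blast
    then obtain u where u: "u \<in> V" "card (E `` {u}) < l"
      using deg le_neq_implies_less unfolding nearly_regular_def by blast
    \<comment> \<open>Failure of \<open>nearly_regular\<close> leaves two alternatives: a second
      deficient vertex, or \<open>v = u\<close> lacking at least two degrees.\<close>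
    obtain v where v: "v \<in> V" "card (E `` {v}) < l" "u = v \<longrightarrow> card (E `` {u}) + 2 \<le> l"
    proof (cases "card (E `` {u}) + 1 = l")
      case True
      then obtain v where "v \<in> V - {u}" "card (E `` {v}) \<noteq> l"
        using no u(1) unfolding nearly_regular_def by blast
      then show ?thesis using that[of v] deg[of v] by auto
    next
      case False
      then show ?thesis using that[of u] u by auto
    qed
    define R where "R S = S \<union> E `` S" for S
    have R: "finite (R S) \<and> card (R S) \<le> (l + 1) * card S" if "finite S" for S
    proof -
      have "finite (E `` S)" using finite_E by (rule finite_Image)
      then show ?thesis using that card_Image_le[OF that deg] by (simp add: R_def)
    qed
    have R_step: "b \<in> R S" if "a \<in> S" "(a, b) \<in> E" for a b S using that by (auto simp: R_def)
    have R_self: "a \<in> R S" if "a \<in> S" for a S using that by (auto simp: R_def)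
    \<comment> \<open>Balls around \<open>u\<close> and \<open>v\<close>. An edge \<open>x y\<close>
      that starts outside \<open>B4\<close> has \<open>y\<close> outside \<open>B3\<close>, so no
      walk of length at most 3 leads from \<open>u\<close> or \<open>v\<close> to \<open>x\<close>
      or \<open>y\<close>. \<open>B4\<close> has at most \<open>2 * (l + 1) ^ 4\<close> vertices,
      and the \<open>+ 2\<close> in the hypothesis leaves two vertices outside.\<close>
    define B1 B2 B3 B4 where "B1 = R {u, v}" and "B2 = R B1" and "B3 = R B2" and "B4 = R B3"
    have "card {u, v} \<le> 2" by (simp add: card_insert_if)
    then have "card B1 \<le> (l + 1) * 2" using R[of "{u, v}"] unfolding B1_def
      by (meson finite.emptyI finite.insertI mult_le_mono2 order_trans)
    moreover have fin: "finite B1" "finite B2" "finite B3" "finite B4"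
      using R unfolding B1_def B2_def B3_def B4_def by auto
    ultimately have "card B2 \<le> (l + 1) * ((l + 1) * 2)" using R[of B1] unfolding B2_def
      by (meson mult_le_mono2 order_trans)
    then have "card B3 \<le> (l + 1) * ((l + 1) * ((l + 1) * 2))" using R[of B2] fin unfolding B3_def
      by (meson mult_le_mono2 order_trans)
    then have "card B4 \<le> (l + 1) * ((l + 1) * ((l + 1) * ((l + 1) * 2)))" using R[of B3] fin unfolding B4_def
      by (meson mult_le_mono2 order_trans)
    also have "\<dots> = 2 * (l + 1) ^ 4" unfolding power4_eq_xxxx by (simp only: ac_simps)
    finally have "card B4 + 2 \<le> card V" using V(2) by linarith
    then have "2 \<le> card (V - B4)" using diff_card_le_card_Diff[OF fin(4), of V] by linarith
    then obtain p q where pq: "p \<in> V - B4" "q \<in> V - B4" "p \<noteq> q"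
      by (metis One_nat_def card_le_Suc0_iff_eq finite_Diff V(1) not_less_eq_eq numeral_2_eq_2)
    have "\<exists>E'. P E' \<and> card E < card E'"
    proof (cases "\<exists>x\<in>V - B4. E `` {x} \<noteq> {}")
      \<comment> \<open>All vertices outside \<open>B4\<close> are isolated, so two of them can be
        joined; \<open>l\<close> is positive because \<open>u\<close> has degree below
        \<open>l\<close>.\<close>
      case False
      then have iso: "E `` {p} = {}" "E `` {q} = {}" using pq by auto
      let ?E = "E \<union> {(p, q), (q, p)}"
      have "girth_ge_5 ?E" using iso by (intro girth_ge_5_insert[OF g5 sym_E pq(3)]) auto
      moreover have "sgraph V ?E"
        using finite_V E_subset pq E_irrefl by unfold_locales (auto simp: sym_def irrefl_def dest: E_sym)
      moreover have "card (?E `` {z}) \<le> l" for z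
      proof -
        have "?E `` {z} = (if z = p then {q} else if z = q then {p} else E `` {z})" using iso pq(3) by auto
        then show ?thesis using u(2) deg[of z] by auto
      qed
      moreover have "card E < card ?E" using iso finite_E by (intro psubset_card_mono) auto
      ultimately show ?thesis unfolding P_def by blast
    next
      case True
      then obtain x y where xy: "x \<in> V - B4" "(x, y) \<in> E" by blast
      have yx: "(y, x) \<in> E" using E_sym xy(2) by blast
      have x4: "x \<notin> B4" using xy by blast
      then have y3: "y \<notin> B3" using R_step[OF _ yx, of B3] by (auto simp: B4_def)
      have x3: "x \<notin> B3" using x4 R_self by (auto simp: B4_def)
      have xy2: "x \<notin> B2" "y \<notin> B2" using x3 y3 R_self unfolding B3_def by blast+
      have xy1: "x \<notin> B1" "y \<notin> B1" using xy2 R_self unfolding B2_def by blast+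
      have uv1: "u \<in> B1" "v \<in> B1" unfolding B1_def by (auto intro: R_self)
      have ne: "u \<noteq> x" "u \<noteq> y" "v \<noteq> x" "v \<noteq> y" "x \<noteq> y" using xy1 uv1 xy E_irrefl by auto
      have w2: "False" if "s \<in> {u, v}" "t \<in> {x, y}" "(s, z) \<in> E" "(z, t) \<in> E" for s t z
        using that xy2 R_step[of s "{u, v}" z] R_step[of z B1 t] unfolding B1_def[symmetric] B2_def[symmetric] by auto
      have w3: "False" if "s \<in> {u, v}" "t \<in> {x, y}" "(s, z) \<in> E" "(z, z') \<in> E" "(z', t) \<in> E" for s t z z'
        using that x3 y3 R_step[of s "{u, v}" z] R_step[of z B1 z'] R_step[of z' B2 t]
        unfolding B1_def[symmetric] B2_def[symmetric] B3_def[symmetric] by auto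
      have w1: "(s, t) \<notin> E" if "s \<in> {u, v}" "t \<in> {x, y}" for s t
        using that xy1 R_step[of s "{u, v}" t] unfolding B1_def[symmetric] by auto
      define E1 where "E1 = E - {(x, y), (y, x)}"
      define E2 where "E2 = E1 \<union> {(u, x), (x, u)}"
      define E3 where "E3 = E2 \<union> {(v, y), (y, v)}"
      have E1E: "E1 \<subseteq> E" by (auto simp: E1_def)
      have sym1: "sym E1" "sym E2" using sym_E by (auto simp: E1_def E2_def sym_def)
      have "girth_ge_5 E2" unfolding E2_def
      proof (rule girth_ge_5_insert[OF girth_ge_5_mono[OF g5 E1E] sym1(1) ne(1)])
        show "(u, x) \<notin> E1" using w1[of u x] E1E by blast
        show False if "(u, z) \<in> E1" "(z, x) \<in> E1" for z using w2[of u x z] that E1E by blast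
        show False if "(u, z) \<in> E1" "(z, w) \<in> E1" "(w, x) \<in> E1" for z w
          using w3[of u x z w] that E1E by blast
      qed
      moreover have "(v, y) \<notin> E2" using w1[of v y] ne by (auto simp: E2_def E1_def)
      moreover have "False" if "(v, z) \<in> E2" "(z, y) \<in> E2" for z
        using that w2[of v y z] ne w1[of v x] by (auto simp: E2_def E1_def)
      moreover have "False" if "(v, z) \<in> E2" "(z, w) \<in> E2" "(w, y) \<in> E2" for z w
      proof -
        \<comment> \<open>If \<open>u = v\<close>, the walk may begin with the new edge
          \<open>u x\<close>; then \<open>x w y\<close> and the deleted edge \<open>y x\<close>
          would form a triangle in \<open>E\<close>.\<close>
        have tri: "\<not> ((x, w) \<in> E \<and> (w, y) \<in> E)" using g5 yx unfolding girth_ge_5_def by blast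
        have wy: "(w, y) \<in> E" "\<not> (w = x)" using that(3) ne by (auto simp: E2_def E1_def)
        show False using that(1,2) wy tri w3[of v y z w] w1[of u y] w1[of v x] ne
          by (auto simp: E2_def E1_def)
      qed
      ultimately have g3: "girth_ge_5 E3" unfolding E3_def
        by (intro girth_ge_5_insert sym1 ne) auto
      have sg: "sgraph V E3" unfolding E3_def E2_def E1_def
        using sgraph_switch[OF sgraph_axioms xy(2) u(1) v(1) ne(1,4)] .
      have d3: "card (E3 `` {z}) \<le> l" for z
      proof -
        consider "z = x" | "z = y" | "z = u" "u \<noteq> v" | "z = v" "u \<noteq> v" | "z = u" "u = v" | "z \<notin> {x, y, u, v}" by auto
        then show ?thesis
        proof cases
          case 1
          then have "E3 `` {z} = insert u (E `` {x} - {y})" using ne by (auto simp: E3_def E2_def E1_def)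
          moreover have "card (insert u (E `` {x} - {y})) \<le> Suc (card (E `` {x} - {y}))" by (simp add: card_insert_if)
          moreover have "Suc (card (E `` {x} - {y})) = card (E `` {x})" using xy(2) by (intro card.remove[symmetric]) auto
          ultimately show ?thesis using deg[of x] by simp
        next
          case 2
          then have "E3 `` {z} = insert v (E `` {y} - {x})" using ne by (auto simp: E3_def E2_def E1_def)
          moreover have "card (insert v (E `` {y} - {x})) \<le> Suc (card (E `` {y} - {x}))" by (simp add: card_insert_if)
          moreover have "Suc (card (E `` {y} - {x})) = card (E `` {y})" using yx by (intro card.remove[symmetric]) auto
          ultimately show ?thesis using deg[of y] by simp
        next
          case 3
          then have "E3 `` {z} = insert x (E `` {u})" using ne by (auto simp: E3_def E2_def E1_def)
          then show ?thesis using u(2) by (simp add: card_insert_if)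
        next
          case 4
          then have "E3 `` {z} = insert y (E `` {v})" using ne by (auto simp: E3_def E2_def E1_def)
          then show ?thesis using v(2) by (simp add: card_insert_if)
        next
          case 5
          then have "E3 `` {z} = insert x (insert y (E `` {u}))" using ne by (auto simp: E3_def E2_def E1_def)
          then show ?thesis using v(3) 5 by (simp add: card_insert_if)
        next
          case 6
          then have "E3 `` {z} = E `` {z}" by (auto simp: E3_def E2_def E1_def)
          then show ?thesis using deg by simp
        qed
      qed
      have "card E < card E3"
      proof -
        have new: "(u, x) \<notin> E" "(x, u) \<notin> E" "(v, y) \<notin> E" "(y, v) \<notin> E"
          using w1 E_sym by blast+
        have "E3 = insert (u, x) (insert (x, u) (insert (v, y) (insert (y, v) (E - {(x, y), (y, x)}))))"
          by (auto simp: E3_def E2_def E1_def)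
        then have "card E3 = card (E - {(x, y), (y, x)}) + 4"
          using new ne finite_E by simp
        moreover have "card (E - {(x, y), (y, x)}) + 2 = card E"
        proof -
          have "card (E - {(x, y), (y, x)}) = card E - card {(x, y), (y, x)}"
            using xy yx by (intro card_Diff_subset) auto
          moreover have "card {(x, y), (y, x)} = 2" using ne by simp
          moreover have "card {(x, y), (y, x)} \<le> card E" using xy yx finite_E by (intro card_mono) auto
          ultimately show ?thesis by linarith
        qed
        ultimately show ?thesis by linarith
      qed
      then show ?thesis using sg g3 d3 unfolding P_def by blast
    qed
    then show False using max by (meson not_le)
  qed
qed

lemma (in sgraph) even_sum_degree: "even (\<Sum>v\<in>V. card (E `` {v}))"
proof -
  have "even (card E)" if "finite E" "sym E" "irrefl E" for E :: "'a rel"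
    using that
  proof (induction "card E" arbitrary: E rule: less_induct)
    case less
    show ?case
    proof (cases "E = {}")
      case False
      then obtain x y where xy: "(x, y) \<in> E" by auto
      then have yx: "(y, x) \<in> E" "x \<noteq> y" using less.prems by (auto dest: symD simp: irrefl_def)
      let ?E = "E - {(x, y), (y, x)}"
      have "card ?E = card E - card {(x, y), (y, x)}" using xy yx by (intro card_Diff_subset) auto
      moreover have "card {(x, y), (y, x)} = 2" using yx by simp
      moreover have "card {(x, y), (y, x)} \<le> card E" using xy yx less.prems by (intro card_mono) auto
      ultimately have c: "card E = card ?E + 2" by linarith
      have "even (card ?E)" using less.prems c
        by (intro less.hyps) (auto simp: sym_def irrefl_def)
      then show ?thesis using c by simp
    qed simp
  qed
  then show ?thesis unfolding sum_degree using finite_E sym_E irrefl_E by blast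
qed

section \<open>Color-critical components\<close>

lemma power_sum_mono:
  assumes "sgraph V E'" "E \<subseteq> E'"
  shows "power_sum r V E \<le> power_sum r V E'"
proof -
  interpret sgraph V E' by fact
  show ?thesis unfolding power_sum_def
    using assms(2) by (intro sum_mono power_mono card_mono) auto
qed

text \<open>If a matching with fewer than \<open>m\<close> edges cannot be extended, its endpoints
  meet every edge.\<close>

lemma matching_or_cover:
  assumes "sym D" "irrefl D"
  shows "(\<exists>x y. inj_on x {..<m} \<and> inj_on y {..<m} \<and> x ` {..<m} \<inter> y ` {..<m} = {} \<and> (\<forall>i<m. (x i, y i) \<in> D)) \<or>
    (\<exists>C. finite C \<and> card C \<le> 2 * m \<and> (\<forall>(a, b)\<in>D. a \<in> C \<or> b \<in> C))"
proof (induction m)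
  case 0
  then show ?case by auto
next
  case (Suc m)
  then show ?case
  proof
    assume "\<exists>x y. inj_on x {..<m} \<and> inj_on y {..<m} \<and> x ` {..<m} \<inter> y ` {..<m} = {} \<and> (\<forall>i<m. (x i, y i) \<in> D)"
    then obtain x y where xy: "inj_on x {..<m}" "inj_on y {..<m}" "x ` {..<m} \<inter> y ` {..<m} = {}" "\<forall>i<m. (x i, y i) \<in> D"
      by blast
    define C where "C = x ` {..<m} \<union> y ` {..<m}"
    have C: "finite C" "card C \<le> 2 * Suc m"
    proof -
      have "card C \<le> card (x ` {..<m}) + card (y ` {..<m})" unfolding C_def by (rule card_Un_le)
      also have "\<dots> \<le> card {..<m} + card {..<m}" by (intro add_mono card_image_le) auto
      finally show "card C \<le> 2 * Suc m" by simp
    qed (simp add: C_def)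
    show ?thesis
    proof (cases "\<forall>(a, b)\<in>D. a \<in> C \<or> b \<in> C")
      case True
      then show ?thesis using C by blast
    next
      case False
      then obtain a b where ab: "(a, b) \<in> D" "a \<notin> C" "b \<notin> C" by blast
      then have "a \<noteq> b" using assms(2) by (auto simp: irrefl_def)
      let ?x = "x(m := a)" and ?y = "y(m := b)"
      have "inj_on ?x {..<Suc m}" "inj_on ?y {..<Suc m}"
        using xy(1,2) ab by (auto simp: inj_on_def C_def less_Suc_eq)
      moreover have "?x ` {..<Suc m} \<inter> ?y ` {..<Suc m} = {}"
      proof -
        have "?x ` {..<Suc m} = insert a (x ` {..<m})" "?y ` {..<Suc m} = insert b (y ` {..<m})"
          by (auto simp: lessThan_Suc)
        then show ?thesis using xy(3) ab \<open>a \<noteq> b\<close> by (auto simp: C_def)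
      qed
      moreover have "\<forall>i<Suc m. (?x i, ?y i) \<in> D" using xy(4) ab by (simp add: less_Suc_eq)
      ultimately show ?thesis by blast
    qed
  next
    assume "\<exists>C. finite C \<and> card C \<le> 2 * m \<and> (\<forall>(a, b)\<in>D. a \<in> C \<or> b \<in> C)"
    then obtain C where "finite C" "card C \<le> 2 * m" "\<forall>(a, b)\<in>D. a \<in> C \<or> b \<in> C" by blast
    moreover from this(2) have "card C \<le> 2 * Suc m" by simp
    ultimately show ?thesis by blast
  qed
qed

text \<open>\<open>cp\<close> numbers the components; those numbered below \<open>s\<close> have chromatic number \<open>k + 1\<close> and
  \<open>u i v i\<close> is a critical edge of the \<open>i\<close>-th one, so the only edges on which \<open>c0\<close> fails to be proper are these.\<close>

locale critical_components = F: sgraph VF EF for VF :: "'b set" and EF +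
  fixes k s :: nat and cp :: "'b \<Rightarrow> nat" and u v :: "nat \<Rightarrow> 'b" and c0 :: "'b \<Rightarrow> nat"
  assumes cp_eq: "(x, y) \<in> EF \<Longrightarrow> cp x = cp y"
    and uv: "i < s \<Longrightarrow> (u i, v i) \<in> EF" and cp_u: "i < s \<Longrightarrow> cp (u i) = i"
    and c0_less: "x \<in> VF \<Longrightarrow> c0 x < k"
    and c0_eq: "(x, y) \<in> EF \<Longrightarrow> c0 x = c0 y \<Longrightarrow> \<exists>i<s. {x, y} = {u i, v i}"
    and not_col: "i < s \<Longrightarrow> \<not> colorable {x \<in> VF. cp x = i} {(x, y) \<in> EF. cp x = i} k"
    and s_pos: "0 < s"
begin

lemma cp_v: "i < s \<Longrightarrow> cp (v i) = i"
  using cp_eq[OF uv] cp_u by simp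

lemma u_neq_v: "i < s \<Longrightarrow> u i \<noteq> v i"
  using uv F.E_irrefl by metis

text \<open>Otherwise \<open>c0\<close> would be proper on the \<open>i\<close>-th component, where
  the critical edge is the only possible conflict.\<close>

lemma c0_uv: "i < s \<Longrightarrow> c0 (u i) = c0 (v i)"
proof (rule ccontr)
  assume i: "i < s" and ne: "c0 (u i) \<noteq> c0 (v i)"
  have "c0 x \<noteq> c0 y" if xy: "(x, y) \<in> EF" "cp x = i" for x y
  proof
    assume "c0 x = c0 y"
    then obtain j where j: "j < s" "{x, y} = {u j, v j}" using c0_eq[OF xy(1)] by blast
    then have "x = u j \<or> x = v j" by (auto simp: doubleton_eq_iff)
    then have "j = i" using cp_u[OF j(1)] cp_v[OF j(1)] xy(2) by auto
    then show False using j ne \<open>c0 x = c0 y\<close> by (auto simp: doubleton_eq_iff)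
  qed
  then have "colorable {x \<in> VF. cp x = i} {(x, y) \<in> EF. cp x = i} k"
    unfolding colorable_def using c0_less by (intro exI[of _ c0]) auto
  then show False using not_col[OF i] by simp
qed

text \<open>The extra colour \<open>k\<close> goes to one end of each critical edge; these ends lie
  in different components, so no two are adjacent.\<close>

lemma colorable_Suc: "colorable VF EF (Suc k)"
  unfolding colorable_def
proof (intro exI conjI ballI)
  let ?c = "\<lambda>x. if \<exists>i<s. x = u i then k else c0 x"
  show "?c x < Suc k" if "x \<in> VF" for x using c0_less[OF that] by auto
  fix e assume e: "e \<in> EF"
  obtain x y where xy: "e = (x, y)" by (cases e)
  have "?c x \<noteq> ?c y"
  proof
    assume eq: "?c x = ?c y"
    have less: "c0 x < k" "c0 y < k" using c0_less e xy F.E_subset by auto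
    show False
    proof (cases "\<exists>i<s. x = u i")
      case True
      then obtain j where "j < s" "y = u j" using eq less by (auto split: if_splits)
      then show False using True cp_eq e xy cp_u F.E_irrefl by (metis (no_types))
    next
      case False
      then have "c0 x = c0 y" "\<not> (\<exists>i<s. y = u i)" using eq less by (auto split: if_splits)
      then show False using c0_eq e xy False by (metis doubleton_eq_iff)
    qed
  qed
  then show "case e of (x, y) \<Rightarrow> ?c x \<noteq> ?c y" by (simp add: xy)
qed

text \<open>Fewer than \<open>s\<close> vertices cannot meet all \<open>s\<close> critical components.\<close>

lemma not_embeds_few_apex:
  assumes X: "finite X" "card X < s" and c: "\<And>x. x \<in> V \<Longrightarrow> x \<notin> X \<Longrightarrow> c x < k"
  shows "\<not> embeds VF EF V (multipartite V c)"
proof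
  assume "embeds VF EF V (multipartite V c)"
  then obtain f where f: "inj_on f VF" "f ` VF \<subseteq> V" "\<And>x y. (x, y) \<in> EF \<Longrightarrow> (f x, f y) \<in> multipartite V c"
    by (rule embedsE) blast
  let ?T = "cp ` {x \<in> VF. f x \<in> X}"
  have finT: "finite ?T" using F.finite_V by simp
  have "card ?T \<le> card {x \<in> VF. f x \<in> X}" using F.finite_V by (intro card_image_le) simp
  also have "\<dots> = card (f ` {x \<in> VF. f x \<in> X})"
    using f(1) by (intro card_image[symmetric]) (auto simp: inj_on_def)
  also have "\<dots> \<le> card X" using X(1) by (intro card_mono) auto
  finally have "card ?T < card {..<s}" using X(2) by simp
  then have "\<not> {..<s} \<subseteq> ?T" using card_mono[OF finT, of "{..<s}"] by linarith
  then obtain i where i: "i < s" "i \<notin> ?T" by auto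
  have "colorable {x \<in> VF. cp x = i} {(x, y) \<in> EF. cp x = i} k"
    unfolding colorable_def
  proof (intro exI[of _ "c \<circ> f"] conjI ballI)
    fix x assume "x \<in> {x \<in> VF. cp x = i}"
    then have "f x \<in> V" "f x \<notin> X" using i(2) f(2) by auto
    then show "(c \<circ> f) x < k" using c by simp
  qed (use f(3) in \<open>auto simp: multipartite_def\<close>)
  then show False using not_col[OF i(1)] by simp
qed

lemma not_colorable: "\<not> colorable VF EF k"
proof
  assume "colorable VF EF k"
  then obtain c where "\<forall>x\<in>VF. c x < k" "\<forall>(x, y)\<in>EF. c x \<noteq> c y" by (auto simp: colorable_def)
  then have "colorable {x \<in> VF. cp x = 0} {(x, y) \<in> EF. cp x = 0} k"
    unfolding colorable_def by (intro exI[of _ c]) auto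
  then show False using not_col[OF s_pos] by simp
qed

text \<open>Each critical component needs one exceptional image: an apex for \<open>u i\<close> if
  \<open>i < w\<close>, an edge inside a class for its critical edge if \<open>w \<le> i\<close>.
  Outside these vertices \<open>c0\<close> is a proper \<open>k\<close>-colouring, so that
  \<open>embeds_extend\<close> applies; vertices of other components see no prescribed
  vertex.\<close>

lemma (in near_partite) embeds_critical_components:
  assumes cc: "critical_components VF EF k s cp u v c0" and f: "card VF \<le> f" and w: "w \<le> s"
    and a: "\<And>i. i < w \<Longrightarrow> a i \<in> apex" "inj_on a {..<w}"
    and xy: "\<And>i. \<lbrakk>w \<le> i; i < s\<rbrakk> \<Longrightarrow> (x i, y i) \<in> E \<and> x i \<notin> apex \<and> y i \<notin> apex \<and> c (x i) = c (y i)"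
      "inj_on x {w..<s}" "inj_on y {w..<s}" "x ` {w..<s} \<inter> y ` {w..<s} = {}"
  shows "embeds VF EF V E"
proof -
  interpret cc: critical_components VF EF k s cp u v c0 by fact
  define S where "S = u ` {..<s} \<union> v ` {w..<s}"
  define g where "g z = (if z = u (cp z) then (if cp z < w then a (cp z) else x (cp z)) else y (cp z))" for z
  \<comment> \<open>The class containing the edge \<open>x i y i\<close> is given. Exchanging its
    colour with \<open>c0 (u i)\<close> throughout the component matches the critical edge to this
    class and keeps the colouring of the rest proper.\<close>
  define sw where "sw p q t = (if t = p then q else if t = q then p else t)" for p q t :: nat
  define h where "h z = (if w \<le> cp z \<and> cp z < s then sw (c0 (u (cp z))) (c (x (cp z))) (c0 z) else c0 z)" for z
  have aV: "a i \<in> V" if "i < w" for i using a(1)[OF that] by (simp add: apex_def)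
  have xyV: "x i \<in> V" "y i \<in> V" if "w \<le> i" "i < s" for i using xy(1)[OF that] E_subset by auto
  have g_u: "g (u i) = (if i < w then a i else x i)" if "i < s" for i
    using cc.cp_u[OF that] by (simp add: g_def)
  have g_v: "g (v i) = y i" if "i < s" for i
    using cc.cp_v[OF that] cc.u_neq_v[OF that] by (auto simp: g_def)
  have S_cases: thesis if "z \<in> S" "\<And>i. i < s \<Longrightarrow> z = u i \<Longrightarrow> thesis" "\<And>i. w \<le> i \<Longrightarrow> i < s \<Longrightarrow> z = v i \<Longrightarrow> thesis" for z thesis
    using that by (auto simp: S_def)
  have ax: "a i \<noteq> x j" "a i \<noteq> y j" if "i < w" "w \<le> j" "j < s" for i j
    using a(1)[OF that(1)] xy(1)[OF that(2,3)] by auto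
  have xyd: "x i \<noteq> y j" if "w \<le> i" "i < s" "w \<le> j" "j < s" for i j
  proof -
    have "x i \<in> x ` {w..<s}" "y j \<in> y ` {w..<s}" using that by auto
    then show ?thesis using xy(4) by (metis IntI empty_iff)
  qed
  have injs: "x i = x j \<Longrightarrow> i = j" "y i = y j \<Longrightarrow> i = j" if "w \<le> i" "i < s" "w \<le> j" "j < s" for i j
    using xy(2,3) that by (auto simp: inj_on_def)
  have inja: "a i = a j \<Longrightarrow> i = j" if "i < w" "j < w" for i j using a(2) that by (auto simp: inj_on_def)
  have sw: "sw p q t < k" if "p < k" "q < k" "t < k" for p q t using that by (simp add: sw_def)
  have sw_inj: "sw p q t = sw p q t' \<Longrightarrow> t = t'" for p q t t' by (auto simp: sw_def split: if_splits)
  have sw_q: "sw p q t = q \<longleftrightarrow> t = p" for p q t by (auto simp: sw_def)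
  have cp_less: "cp z < s" if "z \<in> S" for z using that cc.cp_u cc.cp_v by (auto simp: S_def)
  have S_uv: "z = u (cp z) \<or> w \<le> cp z \<and> z = v (cp z)" if "z \<in> S" for z
    using that cc.cp_u cc.cp_v by (auto simp: S_def)
  have g_eq: "x = y" if xyS: "p \<in> S" "q \<in> S" "g p = g q" and "x = p" "y = q" for p q x y
  proof -
    note P = S_uv[OF xyS(1)] cp_less[OF xyS(1)] and Q = S_uv[OF xyS(2)] cp_less[OF xyS(2)]
    have "cp p = cp q"
      using xyS(3) P Q g_u[of "cp p"] g_v[of "cp p"] g_u[of "cp q"] g_v[of "cp q"]
        ax[of "cp p" "cp q"] ax[of "cp q" "cp p"] xyd[of "cp p" "cp q"] xyd[of "cp q" "cp p"]
        injs[of "cp p" "cp q"] inja[of "cp p" "cp q"]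
      by (smt (verit) not_le)
    then show ?thesis
      using that P Q g_u[of "cp p"] g_v[of "cp p"] xyd[of "cp p" "cp p"] by (smt (verit) not_le)
  qed
  show ?thesis
  proof (rule embeds_extend[OF cc.F.sgraph_axioms f, of S g h])
    have "u i \<in> VF" "v i \<in> VF" if "i < s" for i using cc.uv[OF that] cc.F.E_subset by auto
    then show "S \<subseteq> VF" by (auto simp: S_def)
    show "inj_on g S" by (rule inj_onI) (rule g_eq, auto)
    show "g ` S \<subseteq> V"
    proof (rule image_subsetI)
      fix z assume "z \<in> S"
      then show "g z \<in> V" by (rule S_cases) (auto simp: g_u g_v aV xyV)
    qed
    show "(g p, g q) \<in> E" if pq: "(p, q) \<in> EF" "p \<in> S" "q \<in> S" for p q
    proof -
      define i where "i = cp p"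
      have i: "cp p = i" "cp q = i" "i < s" using cc.cp_eq[OF pq(1)] cp_less[OF pq(2)] by (auto simp: i_def)
      have "p \<noteq> q" using pq(1) cc.F.E_irrefl by auto
      then have "w \<le> i \<and> (p = u i \<and> q = v i \<or> p = v i \<and> q = u i)"
        using S_uv[OF pq(2)] S_uv[OF pq(3)] i by auto
      then show ?thesis using xy(1)[of i] i(3) g_u[of i] g_v[of i] E_sym by auto
    qed
    show "h z < k" if z: "z \<in> VF - S" for z
    proof (cases "w \<le> cp z \<and> cp z < s")
      case True
      then have "u (cp z) \<in> VF" using cc.uv cc.F.E_subset by blast
      then show ?thesis using True z cc.c0_less xyV c_less by (auto simp: h_def intro: sw)
    qed (use z cc.c0_less in \<open>auto simp: h_def\<close>)
    show "h z \<noteq> h t" if zt: "(z, t) \<in> EF" "z \<notin> S" "t \<notin> S" for z t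
    proof
      assume "h z = h t"
      then have "c0 z = c0 t"
        using cc.cp_eq[OF zt(1)] sw_inj[of "c0 (u (cp t))" "c (x (cp t))" "c0 z" "c0 t"]
        by (simp add: h_def split: if_splits)
      then obtain i where "i < s" "{z, t} = {u i, v i}" using cc.c0_eq[OF zt(1)] by blast
      then show False using zt(2,3) by (auto simp: S_def doubleton_eq_iff)
    qed
    show "(\<forall>s\<in>S. (s, z) \<in> EF \<longrightarrow> g s \<notin> apex \<and> c (g s) \<noteq> h z) \<or>
       (\<exists>s\<in>S. g s \<in> apex \<and> (\<forall>s'\<in>S. (s', z) \<in> EF \<longrightarrow> s' = s))" if z: "z \<in> VF - S" for z
    proof -
      define i where "i = cp z"
      have nb: "p = u i \<or> w \<le> i \<and> p = v i" "i < s" if "p \<in> S" "(p, z) \<in> EF" for p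
        using S_uv[OF that(1)] cp_less[OF that(1)] cc.cp_eq[OF that(2)] by (auto simp: i_def)
      consider "i < w" | "w \<le> i" "i < s" | "s \<le> i" by linarith
      then show ?thesis
      proof cases
        case 1
        then have "i < s" using w by simp
        then have "u i \<in> S" "g (u i) \<in> apex" using 1 g_u[of i] a(1) by (auto simp: S_def)
        moreover have "\<forall>s'\<in>S. (s', z) \<in> EF \<longrightarrow> s' = u i" using nb 1 by force
        ultimately show ?thesis by blast
      next
        case 2
        have "g p \<notin> apex \<and> c (g p) \<noteq> h z" if p: "p \<in> S" "(p, z) \<in> EF" for p
        proof -
          have p': "p = u i \<or> p = v i" using nb[OF p] by blast
          have hz: "h z = sw (c0 (u i)) (c (x i)) (c0 z)" using 2 by (simp add: h_def i_def)
          have "c0 z \<noteq> c0 (u i)"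
          proof
            assume "c0 z = c0 (u i)"
            then have "c0 p = c0 z" using p' cc.c0_uv[OF 2(2)] by auto
            then obtain j where j: "j < s" "{p, z} = {u j, v j}" using cc.c0_eq[OF p(2)] by blast
            then have "z = u j \<or> z = v j" by (auto simp: doubleton_eq_iff)
            moreover have "j = i" using \<open>z = u j \<or> z = v j\<close> cc.cp_u cc.cp_v j(1) by (auto simp: i_def)
            ultimately show False using z 2 by (auto simp: S_def)
          qed
          then have "h z \<noteq> c (x i)" using hz sw_q by metis
          then show ?thesis using p' g_u[OF 2(2)] g_v[OF 2(2)] xy(1)[OF 2] 2 by auto
        qed
        then show ?thesis by blast
      next
        case 3
        then show ?thesis using nb by force
      qed
    qed
  qed
qed

end

text \<open>The number \<open>w\<close> of apices decides. If it is \<open>s - 1\<close>, one edge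
  inside a class would complete \<open>F\<close>, so \<open>E\<close> is contained in the asserted
  graph. If it is smaller, making one more vertex \<open>v0\<close> adjacent to all others gains
  order \<open>(\<kappa> * n) ^ r\<close>, whereas the edges inside classes, having no matching of
  size \<open>s - w\<close>, contribute only order \<open>\<tau> * n ^ r\<close>. The bound 2 on the
  other classes ensures later that exactly \<open>s - 1\<close> parts have order 1.\<close>

theorem (in critical_components) extremal_multipartite:
  assumes "2 \<le> k" "1 \<le> r"
  shows "\<exists>n0. \<forall>(V :: 'a set) E. extremal r VF EF V E \<longrightarrow> n0 \<le> card V \<longrightarrow>
    (\<exists>c. (\<forall>x\<in>V. c x < k + (s - 1)) \<and> (\<forall>i<k. 2 \<le> card {x \<in> V. c x = i}) \<and>
      (\<forall>i. k \<le> i \<longrightarrow> i < k + (s - 1) \<longrightarrow> card {x \<in> V. c x = i} = 1) \<and>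
      \<not> embeds VF EF V (multipartite V c) \<and> power_sum r V E \<le> power_sum r V (multipartite V c))"
proof -
  define f where "f = card VF"
  obtain \<kappa> :: real where \<kappa>: "0 < \<kappa>" and near: "\<And>\<tau>. 0 < \<tau> \<Longrightarrow> 2 * real f * \<tau> \<le> \<kappa> \<Longrightarrow>
     \<exists>n0. \<forall>(V :: 'a set) E. extremal r VF EF V E \<longrightarrow> n0 \<le> card V \<longrightarrow>
     (\<exists>\<beta> \<gamma> c Gd. near_partite V E k f \<kappa> \<tau> \<beta> \<gamma> c Gd)"
    using extremal_near_partite[OF F.sgraph_axioms colorable_Suc not_colorable assms, where 'a = 'a]
    unfolding f_def by blast
  \<comment> \<open>The bounds serve, in this order, the hypothesis of \<open>near\<close>, the
    claim that a typical vertex misses at least half of \<open>\<kappa> * n\<close> in its own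
    class, and the final contradiction with a factor 2 to spare.\<close>
  obtain \<tau> where \<tau>: "0 < \<tau>" "\<tau> \<le> \<kappa> / (2 * f + 1)" "\<tau> \<le> \<kappa> / 2" "\<tau> \<le> (\<kappa> / 4) ^ r / (8 * s * r)"
    using ex_min_pos4[of "\<kappa> / (2 * f + 1)" "\<kappa> / 2" "(\<kappa> / 4) ^ r / (8 * s * r)" 1] \<kappa> s_pos assms(2) by auto
  have "2 * real f * \<tau> \<le> (2 * real f + 1) * (\<kappa> / (2 * f + 1))" using \<tau> by (intro mult_mono) auto
  also have "\<dots> = \<kappa>" by (simp add: field_simps)
  finally obtain n1 where n1: "\<And>(V :: 'a set) E. extremal r VF EF V E \<Longrightarrow> n1 \<le> card V \<Longrightarrow>
     (\<exists>\<beta> \<gamma> c Gd. near_partite V E k f \<kappa> \<tau> \<beta> \<gamma> c Gd)" using near[OF \<tau>(1)] by blast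
  \<comment> \<open>With \<open>\<kappa> * n \<ge> 4 + 2 * s\<close>, a class keeps two vertices
    after losing fewer than \<open>s\<close> apices, and \<open>\<kappa> / 4 * n \<ge> 1\<close>
    absorbs the \<open>- 1\<close> in the degree \<open>n - 1\<close> of \<open>v0\<close>.\<close>
  obtain n2 :: nat where n2: "(4 + 2 * s) / \<kappa> \<le> n2" using real_arch_simple by blast
  define n0 where "n0 = max (max n1 n2) (4 * s)"
  show ?thesis
  proof (intro exI[of _ n0] allI impI)
    fix V :: "'a set" and E
    assume ex: "extremal r VF EF V E" and nn: "n0 \<le> card V"
    let ?n = "real (card V)"
    have n: "n1 \<le> card V" "n2 \<le> card V" "4 * s \<le> card V" using nn by (auto simp: n0_def)
    obtain \<beta> \<gamma> c Gd where "near_partite V E k f \<kappa> \<tau> \<beta> \<gamma> c Gd" using n1[OF ex n(1)] by blast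
    then interpret near_partite V E k f \<kappa> \<tau> \<beta> \<gamma> c Gd .
    have free: "\<not> embeds VF EF V E"
      and max: "\<And>E'. sgraph V E' \<Longrightarrow> \<not> embeds VF EF V E' \<Longrightarrow> power_sum r V E' \<le> power_sum r V E"
      using ex by (auto simp: extremal_def)
    have "(4 + 2 * s) / \<kappa> \<le> ?n" using n2 n(2) by linarith
    then have \<kappa>n: "4 + 2 * s \<le> \<kappa> * ?n" using \<kappa> by (simp add: field_simps)
    have n_pos: "0 < ?n" using n(3) s_pos by simp
    have finA: "finite apex" using finite_V by (simp add: apex_def)
    have AV: "apex \<subseteq> V" by (auto simp: apex_def)
    have cc: "critical_components VF EF k s cp u v c0" by (rule critical_components_axioms)
    have card_apex: "card apex < s"
    proof (rule ccontr)
      assume "\<not> ?thesis"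
      then obtain A where A: "A \<subseteq> apex" "card A = s" by (metis obtain_subset_with_card_n not_less)
      then obtain a where a: "bij_betw a {..<s} A"
        using ex_bij_betw_nat_finite[of A] finA finite_subset by (metis atLeast0LessThan)
      have "embeds VF EF V E"
        using a A by (intro embeds_critical_components[OF cc, of s a]) (auto simp: f_def bij_betw_def)
      then show False using free by simp
    qed
    define w where "w = card apex"
    obtain a where a: "bij_betw a {..<w} apex"
      using ex_bij_betw_nat_finite[OF finA] by (metis atLeast0LessThan w_def)
    define D where "D = {(x, y) \<in> E. x \<notin> apex \<and> y \<notin> apex \<and> c x = c y}"
    interpret D: sgraph V D
      using finite_V E_subset E_irrefl by unfold_locales (auto simp: D_def sym_def irrefl_def dest: E_sym)
    have no_matching: False if xy: "inj_on x {..<s - w}" "inj_on y {..<s - w}" "x ` {..<s - w} \<inter> y ` {..<s - w} = {}"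
      "\<forall>i<s - w. (x i, y i) \<in> D" for x y
    proof -
      have *: "i - w < s - w" if "w \<le> i" "i < s" for i using that by simp
      have "embeds VF EF V E"
      proof (rule embeds_critical_components[OF cc, of w a "\<lambda>i. x (i - w)" "\<lambda>i. y (i - w)"])
        show "card VF \<le> f" "w \<le> s" using card_apex by (auto simp: f_def w_def)
        show "a i \<in> apex" if "i < w" for i using a that by (auto simp: bij_betw_def)
        show "inj_on a {..<w}" using a by (simp add: bij_betw_def)
        show "(x (i - w), y (i - w)) \<in> E \<and> x (i - w) \<notin> apex \<and> y (i - w) \<notin> apex \<and> c (x (i - w)) = c (y (i - w))"
          if "w \<le> i" "i < s" for i using xy(4) *[OF that] by (auto simp: D_def)
        show "inj_on (\<lambda>i. x (i - w)) {w..<s}" "inj_on (\<lambda>i. y (i - w)) {w..<s}"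
          using xy(1,2) unfolding inj_on_def by (auto simp: * ) (metis * eq_diff_iff lessThan_iff)+
        show "(\<lambda>i. x (i - w)) ` {w..<s} \<inter> (\<lambda>i. y (i - w)) ` {w..<s} = {}"
          using xy(3) * by (fastforce simp: disjoint_iff)
      qed
      then show False using free by simp
    qed
    \<comment> \<open>Colours from \<open>k\<close> on do not occur in \<open>c\<close>, so for
      \<open>b\<close> injective on \<open>X\<close> each vertex of \<open>X\<close> becomes a part
      of its own.\<close>
    define join where "join X b = (\<lambda>x. if x \<in> X then k + b x else c x)" for X and b :: "'a \<Rightarrow> nat"
    have join_sub: "E \<subseteq> multipartite V (join X b) \<union> D" if "apex \<subseteq> X" "inj_on b X" for X b
    proof (rule subrelI)
      fix x y assume xy: "(x, y) \<in> E"
      then have V: "x \<in> V" "y \<in> V" "x \<noteq> y" using E_subset E_irrefl by auto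
      then have "c x < k" "c y < k" using c_less by auto
      then show "(x, y) \<in> multipartite V (join X b) \<union> D"
        using xy V that by (auto simp: multipartite_def D_def join_def inj_on_def)
    qed
    have join_free: "\<not> embeds VF EF V (multipartite V (join X b))" if "finite X" "card X < s" for X b
      using that by (intro not_embeds_few_apex) (auto simp: join_def c_less)
    show "\<exists>c. (\<forall>x\<in>V. c x < k + (s - 1)) \<and> (\<forall>i<k. 2 \<le> card {x \<in> V. c x = i}) \<and>
      (\<forall>i. k \<le> i \<longrightarrow> i < k + (s - 1) \<longrightarrow> card {x \<in> V. c x = i} = 1) \<and>
      \<not> embeds VF EF V (multipartite V c) \<and> power_sum r V E \<le> power_sum r V (multipartite V c)"
    proof (cases "w = s - 1")
      case True
      \<comment> \<open>Here \<open>s - w = 1\<close>, so a single edge is already a forbidden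
        matching.\<close>
      have "D = {}"
      proof (rule ccontr)
        assume "D \<noteq> {}"
        then obtain p q where pq: "(p, q) \<in> D" by auto
        then have "p \<noteq> q" using D.E_irrefl by auto
        then show False using no_matching[of "\<lambda>_. p" "\<lambda>_. q"] pq True s_pos by (auto simp: inj_on_def)
      qed
      obtain b where b: "bij_betw b apex {..<w}"
        using a bij_betw_inv by blast
      define c' where "c' = join apex b"
      have "E \<subseteq> multipartite V c'"
        using join_sub[of apex b] b \<open>D = {}\<close> by (simp add: c'_def bij_betw_def)
      then have "power_sum r V E \<le> power_sum r V (multipartite V c')"
        by (intro power_sum_mono sgraph_multipartite finite_V)
      moreover have "\<not> embeds VF EF V (multipartite V c')"
        unfolding c'_def using finA card_apex by (rule join_free)
      moreover have "\<forall>x\<in>V. c' x < k + (s - 1)"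
      proof
        fix x assume x: "x \<in> V"
        have "b x < w" if "x \<in> apex" using b that by (auto simp: bij_betw_def)
        then show "c' x < k + (s - 1)" using c_less[OF x] True by (auto simp: c'_def join_def)
      qed
      moreover have "2 \<le> card {x \<in> V. c' x = i}" if i: "i < k" for i
      proof -
        have "{x \<in> Gd. c x = i} \<subseteq> {x \<in> V. c' x = i} \<union> apex"
          using Gd_subset by (auto simp: c'_def join_def)
        then have "card {x \<in> Gd. c x = i} \<le> card ({x \<in> V. c' x = i} \<union> apex)"
          using finite_V finA by (intro card_mono) auto
        also have "\<dots> \<le> card {x \<in> V. c' x = i} + card apex" by (rule card_Un_le)
        finally show ?thesis using class_ge[OF i] \<kappa>n card_apex by linarith
      qed
      moreover have "card {x \<in> V. c' x = i} = 1" if i: "k \<le> i" "i < k + (s - 1)" for i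
      proof -
        have "i - k \<in> b ` apex" using i b True by (auto simp: bij_betw_def)
        then obtain p where p: "p \<in> apex" "b p = i - k" by auto
        have "{x \<in> V. c' x = i} = {p}"
        proof (intro equalityI subsetI)
          fix x assume x: "x \<in> {x \<in> V. c' x = i}"
          then have "x \<in> apex" using c_less[of x] i(1) by (auto simp: c'_def join_def split: if_splits)
          then have "b x = b p" using x p(2) by (auto simp: c'_def join_def)
          then show "x \<in> {p}" using b \<open>x \<in> apex\<close> p(1) by (auto simp: bij_betw_def inj_on_def)
        qed (use p i AV in \<open>auto simp: c'_def join_def\<close>)
        then show ?thesis by simp
      qed
      ultimately show ?thesis by blast
    next
      case False
      then have w: "Suc w < s" using card_apex by (simp add: w_def)
      obtain C where C: "finite C" "card C \<le> 2 * (s - w)" "\<And>p q. (p, q) \<in> D \<Longrightarrow> p \<in> C \<or> q \<in> C"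
        using matching_or_cover[OF D.sym_E D.irrefl_E, of "s - w"] no_matching by blast
      have "card apex < card V" using card_apex n(3) by simp
      then have "\<not> V \<subseteq> apex" using card_mono[OF finA, of V] by linarith
      then obtain v0 where v0: "v0 \<in> V" "v0 \<notin> apex" by auto
      \<comment> \<open>As \<open>Suc w < s\<close>, this set still has fewer than \<open>s\<close>
        vertices, so \<open>join_free\<close> applies to it.\<close>
      define X where "X = insert v0 apex"
      have X: "finite X" "card X < s" using finA v0(2) w by (auto simp: X_def w_def)
      obtain b :: "'a \<Rightarrow> nat" where b: "inj_on b X" using finite_imp_inj_to_nat_seg[OF X(1)] by blast
      define E' where "E' = multipartite V (join X b)"
      interpret E': sgraph V E' unfolding E'_def using finite_V by (rule sgraph_multipartite)
      have le: "power_sum r V E' \<le> power_sum r V E"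
        using join_free[OF X] by (intro max E'.sgraph_axioms) (simp add: E'_def)
      define d where "d x = real (card (E `` {x}))" for x
      define d' where "d' x = real (card (E' `` {x}))" for x
      have dn: "0 \<le> d x" "d x \<le> ?n" "0 \<le> d' x" "d' x \<le> ?n" for x
        using degree_le[of x] E'.degree_le[of x] by (auto simp: d_def d'_def)
      have "d x \<le> d' x + card (D `` {x})" for x
      proof -
        have "E `` {x} \<subseteq> E' `` {x} \<union> D `` {x}" using join_sub[of X b] b by (auto simp: E'_def X_def)
        then have "card (E `` {x}) \<le> card (E' `` {x} \<union> D `` {x})" by (intro card_mono) auto
        also have "\<dots> \<le> card (E' `` {x}) + card (D `` {x})" by (rule card_Un_le)
        finally show ?thesis by (simp add: d_def d'_def)
      qed
      then have up: "d x ^ r \<le> d' x ^ r + real r * card (D `` {x}) * ?n ^ (r - 1)" for x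
        using dn assms(2) by (intro power_diff_le) auto
      \<comment> \<open>\<open>v0\<close> is typical: of the at least \<open>\<kappa> * n\<close>
        vertices in its class at most \<open>\<tau> * n\<close> were its neighbours, and now all of
        them except itself are.\<close>
      have gain: "d v0 ^ r + (\<kappa> / 4 * ?n) ^ r \<le> d' v0 ^ r"
      proof -
        have "E' `` {v0} = V - {v0}"
          using v0 b c_less by (auto simp: E'_def multipartite_def join_def X_def inj_on_def) (metis not_add_less1)+
        then have "card (E' `` {v0}) = card V - 1" using v0 finite_V by simp
        then have d': "d' v0 = ?n - 1" using n_pos by (simp add: d'_def)
        have "{x \<in> Gd. c x = c v0} \<union> E `` {v0} \<subseteq> V" using Gd_subset nbrs_subset by auto
        then have "card ({x \<in> Gd. c x = c v0} \<union> E `` {v0}) \<le> card V" using finite_V by (intro card_mono)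
        moreover have "card ({x \<in> Gd. c x = c v0} \<union> E `` {v0}) + card ({x \<in> Gd. c x = c v0} \<inter> E `` {v0})
          = card {x \<in> Gd. c x = c v0} + card (E `` {v0})"
          using finite_V Gd_subset by (intro card_Un_Int[symmetric]) (auto intro: finite_subset)
        moreover have "card ({x \<in> Gd. c x = c v0} \<inter> E `` {v0}) \<le> card {x \<in> V. c x = c v0 \<and> (v0, x) \<in> E}"
          using finite_V Gd_subset by (intro card_mono) auto
        moreover have "card {x \<in> V. c x = c v0 \<and> (v0, x) \<in> E} \<le> \<tau> * ?n" using in_degree_le[of v0] v0 by simp
        moreover have "\<kappa> * ?n \<le> card {x \<in> Gd. c x = c v0}" using class_ge c_less v0(1) by blast
        moreover have "\<tau> * ?n \<le> \<kappa> / 2 * ?n" using \<tau>(3) by (intro mult_right_mono) auto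
        ultimately have "d v0 + \<kappa> / 2 * ?n \<le> ?n" unfolding d_def by linarith
        then have "d v0 + \<kappa> / 4 * ?n \<le> d' v0" using d' \<kappa>n by linarith
        then have "(d v0 + \<kappa> / 4 * ?n) ^ r \<le> d' v0 ^ r" using dn \<kappa> by (intro power_mono) auto
        moreover have "d v0 ^ r + (\<kappa> / 4 * ?n) ^ r \<le> (d v0 + \<kappa> / 4 * ?n) ^ r"
          using dn \<kappa> assms(2) by (intro power_add_ge) auto
        ultimately show ?thesis by linarith
      qed
      \<comment> \<open>The cover has at most \<open>2 * s\<close> vertices, each with at most
        \<open>\<tau> * n\<close> neighbours in its class, and pairs occur in both
        directions.\<close>
      have cardD: "card D \<le> 4 * s * \<tau> * ?n"
      proof -
        have D_le: "real (card (D `` {x})) \<le> \<tau> * ?n" if "x \<in> C \<inter> (V - apex)" for x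
        proof -
          have "D `` {x} \<subseteq> {y \<in> V. c y = c x \<and> (x, y) \<in> E}" using E_subset by (auto simp: D_def)
          then have "card (D `` {x}) \<le> card {y \<in> V. c y = c x \<and> (x, y) \<in> E}"
            using finite_V by (intro card_mono) auto
          then show ?thesis using in_degree_le[of x] that by force
        qed
        let ?C = "C \<inter> (V - apex)"
        have "D \<subseteq> (\<Union>x\<in>?C. {x} \<times> D `` {x} \<union> D `` {x} \<times> {x})"
        proof (rule subrelI)
          fix p q assume pq: "(p, q) \<in> D"
          then have "p \<in> V - apex" "q \<in> V - apex" using D.E_subset by (auto simp: D_def)
          then show "(p, q) \<in> (\<Union>x\<in>?C. {x} \<times> D `` {x} \<union> D `` {x} \<times> {x})"
            using C(3)[OF pq] pq D.E_sym[OF pq] by auto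
        qed
        then have "card D \<le> card (\<Union>x\<in>?C. {x} \<times> D `` {x} \<union> D `` {x} \<times> {x})"
          using C(1) by (intro card_mono) auto
        also have "\<dots> \<le> (\<Sum>x\<in>?C. card ({x} \<times> D `` {x} \<union> D `` {x} \<times> {x}))"
          using C(1) by (intro card_UN_le) auto
        also have "\<dots> \<le> (\<Sum>x\<in>?C. 2 * card (D `` {x}))"
        proof (rule sum_mono)
          fix x
          show "card ({x} \<times> D `` {x} \<union> D `` {x} \<times> {x}) \<le> 2 * card (D `` {x})"
            using card_Un_le[of "{x} \<times> D `` {x}" "D `` {x} \<times> {x}"] by (simp add: card_cartesian_product)
        qed
        finally have "real (card D) \<le> (\<Sum>x\<in>?C. 2 * real (card (D `` {x})))"
          by (metis (mono_tags, lifting) of_nat_le_iff of_nat_mult of_nat_numeral of_nat_sum sum.cong)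
        also have "\<dots> \<le> of_nat (card ?C) * (2 * (\<tau> * ?n))"
          using D_le by (intro sum_bounded_above) auto
        also have "\<dots> \<le> (2 * s) * (2 * (\<tau> * ?n))"
        proof (rule mult_right_mono)
          have "card ?C \<le> card C" using C(1) by (intro card_mono) auto
          then show "real (card ?C) \<le> real (2 * s)" using C(2) by simp
        qed (use \<tau> in auto)
        finally show ?thesis by (simp add: algebra_simps)
      qed
      have nr: "?n * ?n ^ (r - 1) = ?n ^ r" using assms(2) by (cases r) auto
      have "(\<Sum>x\<in>V. d x ^ r) + (\<kappa> / 4 * ?n) ^ r \<le> (\<Sum>x\<in>V. d' x ^ r) + real r * card D * ?n ^ (r - 1)"
      proof -
        have "(\<Sum>x\<in>V. d x ^ r + (if x = v0 then (\<kappa> / 4 * ?n) ^ r else 0)) \<le>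
          (\<Sum>x\<in>V. d' x ^ r + real r * card (D `` {x}) * ?n ^ (r - 1))"
        proof (rule sum_mono)
          fix x
          have nonneg: "0 \<le> real r * card (D `` {x}) * ?n ^ (r - 1)" by simp
          show "d x ^ r + (if x = v0 then (\<kappa> / 4 * ?n) ^ r else 0) \<le> d' x ^ r + real r * card (D `` {x}) * ?n ^ (r - 1)"
          proof (cases "x = v0")
            case True
            have "d x ^ r + (\<kappa> / 4 * ?n) ^ r \<le> d' x ^ r + real r * card (D `` {x}) * ?n ^ (r - 1)"
              using gain nonneg unfolding True by linarith
            then show ?thesis unfolding if_P[OF True] .
          next
            case False
            then show ?thesis using up[of x] by simp
          qed
        qed
        also have "(\<Sum>x\<in>V. d' x ^ r + real r * card (D `` {x}) * ?n ^ (r - 1)) = (\<Sum>x\<in>V. d' x ^ r) + real r * card D * ?n ^ (r - 1)"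
          unfolding D.sum_degree[symmetric] by (simp add: sum.distrib sum_distrib_left sum_distrib_right)
        finally show ?thesis using v0(1) finite_V by (simp add: sum.distrib)
      qed
      moreover have "(\<Sum>x\<in>V. d' x ^ r) \<le> (\<Sum>x\<in>V. d x ^ r)"
        using le unfolding power_sum_def d_def d'_def by (simp flip: of_nat_power of_nat_sum)
      ultimately have "(\<kappa> / 4 * ?n) ^ r \<le> real r * card D * ?n ^ (r - 1)" by linarith
      also have "\<dots> \<le> r * (4 * s * \<tau> * ?n) * ?n ^ (r - 1)"
        using cardD by (intro mult_right_mono mult_left_mono) auto
      also have "\<dots> = (4 * s * r * \<tau>) * (?n * ?n ^ (r - 1))" by (simp add: algebra_simps)
      finally have "(\<kappa> / 4) ^ r * ?n ^ r \<le> (4 * s * r * \<tau>) * ?n ^ r" unfolding nr power_mult_distrib .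
      then have "(\<kappa> / 4) ^ r \<le> 4 * s * r * \<tau>" using n_pos by simp
      also have "\<dots> \<le> (4 * s * r) * ((\<kappa> / 4) ^ r / (8 * s * r))" using \<tau>(4) by (intro mult_left_mono) auto
      also have "\<dots> = (\<kappa> / 4) ^ r / 2" using s_pos assms(2) by (simp add: field_simps)
      finally have "(\<kappa> / 4) ^ r \<le> 0" by simp
      moreover have "0 < (\<kappa> / 4) ^ r" using \<kappa> by simp
      ultimately show ?thesis by linarith
    qed
  qed
qed

section \<open>Complete partite graphs with one part of order 1\<close>

lemma not_colorable_clique:
  assumes "K \<subseteq> VF" "card K = Suc k" "\<And>x y. \<lbrakk>x \<in> K; y \<in> K; x \<noteq> y\<rbrakk> \<Longrightarrow> (x, y) \<in> EF"
  shows "\<not> colorable VF EF k"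
proof
  assume "colorable VF EF k"
  then obtain c where c: "\<forall>x\<in>VF. c x < k" "\<forall>(x, y)\<in>EF. c x \<noteq> c y" by (auto simp: colorable_def)
  have "inj_on c K" using c(2) assms(3) by (fastforce intro: inj_onI)
  moreover have "c ` K \<subseteq> {..<k}" using c(1) assms(1) by auto
  ultimately have "card K \<le> card {..<k}" by (intro card_inj_on_le) auto
  then show False using assms(2) by simp
qed

lemma ex_inj_on_with_value:
  assumes "finite A" "finite B" "card A \<le> card B" "a \<in> A" "b \<in> B"
  shows "\<exists>h. inj_on h A \<and> h ` A \<subseteq> B \<and> h a = b"
proof -
  have "card (A - {a}) \<le> card (B - {b})" using assms by simp
  then obtain g where g: "g ` (A - {a}) \<subseteq> B - {b}" "inj_on g (A - {a})"
    using card_le_inj[of "A - {a}" "B - {b}"] assms(1,2) by auto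
  let ?h = "g(a := b)"
  have "inj_on ?h A"
  proof (rule inj_onI)
    fix x y assume "x \<in> A" "y \<in> A" "?h x = ?h y"
    then show "x = y" using g by (auto simp: inj_on_def split: if_splits)
  qed
  moreover have "?h ` A \<subseteq> B" using g(1) assms(5) by auto
  ultimately show ?thesis by (intro exI[of _ ?h]) simp
qed

text \<open>The degree sum of \<open>D\<close> is even, so if \<open>H\<close> misses degree \<open>l\<close> at one vertex then so does \<open>D\<close>.\<close>

lemma nearly_regular_sum_power_ge:
  assumes D: "sgraph A D" "\<And>x. x \<in> A \<Longrightarrow> card (D `` {x}) \<le> l" and H: "sgraph A H" "nearly_regular l A H"
  shows "(\<Sum>x\<in>A. (N + card (D `` {x})) ^ r) \<le> (\<Sum>x\<in>A. (N + card (H `` {x})) ^ r)"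
proof -
  interpret D: sgraph A D by fact
  interpret H: sgraph A H by fact
  from H(2) show ?thesis unfolding nearly_regular_def
  proof
    assume "\<forall>x\<in>A. card (H `` {x}) = l"
    then show ?thesis using D(2) by (intro sum_mono power_mono add_left_mono) auto
  next
    assume "\<exists>w\<in>A. card (H `` {w}) + 1 = l \<and> (\<forall>x\<in>A - {w}. card (H `` {x}) = l)"
    then obtain w where w: "w \<in> A" "card (H `` {w}) + 1 = l" "\<forall>x\<in>A - {w}. card (H `` {x}) = l" by blast
    have sum_H: "(\<Sum>x\<in>A. card (H `` {x})) + 1 = card A * l"
    proof -
      have "(\<Sum>x\<in>A. card (H `` {x})) = card (H `` {w}) + (card A - 1) * l"
        using sum.remove[OF D.finite_V w(1), of "\<lambda>x. card (H `` {x})"] w(1,3) D.finite_V by simp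
      moreover have "card A * l = (card A - 1) * l + l"
        using w(1) D.finite_V card_gt_0_iff[of A] by (cases "card A") auto
      ultimately show ?thesis using w(2) by linarith
    qed
    have "\<exists>v\<in>A. card (D `` {v}) \<noteq> l"
    proof (rule ccontr)
      assume "\<not> ?thesis"
      then have "(\<Sum>x\<in>A. card (D `` {x})) = card A * l" by simp
      then show False using sum_H D.even_sum_degree H.even_sum_degree by (metis even_plus_one_iff)
    qed
    then obtain v where v: "v \<in> A" "card (D `` {v}) \<noteq> l" by blast
    then have dv: "card (D `` {v}) \<le> card (H `` {w})" using D(2)[OF v(1)] w(2) by linarith
    have "(\<Sum>x\<in>A. (N + card (D `` {x})) ^ r) = (N + card (D `` {v})) ^ r + (\<Sum>x\<in>A - {v}. (N + card (D `` {x})) ^ r)"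
      using D.finite_V v(1) by (rule sum.remove)
    also have "(\<Sum>x\<in>A - {v}. (N + card (D `` {x})) ^ r) \<le> (\<Sum>x\<in>A - {v}. (N + l) ^ r)"
      using D(2) by (intro sum_mono power_mono) auto
    also have "(\<Sum>x\<in>A - {v}. (N + l) ^ r) = (\<Sum>x\<in>A - {w}. (N + l) ^ r)" using v(1) w(1) D.finite_V by simp
    also have "\<dots> = (\<Sum>x\<in>A - {w}. (N + card (H `` {x})) ^ r)" using w(3) by simp
    also have "(N + card (D `` {v})) ^ r \<le> (N + card (H `` {w})) ^ r" using dv by (intro power_mono) auto
    also have "(N + card (H `` {w})) ^ r + (\<Sum>x\<in>A - {w}. (N + card (H `` {x})) ^ r) = (\<Sum>x\<in>A. (N + card (H `` {x})) ^ r)"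
      using D.finite_V w(1) by (rule sum.remove[symmetric])
    finally show ?thesis by simp
  qed
qed

text \<open>\<phi> numbers the parts of \<open>F\<close>; the value \<open>k\<close> is reserved for
  the part consisting of \<open>p\<close>.\<close>

locale complete_1_a =
  fixes VF :: "'b set" and \<phi> :: "'b \<Rightarrow> nat" and p :: 'b and k a :: nat
  assumes finite_VF: "finite VF" and k_ge: "2 \<le> k" and a_pos: "0 < a" and p: "p \<in> VF" "\<phi> p = k"
    and \<phi>_less: "z \<in> VF \<Longrightarrow> z \<noteq> p \<Longrightarrow> \<phi> z < k" and card_class: "i < k \<Longrightarrow> card {z \<in> VF. \<phi> z = i} = a"
begin

abbreviation EF :: "'b rel" where
  "EF \<equiv> multipartite VF \<phi>"

lemma sgraph_EF: "sgraph VF EF"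
  using finite_VF by (rule sgraph_multipartite)

lemma \<phi>_le: "z \<in> VF \<Longrightarrow> \<phi> z < Suc k"
  using p \<phi>_less by (cases "z = p") (auto simp: less_Suc_eq)

lemma colorable_Suc: "colorable VF EF (Suc k)"
  unfolding colorable_def using \<phi>_le by (intro exI[of _ \<phi>]) (auto simp: multipartite_def)

lemma card_class_le: "card {z \<in> VF. \<phi> z = i} \<le> a"
proof -
  have "{z \<in> VF. \<phi> z = k} = {p}" using p \<phi>_less by fastforce
  then have "card {z \<in> VF. \<phi> z = k} = 1" by simp
  moreover have "{z \<in> VF. \<phi> z = i} = {}" if "k < i" using \<phi>_le that by fastforce
  ultimately show ?thesis using card_class[of i] a_pos
    by (metis One_nat_def Suc_leI card.empty linorder_neqE_nat order_refl zero_le)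
qed

lemma card_VF: "card VF = k * a + 1"
proof -
  have "VF - {p} = (\<Union>i<k. {z \<in> VF. \<phi> z = i})" using \<phi>_less p by force
  then have "card (VF - {p}) = card (\<Union>i<k. {z \<in> VF. \<phi> z = i})" by (rule arg_cong)
  also have "\<dots> = (\<Sum>i<k. card {z \<in> VF. \<phi> z = i})"
    using finite_VF by (intro card_UN_disjoint) auto
  also have "\<dots> = k * a" using card_class by simp
  finally have "card (VF - {p}) = k * a" .
  then show ?thesis using card.remove[OF finite_VF p(1)] by simp
qed

lemma not_colorable: "\<not> colorable VF EF k"
proof -
  have "\<exists>z. z \<in> VF \<and> \<phi> z = i" if "i < Suc k" for i
  proof (cases "i = k")
    case False
    then have "card {z \<in> VF. \<phi> z = i} \<noteq> 0" using that card_class[of i] a_pos by simp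
    then show ?thesis by (metis (mono_tags, lifting) Collect_empty_eq card.empty)
  qed (use p in auto)
  then obtain z where z: "\<And>i. i < Suc k \<Longrightarrow> z i \<in> VF \<and> \<phi> (z i) = i" by metis
  have "inj_on z {..<Suc k}" using z by (metis inj_onI lessThan_iff)
  then have "card (z ` {..<Suc k}) = Suc k" by (simp add: card_image)
  moreover have "z ` {..<Suc k} \<subseteq> VF" using z by auto
  ultimately show ?thesis using z by (intro not_colorable_clique) (auto simp: multipartite_def)
qed

text \<open>Without \<open>p\<close> the graph is \<open>k\<close>-partite, so an apex can play
  \<open>p\<close>. So can a vertex \<open>x\<close> with \<open>a\<close> neighbours in its own
  class: these neighbours form one part, and the other \<open>k - 1\<close> parts go to the other
  \<open>k - 1\<close> classes.\<close>

lemma (in near_partite) complete_1_a_in_degree: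
  assumes F: "complete_1_a VF \<phi> p k a" "card VF \<le> f" and free: "\<not> embeds VF (multipartite VF \<phi>) V E"
  shows "apex = {}" and "x \<in> V \<Longrightarrow> card {y \<in> V. c y = c x \<and> (x, y) \<in> E} < a"
proof -
  interpret F: complete_1_a VF \<phi> p k a by fact
  show no_apex: "apex = {}"
  proof (rule ccontr)
    assume "apex \<noteq> {}"
    then obtain x where x: "x \<in> apex" by blast
    have "embeds VF F.EF V E"
    proof (rule embeds_extend[OF F.sgraph_EF F(2), of "{p}" "\<lambda>_. x" \<phi>])
      show "(\<forall>s\<in>{p}. (s, z) \<in> F.EF \<longrightarrow> x \<notin> apex \<and> c x \<noteq> \<phi> z) \<or>
         (\<exists>s\<in>{p}. x \<in> apex \<and> (\<forall>s'\<in>{p}. (s', z) \<in> F.EF \<longrightarrow> s' = s))" for z using x by simp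
    qed (use x F.p F.\<phi>_less in \<open>auto simp: apex_def multipartite_def\<close>)
    then show False using free by simp
  qed
  assume x: "x \<in> V"
  show "card {y \<in> V. c y = c x \<and> (x, y) \<in> E} < a"
  proof (rule ccontr)
    assume "\<not> ?thesis"
    then have "a \<le> card {y \<in> V. c y = c x \<and> (x, y) \<in> E}" by simp
    then obtain Y where Y: "Y \<subseteq> {y \<in> V. c y = c x \<and> (x, y) \<in> E}" "card Y = a"
      by (rule obtain_subset_with_card_n) blast
    define \<Phi> where "\<Phi> = {z \<in> VF. \<phi> z = 0}"
    have fin: "finite \<Phi>" "finite Y"
      using F.finite_VF finite_V finite_subset[OF Y(1)] by (auto simp: \<Phi>_def)
    have "card \<Phi> = a" using F.card_class[of 0] F.k_ge by (simp add: \<Phi>_def)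
    then obtain b where b: "bij_betw b \<Phi> Y" using finite_same_card_bij[OF fin] Y(2) by auto
    have p\<Phi>: "p \<notin> \<Phi>" using F.p F.k_ge by (simp add: \<Phi>_def)
    define g where "g z = (if z = p then x else b z)" for z
    \<comment> \<open>Maps the parts from 1 to \<open>k - 1\<close> injectively to the colours other
      than \<open>c x\<close>: numbers up to \<open>c x\<close> drop by one.\<close>
    define h where "h z = (if \<phi> z \<le> c x then \<phi> z - 1 else \<phi> z)" for z
    have bY: "b z \<in> Y" if "z \<in> \<Phi>" for z using b that by (auto simp: bij_betw_def)
    have xY: "x \<notin> Y" using Y(1) E_irrefl by auto
    have g_col: "c (g z) = c x" if "z \<in> insert p \<Phi>" for z
      using that bY[of z] Y(1) by (auto simp: g_def)
    have \<phi>_pos: "0 < \<phi> z \<and> \<phi> z < k" if "z \<in> VF - insert p \<Phi>" for z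
      using that F.\<phi>_less by (auto simp: \<Phi>_def)
    have cx: "c x < k" using c_less[OF x] .
    have "embeds VF F.EF V E"
    proof (rule embeds_extend[OF F.sgraph_EF F(2), of "insert p \<Phi>" g h])
      show "insert p \<Phi> \<subseteq> VF" using F.p by (auto simp: \<Phi>_def)
      show "inj_on g (insert p \<Phi>)"
        using b p\<Phi> xY bY unfolding g_def bij_betw_def inj_on_def by auto
      show "g ` insert p \<Phi> \<subseteq> V" using bY Y(1) x by (auto simp: g_def)
      show "(g y, g z) \<in> E" if yz: "(y, z) \<in> F.EF" "y \<in> insert p \<Phi>" "z \<in> insert p \<Phi>" for y z
      proof -
        have x_adj: "(x, b t) \<in> E" if "t \<in> \<Phi>" for t using bY[OF that] Y(1) by blast
        have "\<phi> y \<noteq> \<phi> z" using yz(1) by (simp add: multipartite_def)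
        then have "y = p \<and> z \<in> \<Phi> \<or> z = p \<and> y \<in> \<Phi>" using yz(2,3) by (auto simp: \<Phi>_def)
        then show ?thesis
        proof
          assume "y = p \<and> z \<in> \<Phi>"
          then show ?thesis using x_adj[of z] p\<Phi> by (auto simp: g_def)
        next
          assume "z = p \<and> y \<in> \<Phi>"
          then show ?thesis using E_sym[OF x_adj[of y]] p\<Phi> by (auto simp: g_def)
        qed
      qed
      show "h z < k" if "z \<in> VF - insert p \<Phi>" for z using \<phi>_pos[OF that] cx by (auto simp: h_def)
      show "h y \<noteq> h z" if "(y, z) \<in> F.EF" "y \<notin> insert p \<Phi>" "z \<notin> insert p \<Phi>" for y z
        using that \<phi>_pos[of y] \<phi>_pos[of z] by (auto simp: h_def multipartite_def)
      show "(\<forall>s\<in>insert p \<Phi>. (s, z) \<in> F.EF \<longrightarrow> g s \<notin> apex \<and> c (g s) \<noteq> h z) \<or>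
        (\<exists>s\<in>insert p \<Phi>. g s \<in> apex \<and> (\<forall>s'\<in>insert p \<Phi>. (s', z) \<in> F.EF \<longrightarrow> s' = s))" if "z \<in> VF - insert p \<Phi>" for z
        using \<phi>_pos[OF that] g_col no_apex by (auto simp: h_def)
    qed
    then show False using free by simp
  qed
qed

text \<open>By pigeonhole, some class receives more than \<open>a\<close> of the
  \<open>k * a + 1\<close> vertices. As parts have at most \<open>a\<close> vertices, these span a
  complete partite graph inside \<open>H i\<close> with at least two parts, and three parts give a
  triangle. With two parts, each has fewer than \<open>a\<close> vertices by the degree bound, so
  both have at least two, and a 4-cycle appears.\<close>

lemma not_embeds_T0:
  assumes V: "finite V" "\<And>x. x \<in> V \<Longrightarrow> c x < k"
    and H: "\<And>i. i < k \<Longrightarrow> sgraph {x \<in> V. c x = i} (H i)" "\<And>i. i < k \<Longrightarrow> girth_ge_5 (H i)"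
      "\<And>i x. i < k \<Longrightarrow> card (H i `` {x}) \<le> a - 1"
  shows "\<not> embeds VF EF V (multipartite V c \<union> (\<Union>i<k. H i))"
proof
  assume "embeds VF EF V (multipartite V c \<union> (\<Union>i<k. H i))"
  then obtain f where f: "inj_on f VF" "f ` VF \<subseteq> V"
    "\<And>x y. (x, y) \<in> EF \<Longrightarrow> (f x, f y) \<in> multipartite V c \<union> (\<Union>i<k. H i)"
    by (rule embedsE) blast
  define Q where "Q i = {z \<in> VF. c (f z) = i}" for i
  have finQ: "finite (Q i)" for i using finite_VF by (simp add: Q_def)
  have "\<exists>i<k. a < card (Q i)"
  proof (rule ccontr)
    assume "\<not> ?thesis"
    then have le: "\<And>i. i < k \<Longrightarrow> card (Q i) \<le> a" by force
    have "VF = (\<Union>i<k. Q i)" using f(2) V(2) by (auto simp: Q_def)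
    then have "card VF = card (\<Union>i<k. Q i)" by (rule arg_cong)
    also have "\<dots> \<le> (\<Sum>i<k. card (Q i))" by (rule card_UN_le) simp
    also have "\<dots> \<le> k * a" using sum_bounded_above[of "{..<k}" "\<lambda>i. card (Q i)" a] le by simp
    finally show False using card_VF by simp
  qed
  then obtain i where i: "i < k" "a < card (Q i)" by blast
  interpret H: sgraph "{x \<in> V. c x = i}" "H i" using H(1)[OF i(1)] .
  have tri: "\<And>x y z. \<lbrakk>(x, y) \<in> H i; (y, z) \<in> H i; (z, x) \<in> H i\<rbrakk> \<Longrightarrow> False"
    and quad: "\<And>x y u w. \<lbrakk>(x, u) \<in> H i; (u, y) \<in> H i; (y, w) \<in> H i; (w, x) \<in> H i\<rbrakk> \<Longrightarrow> x = y \<or> u = w"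
    using H(2)[OF i(1)] unfolding girth_ge_5_def by blast+
  have edge: "(f x, f y) \<in> H i" if xy: "x \<in> Q i" "y \<in> Q i" "\<phi> x \<noteq> \<phi> y" for x y
  proof -
    have "(x, y) \<in> EF" using xy by (auto simp: Q_def multipartite_def)
    from f(3)[OF this] obtain j where j: "j < k" "(f x, f y) \<in> H j"
      using xy by (auto simp: Q_def multipartite_def)
    moreover have "j = i" using sgraph.E_subset[OF H(1)[OF j(1)]] j(2) xy(1) by (auto simp: Q_def)
    ultimately show ?thesis by simp
  qed
  have f_eq: "x = y" if "x \<in> Q i" "y \<in> Q i" "f x = f y" for x y
    using f(1) that by (auto simp: Q_def inj_on_def)
  define P where "P j = {z \<in> Q i. \<phi> z = j}" for j
  have finP: "finite (P j)" for j using finQ by (simp add: P_def)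
  have P_le: "card (P j) \<le> a" for j
  proof -
    have "card (P j) \<le> card {z \<in> VF. \<phi> z = j}"
      using finite_VF by (intro card_mono) (auto simp: P_def Q_def)
    then show ?thesis using card_class_le[of j] by linarith
  qed
  have other: "\<exists>w\<in>Q i. \<phi> w \<noteq> j" for j
  proof (rule ccontr)
    assume "\<not> ?thesis"
    then have "Q i = P j" by (auto simp: P_def)
    then show False using P_le[of j] i(2) by simp
  qed
  obtain z where z: "z \<in> Q i" using other[of 0] by blast
  obtain w where w: "w \<in> Q i" "\<phi> w \<noteq> \<phi> z" using other by blast
  have "t \<in> P (\<phi> z) \<union> P (\<phi> w)" if t: "t \<in> Q i" for t
  proof (rule ccontr)
    assume "t \<notin> P (\<phi> z) \<union> P (\<phi> w)"
    then have "\<phi> t \<noteq> \<phi> z" "\<phi> t \<noteq> \<phi> w" using t by (auto simp: P_def)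
    then show False using tri edge z w t by metis
  qed
  then have QP: "Q i = P (\<phi> z) \<union> P (\<phi> w)" by (auto simp: P_def)
  have QP_card: "card (Q i) \<le> card (P (\<phi> z)) + card (P (\<phi> w))" unfolding QP by (rule card_Un_le)
  have small: "card (P (\<phi> w)) < a" if "x \<in> Q i" "\<phi> x \<noteq> \<phi> w" for x w
  proof -
    have "f ` P (\<phi> w) \<subseteq> H i `` {f x}" using edge that by (auto simp: P_def)
    then have "card (f ` P (\<phi> w)) \<le> card (H i `` {f x})" by (intro card_mono) auto
    moreover have "card (f ` P (\<phi> w)) = card (P (\<phi> w))"
      using f_eq by (intro card_image) (auto simp: P_def inj_on_def)
    ultimately show ?thesis using H(3)[OF i(1), of "f x"] a_pos by linarith
  qed
  have "card (P (\<phi> w)) < a" "card (P (\<phi> z)) < a" using small z w by metis+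
  then have two: "2 \<le> card (P (\<phi> w))" "2 \<le> card (P (\<phi> z))" using QP_card i(2) by linarith+
  have ex2: "\<exists>x y. x \<in> P j \<and> y \<in> P j \<and> x \<noteq> y" if "2 \<le> card (P j)" for j
    using that finP[of j] by (metis One_nat_def card_le_Suc0_iff_eq not_less_eq_eq numeral_2_eq_2)
  obtain z1 z2 where z12: "z1 \<in> P (\<phi> z)" "z2 \<in> P (\<phi> z)" "z1 \<noteq> z2" using ex2[OF two(2)] by blast
  obtain w1 w2 where w12: "w1 \<in> P (\<phi> w)" "w2 \<in> P (\<phi> w)" "w1 \<noteq> w2" using ex2[OF two(1)] by blast
  have Q: "z1 \<in> Q i" "z2 \<in> Q i" "w1 \<in> Q i" "w2 \<in> Q i"
    "\<phi> z1 \<noteq> \<phi> w1" "\<phi> w1 \<noteq> \<phi> z2" "\<phi> z2 \<noteq> \<phi> w2" "\<phi> w2 \<noteq> \<phi> z1"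
    using z12 w12 w(2) by (auto simp: P_def)
  have "f z1 = f z2 \<or> f w1 = f w2" using Q by (intro quad edge)
  then show False using f_eq Q z12(3) w12(3) by blast
qed

text \<open>The competitor keeps the classes and joins all pairs across them. Inside a class the
  degrees of the extremal graph are at most \<open>a - 1\<close>; since the number of vertices
  outside is the same for all members of a class, \<open>nearly_regular_sum_power_ge\<close>
  compares class by class.\<close>

theorem extremal_T0:
  assumes "1 \<le> r"
  shows "\<exists>n0. \<forall>(V :: 'a set) E. extremal r VF EF V E \<longrightarrow> n0 \<le> card V \<longrightarrow>
    (\<exists>c H. (\<forall>x\<in>V. c x < k) \<and> (\<forall>i<k. {x \<in> V. c x = i} \<noteq> {}) \<and>
      (\<forall>i<k. sgraph {x \<in> V. c x = i} (H i) \<and> nearly_regular (a - 1) {x \<in> V. c x = i} (H i)) \<and>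
      \<not> embeds VF EF V (multipartite V c \<union> (\<Union>i<k. H i)) \<and>
      power_sum r V E \<le> power_sum r V (multipartite V c \<union> (\<Union>i<k. H i)))"
proof -
  \<comment> \<open>The order that \<open>almost_regular_girth_ge_5_exists\<close> requires for
    \<open>l = a - 1\<close>.\<close>
  define m where "m = 2 * (a - 1 + 1) ^ 4 + 2"
  obtain n0 where n0: "\<And>(V :: 'a set) E. extremal r VF EF V E \<Longrightarrow> n0 \<le> card V \<Longrightarrow>
    (\<exists>\<kappa> \<tau> \<beta> \<gamma> c Gd. near_partite V E k (card VF) \<kappa> \<tau> \<beta> \<gamma> c Gd \<and> (\<forall>i<k. m \<le> card {x \<in> V. c x = i}))"
    using extremal_near_partite_classes[OF sgraph_EF colorable_Suc not_colorable k_ge assms, where 'a = 'a and m = m]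
    by blast
  show ?thesis
  proof (intro exI[of _ n0] allI impI)
    fix V :: "'a set" and E
    assume ex: "extremal r VF EF V E" and nn: "n0 \<le> card V"
    obtain \<kappa> \<tau> \<beta> \<gamma> c Gd where np: "near_partite V E k (card VF) \<kappa> \<tau> \<beta> \<gamma> c Gd"
      and classes: "\<forall>i<k. m \<le> card {x \<in> V. c x = i}" using n0[OF ex nn] by blast
    interpret near_partite V E k "card VF" \<kappa> \<tau> \<beta> \<gamma> c Gd by (rule np)
    have free: "\<not> embeds VF EF V E" using ex by (simp add: extremal_def)
    define A where "A i = {x \<in> V. c x = i}" for i
    have finA: "finite (A i)" for i using finite_V by (simp add: A_def)
    have A_ge: "m \<le> card (A i)" if "i < k" for i using classes that by (simp add: A_def)
    have "\<forall>i. \<exists>H. i < k \<longrightarrow> sgraph (A i) H \<and> girth_ge_5 H \<and> (\<forall>x. card (H `` {x}) \<le> a - 1) \<and> nearly_regular (a - 1) (A i) H"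
      using almost_regular_girth_ge_5_exists[OF finA] A_ge unfolding m_def by blast
    then obtain H where H: "\<And>i. i < k \<Longrightarrow> sgraph (A i) (H i)" "\<And>i. i < k \<Longrightarrow> girth_ge_5 (H i)"
      "\<And>i x. i < k \<Longrightarrow> card (H i `` {x}) \<le> a - 1" "\<And>i. i < k \<Longrightarrow> nearly_regular (a - 1) (A i) (H i)"
      by metis
    define T where "T = multipartite V c \<union> (\<Union>i<k. H i)"
    have T_free: "\<not> embeds VF EF V T"
      unfolding T_def using H c_less finite_V by (intro not_embeds_T0) (auto simp: A_def)
    have T_nbrs: "card (T `` {x}) = card (V - A i) + card (H i `` {x})" if x: "i < k" "x \<in> A i" for i x
    proof -
      have sub: "H j \<subseteq> A j \<times> A j" if "j < k" for j using sgraph.E_subset[OF H(1)[OF that]] .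
      have "T `` {x} = (V - A i) \<union> H i `` {x}"
        using x sub by (fastforce simp: T_def A_def multipartite_def)
      moreover have "(V - A i) \<inter> H i `` {x} = {}" using sub[OF x(1)] by auto
      moreover have "finite (H i `` {x})" using sub[OF x(1)] finA by (metis finite_SigmaI finite_Image finite_subset)
      ultimately show ?thesis using finite_V by (simp add: card_Un_disjoint)
    qed
    define D where "D i = E \<inter> A i \<times> A i" for i
    have D: "sgraph (A i) (D i)" for i
      using finA E_irrefl by unfold_locales (auto simp: D_def sym_def irrefl_def dest: E_sym)
    have D_le: "card (D i `` {x}) \<le> a - 1" if "x \<in> A i" for i x
    proof -
      have "D i `` {x} = {y \<in> V. c y = c x \<and> (x, y) \<in> E}" using that by (auto simp: D_def A_def)
      moreover have "complete_1_a VF \<phi> p k a" by (rule complete_1_a_axioms)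
      ultimately show ?thesis
        using complete_1_a_in_degree(2)[of VF \<phi> p a x] that free by (auto simp: A_def)
    qed
    have E_nbrs: "card (E `` {x}) \<le> card (V - A i) + card (D i `` {x})" if "x \<in> A i" for i x
    proof -
      have "E `` {x} \<subseteq> (V - A i) \<union> D i `` {x}" using that nbrs_subset by (auto simp: D_def A_def)
      then have "card (E `` {x}) \<le> card ((V - A i) \<union> D i `` {x})"
        using finite_V sgraph.finite_nbrs[OF D] by (intro card_mono) auto
      also have "\<dots> \<le> card (V - A i) + card (D i `` {x})" by (rule card_Un_le)
      finally show ?thesis .
    qed
    have split: "(\<Sum>x\<in>V. g x) = (\<Sum>i<k. \<Sum>x\<in>A i. g x)" for g :: "'a \<Rightarrow> nat"
      unfolding A_def using finite_V c_less by (intro sum.group[symmetric]) auto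
    have "power_sum r V E \<le> power_sum r V T"
      unfolding power_sum_def split
    proof (rule sum_mono)
      fix i assume "i \<in> {..<k}"
      then have i: "i < k" by simp
      have "(\<Sum>x\<in>A i. card (E `` {x}) ^ r) \<le> (\<Sum>x\<in>A i. (card (V - A i) + card (D i `` {x})) ^ r)"
        using E_nbrs by (intro sum_mono power_mono) auto
      also have "\<dots> \<le> (\<Sum>x\<in>A i. (card (V - A i) + card (H i `` {x})) ^ r)"
        using D D_le H(1,4)[OF i] by (intro nearly_regular_sum_power_ge)
      also have "\<dots> = (\<Sum>x\<in>A i. card (T `` {x}) ^ r)" using T_nbrs[OF i] by simp
      finally show "(\<Sum>x\<in>A i. card (E `` {x}) ^ r) \<le> (\<Sum>x\<in>A i. card (T `` {x}) ^ r)" .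
    qed
    moreover have "A i \<noteq> {}" if "i < k" for i using A_ge[OF that] by (auto simp: m_def)
    ultimately show "\<exists>c H. (\<forall>x\<in>V. c x < k) \<and> (\<forall>i<k. {x \<in> V. c x = i} \<noteq> {}) \<and>
      (\<forall>i<k. sgraph {x \<in> V. c x = i} (H i) \<and> nearly_regular (a - 1) {x \<in> V. c x = i} (H i)) \<and>
      \<not> embeds VF EF V (multipartite V c \<union> (\<Union>i<k. H i)) \<and>
      power_sum r V E \<le> power_sum r V (multipartite V c \<union> (\<Union>i<k. H i))"
      using T_free H(1,4) c_less unfolding T_def A_def by blast
  qed
qed

end

section \<open>Two cliques sharing a vertex\<close>

locale two_cliques =
  fixes VF :: "'b set" and H1 H2 :: "'b set" and p :: 'b and k :: nat
  assumes VF: "VF = H1 \<union> H2" and fin: "finite H1" "finite H2"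
    and card_H: "card H1 = Suc k" "card H2 = Suc k" and p: "H1 \<inter> H2 = {p}" and k_ge: "2 \<le> k"
begin

definition EF :: "'b rel" where
  "EF = {(x, y). x \<noteq> y \<and> (x \<in> H1 \<and> y \<in> H1 \<or> x \<in> H2 \<and> y \<in> H2)}"

lemma sgraph_EF: "sgraph VF EF"
  using fin by unfold_locales (auto simp: VF EF_def sym_def irrefl_def)

lemma p_mem: "p \<in> H1" "p \<in> H2"
  using p by auto

lemma not_colorable: "\<not> colorable VF EF k"
  using card_H(1) by (intro not_colorable_clique[of H1]) (auto simp: VF EF_def)

lemma colorable_Suc: "colorable VF EF (Suc k)"
proof -
  obtain h1 where h1: "inj_on h1 H1" "h1 ` H1 \<subseteq> {..<Suc k}" "h1 p = k"
    using ex_inj_on_with_value[of H1 "{..<Suc k}" p k] fin card_H p_mem by auto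
  obtain h2 where h2: "inj_on h2 H2" "h2 ` H2 \<subseteq> {..<Suc k}" "h2 p = k"
    using ex_inj_on_with_value[of H2 "{..<Suc k}" p k] fin card_H p_mem by auto
  let ?c = "\<lambda>x. if x \<in> H1 then h1 x else h2 x"
  have c2: "?c x = h2 x" if "x \<in> H2" for x
  proof (cases "x \<in> H1")
    case True
    then have "x = p" using that p by blast
    then show ?thesis using h1(3) h2(3) by simp
  qed simp
  have "\<forall>x\<in>VF. ?c x < Suc k" using h1(2) h2(2) by (auto simp: VF simp del: Suc_eq_plus1)
  moreover have "?c x \<noteq> ?c y" if xy: "(x, y) \<in> EF" for x y
  proof (cases "x \<in> H1 \<and> y \<in> H1")
    case True
    then show ?thesis using h1(1) xy by (auto simp: EF_def inj_on_def)
  next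
    case False
    then have "x \<in> H2" "y \<in> H2" "x \<noteq> y" using xy by (auto simp: EF_def)
    then show ?thesis using h2(1) unfolding c2[OF \<open>x \<in> H2\<close>] c2[OF \<open>y \<in> H2\<close>] by (auto simp: inj_on_def)
  qed
  ultimately show ?thesis unfolding colorable_def by (intro exI[of _ ?c]) blast
qed

text \<open>A clique on \<open>k + 1\<close> vertices repeats a colour and so uses the only edge
  inside a class. Both cliques would contain its two ends, but they share just one vertex.\<close>

lemma not_embeds_one_edge:
  assumes c: "\<And>x. x \<in> V \<Longrightarrow> c x < k" and xy: "x \<noteq> y"
  shows "\<not> embeds VF EF V (multipartite V c \<union> {(x, y), (y, x)})"
proof
  assume "embeds VF EF V (multipartite V c \<union> {(x, y), (y, x)})"
  then obtain f where f: "inj_on f VF" "f ` VF \<subseteq> V"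
    "\<And>u v. (u, v) \<in> EF \<Longrightarrow> (f u, f v) \<in> multipartite V c \<union> {(x, y), (y, x)}"
    by (rule embedsE) blast
  have both: "x \<in> f ` H \<and> y \<in> f ` H"
    if H: "H \<subseteq> VF" "card H = Suc k" "\<And>u v. \<lbrakk>u \<in> H; v \<in> H; u \<noteq> v\<rbrakk> \<Longrightarrow> (u, v) \<in> EF" for H
  proof -
    have "(c \<circ> f) ` H \<subseteq> {..<k}" using f(2) H(1) c by auto
    moreover have "finite H" using H(2) by (metis card.infinite nat.distinct(1))
    ultimately have "\<not> inj_on (c \<circ> f) H"
      using card_inj_on_le[of "c \<circ> f" H "{..<k}"] H(2) by auto
    then obtain u v where uv: "u \<in> H" "v \<in> H" "u \<noteq> v" "c (f u) = c (f v)" by (auto simp: inj_on_def)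
    then have "(f u, f v) \<in> {(x, y), (y, x)}" using f(3)[OF H(3)[OF uv(1-3)]] by (auto simp: multipartite_def)
    then show ?thesis using uv(1,2) by auto
  qed
  have "x \<in> f ` H1 \<and> y \<in> f ` H1" using card_H by (intro both) (auto simp: VF EF_def)
  moreover have "x \<in> f ` H2 \<and> y \<in> f ` H2" using card_H by (intro both) (auto simp: VF EF_def)
  moreover have "f ` H1 \<inter> f ` H2 = f ` (H1 \<inter> H2)"
    using f(1) by (intro inj_on_image_Int[symmetric]) (auto simp: VF)
  ultimately have "x = f p" "y = f p" using p by auto
  then show False using xy by simp
qed

end

text \<open>The rest of each clique is coloured separately, avoiding the colours prescribed in that
  clique; the two colourings only have to agree at \<open>p\<close>. This reduces
  \<open>embeds_extend\<close> to counting colours.\<close>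

lemma (in near_partite) embeds_two_cliques:
  assumes F: "two_cliques VF H1 H2 p k" "card VF \<le> f" and no_apex: "apex = {}"
    and S: "S \<subseteq> VF" "inj_on g S" "g ` S \<subseteq> V"
      "\<And>x y. \<lbrakk>x \<in> S \<inter> H1; y \<in> S \<inter> H1; x \<noteq> y\<rbrakk> \<Longrightarrow> (g x, g y) \<in> E"
      "\<And>x y. \<lbrakk>x \<in> S \<inter> H2; y \<in> S \<inter> H2; x \<noteq> y\<rbrakk> \<Longrightarrow> (g x, g y) \<in> E"
    and h1: "inj_on h1 (H1 - S)" "h1 ` (H1 - S) \<subseteq> {..<k} - (c \<circ> g) ` (S \<inter> H1)"
    and h2: "inj_on h2 (H2 - S)" "h2 ` (H2 - S) \<subseteq> {..<k} - (c \<circ> g) ` (S \<inter> H2)"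
    and hp: "p \<notin> S \<Longrightarrow> h1 p = h2 p"
  shows "embeds VF (two_cliques.EF H1 H2) V E"
proof -
  interpret F: two_cliques VF H1 H2 p k by fact
  define h where "h z = (if z \<in> H1 then h1 z else h2 z)" for z
  have h_H2: "h z = h2 z" if "z \<in> H2" "z \<notin> S" for z
  proof (cases "z \<in> H1")
    case True
    then have "z = p" using that F.p by blast
    then show ?thesis using hp that True by (simp add: h_def)
  qed (simp add: h_def)
  have h_H1: "h z = h1 z" if "z \<in> H1" for z using that by (simp add: h_def)
  show ?thesis
  proof (rule embeds_extend[OF F.sgraph_EF F(2) S(1-3), of h])
    show "(g x, g y) \<in> E" if "(x, y) \<in> F.EF" "x \<in> S" "y \<in> S" for x y
      using that S(4,5) by (auto simp: F.EF_def)
    show "h z < k" if z: "z \<in> VF - S" for z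
    proof (cases "z \<in> H1")
      case True
      then show ?thesis using z h1(2) h_H1 by auto
    next
      case False
      then have "z \<in> H2" using z F.VF by auto
      then show ?thesis using z h2(2) h_H2 by auto
    qed
    show "h z \<noteq> h w" if zw: "(z, w) \<in> F.EF" "z \<notin> S" "w \<notin> S" for z w
    proof (cases "z \<in> H1 \<and> w \<in> H1")
      case True
      then show ?thesis using zw h1(1) h_H1 by (auto simp: F.EF_def inj_on_def)
    next
      case False
      then have "z \<in> H2" "w \<in> H2" using zw by (auto simp: F.EF_def)
      then show ?thesis using zw h2(1) h_H2 by (auto simp: F.EF_def inj_on_def)
    qed
    show "(\<forall>s\<in>S. (s, z) \<in> F.EF \<longrightarrow> g s \<notin> apex \<and> c (g s) \<noteq> h z) \<or>
       (\<exists>s\<in>S. g s \<in> apex \<and> (\<forall>s'\<in>S. (s', z) \<in> F.EF \<longrightarrow> s' = s))" if z: "z \<in> VF - S" for z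
    proof -
      have "c (g s) \<noteq> h z" if s: "s \<in> S" "(s, z) \<in> F.EF" for s
      proof -
        consider "s \<in> H1" "z \<in> H1" | "s \<in> H2" "z \<in> H2" using s(2) by (auto simp: F.EF_def)
        then show ?thesis
        proof cases
          case 1
          then have "h z \<in> h1 ` (H1 - S)" "c (g s) \<in> (c \<circ> g) ` (S \<inter> H1)" using z s h_H1 by auto
          then show ?thesis using h1(2) by force
        next
          case 2
          then have "h z \<in> h2 ` (H2 - S)" "c (g s) \<in> (c \<circ> g) ` (S \<inter> H2)" using z s h_H2 by auto
          then show ?thesis using h2(2) by force
        qed
      qed
      then show ?thesis using no_apex by auto
    qed
  qed
qed

context near_partite
begin

context
  fixes VF H1 H2 :: "'b set" and p :: 'b
  assumes F: "two_cliques VF H1 H2 p k" "card VF \<le> f" and free: "\<not> embeds VF (two_cliques.EF H1 H2) V E"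
begin

interpretation F: two_cliques VF H1 H2 p k by (rule F(1))

lemma two_cliques_no_apex: "apex = {}"
proof (rule ccontr)
  assume "apex \<noteq> {}"
  then obtain x where x: "x \<in> apex" by blast
  have "card (H1 - {p}) \<le> card {..<k}" "card (H2 - {p}) \<le> card {..<k}"
    using F.card_H F.p_mem F.fin by simp_all
  then obtain h1 h2 where h1: "h1 ` (H1 - {p}) \<subseteq> {..<k}" "inj_on h1 (H1 - {p})"
    and h2: "h2 ` (H2 - {p}) \<subseteq> {..<k}" "inj_on h2 (H2 - {p})"
    using card_le_inj[of "H1 - {p}" "{..<k}"] card_le_inj[of "H2 - {p}" "{..<k}"] F.fin by auto
  define h where "h z = (if z \<in> H1 then h1 z else h2 z)" for z
  have sep: "z \<notin> H1" if "z \<in> H2" "z \<noteq> p" for z using that F.p by blast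
  have "embeds VF F.EF V E"
  proof (rule embeds_extend[OF F.sgraph_EF F(2), of "{p}" "\<lambda>_. x" h])
    show "(\<forall>s\<in>{p}. (s, z) \<in> F.EF \<longrightarrow> x \<notin> apex \<and> c x \<noteq> h z) \<or>
       (\<exists>s\<in>{p}. x \<in> apex \<and> (\<forall>s'\<in>{p}. (s', z) \<in> F.EF \<longrightarrow> s' = s))" for z using x by simp
    show "h z < k" if "z \<in> VF - {p}" for z using that h1(1) h2(1) by (auto simp: h_def F.VF)
    show "h z \<noteq> h w" if "(z, w) \<in> F.EF" "z \<notin> {p}" "w \<notin> {p}" for z w
    proof (cases "z \<in> H1 \<and> w \<in> H1")
      case True
      then show ?thesis using that h1(2) by (auto simp: h_def F.EF_def inj_on_def)
    next
      case False
      then have zw: "z \<in> H2" "w \<in> H2" "z \<noteq> w" using that(1) by (auto simp: F.EF_def)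
      then have "z \<notin> H1" "w \<notin> H1" using sep that by auto
      then show ?thesis using that(2,3) zw h2(2) by (auto simp: h_def inj_on_def)
    qed
  qed (use x F.p_mem in \<open>auto simp: apex_def F.EF_def F.VF\<close>)
  then show False using free by simp
qed

text \<open>If the prescribed vertices repeat exactly one colour, then as many colours as vertices
  remain: \<open>k - card I\<close> equals \<open>k + 1 - card T\<close>.\<close>

lemma two_cliques_rest:
  assumes "finite I" "I \<subseteq> {..<k}" "H = H1 \<or> H = H2" "T \<subseteq> H" "card T = Suc (card I)"
  shows "\<exists>h. inj_on h (H - T) \<and> h ` (H - T) \<subseteq> {..<k} - I"
proof -
  have H: "finite H" "card H = Suc k" using assms(3) F.fin F.card_H by auto
  have "card (H - T) = Suc k - card T" using assms(4) H finite_subset by (metis card_Diff_subset)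
  moreover have "card ({..<k} - I) = k - card I" using assms(1,2) by (simp add: card_Diff_subset)
  ultimately have "card (H - T) \<le> card ({..<k} - I)" using assms(5) by simp
  then show ?thesis using card_le_inj[of "H - T" "{..<k} - I"] H(1) by auto
qed

lemma two_cliques_vertices:
  obtains q1 q1' q2 q2' where "q1 \<in> H1" "q1' \<in> H1" "q2 \<in> H2" "q2' \<in> H2" "distinct [p, q1, q1', q2, q2']"
    "q1 \<notin> H2" "q1' \<notin> H2" "q2 \<notin> H1" "q2' \<notin> H1"
proof -
  have ex2: "\<exists>x y. x \<in> H - {p} \<and> y \<in> H - {p} \<and> x \<noteq> y" if "H = H1 \<or> H = H2" for H
  proof -
    have "card (H - {p}) = k" "finite H" using that F.card_H F.p_mem F.fin by auto
    then show ?thesis using F.k_ge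
      by (metis One_nat_def card_le_Suc0_iff_eq finite_Diff not_less_eq_eq numeral_2_eq_2)
  qed
  obtain q1 q1' where 1: "q1 \<in> H1 - {p}" "q1' \<in> H1 - {p}" "q1 \<noteq> q1'" using ex2[of H1] by blast
  obtain q2 q2' where 2: "q2 \<in> H2 - {p}" "q2' \<in> H2 - {p}" "q2 \<noteq> q2'" using ex2[of H2] by blast
  have "q1 \<notin> H2" "q1' \<notin> H2" "q2 \<notin> H1" "q2' \<notin> H1" using 1 2 F.p by blast+
  then show thesis using 1 2 by (intro that[of q1 q1' q2 q2']) auto
qed

text \<open>Otherwise \<open>x\<close> plays \<open>p\<close>, and each of the two edges goes into
  its own clique, which thereby saves one colour.\<close>

lemma two_cliques_in_edges_share:
  assumes e: "(x, y1) \<in> E" "(x, y2) \<in> E" "c x = c y1" "c x = c y2"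
  shows "y1 = y2"
proof (rule ccontr)
  assume ne: "y1 \<noteq> y2"
  obtain q1 q1' q2 q2' where q: "q1 \<in> H1" "q1' \<in> H1" "q2 \<in> H2" "q2' \<in> H2" "distinct [p, q1, q1', q2, q2']"
    "q1 \<notin> H2" "q1' \<notin> H2" "q2 \<notin> H1" "q2' \<notin> H1" by (rule two_cliques_vertices)
  have V: "x \<in> V" "y1 \<in> V" "y2 \<in> V" "x \<noteq> y1" "x \<noteq> y2" using e E_subset E_irrefl by auto
  define S where "S = {p, q1, q2}"
  define g where "g z = (if z = p then x else if z = q1 then y1 else y2)" for z
  have S1: "S \<inter> H1 = {p, q1}" and S2: "S \<inter> H2 = {p, q2}" using q F.p_mem by (auto simp: S_def)
  have D: "H1 - S = H1 - {p, q1}" "H2 - S = H2 - {p, q2}" using S1 S2 by blast+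
  have I: "(c \<circ> g) ` {p, q1} = {c x}" "(c \<circ> g) ` {p, q2} = {c x}" using e q by (auto simp: g_def)
  have cx: "c x < k" using c_less V by simp
  obtain h1 where h1: "inj_on h1 (H1 - {p, q1})" "h1 ` (H1 - {p, q1}) \<subseteq> {..<k} - {c x}"
    using two_cliques_rest[of "{c x}" H1 "{p, q1}"] cx q F.p_mem by auto
  obtain h2 where h2: "inj_on h2 (H2 - {p, q2})" "h2 ` (H2 - {p, q2}) \<subseteq> {..<k} - {c x}"
    using two_cliques_rest[of "{c x}" H2 "{p, q2}"] cx q F.p_mem by auto
  have "embeds VF F.EF V E"
  proof (rule embeds_two_cliques[OF F two_cliques_no_apex, of S g h1 h2])
    show "S \<subseteq> VF" using q F.p_mem by (auto simp: S_def F.VF)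
    show "inj_on g S" using q ne V by (auto simp: S_def g_def inj_on_def)
    show "g ` S \<subseteq> V" using V by (auto simp: S_def g_def)
    show "(g z, g w) \<in> E" if "z \<in> S \<inter> H1" "w \<in> S \<inter> H1" "z \<noteq> w" for z w
      using that e E_sym[OF e(1)] q unfolding S1 by (auto simp: g_def)
    show "(g z, g w) \<in> E" if "z \<in> S \<inter> H2" "w \<in> S \<inter> H2" "z \<noteq> w" for z w
      using that e E_sym[OF e(2)] q unfolding S2 by (auto simp: g_def)
    show "p \<notin> S \<Longrightarrow> h1 p = h2 p" by (simp add: S_def)
  qed (use h1 h2 in \<open>simp_all only: S1 S2 D I\<close>)
  then show False using free by simp
qed

text \<open>Each edge goes into its own clique, away from \<open>p\<close>. As \<open>p\<close> lies
  in both cliques, it must get the same colour \<open>j\<close> in both, different from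
  \<open>i\<close>; here \<open>2 \<le> k\<close> enters.\<close>

lemma two_cliques_in_edges_disjoint:
  assumes e: "(x1, y1) \<in> E" "(x2, y2) \<in> E" "c x1 = i" "c y1 = i" "c x2 = i" "c y2 = i"
    and ne: "{x1, y1} \<inter> {x2, y2} = {}"
  shows False
proof -
  obtain q1 q1' q2 q2' where q: "q1 \<in> H1" "q1' \<in> H1" "q2 \<in> H2" "q2' \<in> H2" "distinct [p, q1, q1', q2, q2']"
    "q1 \<notin> H2" "q1' \<notin> H2" "q2 \<notin> H1" "q2' \<notin> H1" by (rule two_cliques_vertices)
  have V: "x1 \<in> V" "y1 \<in> V" "x2 \<in> V" "y2 \<in> V" "x1 \<noteq> y1" "x2 \<noteq> y2" using e E_subset E_irrefl by auto
  define S where "S = {q1, q1', q2, q2'}"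
  define g where "g z = (if z = q1 then x1 else if z = q1' then y1 else if z = q2 then x2 else y2)" for z
  have S1: "S \<inter> H1 = {q1, q1'}" and S2: "S \<inter> H2 = {q2, q2'}" using q by (auto simp: S_def)
  have D: "H1 - S = H1 - {q1, q1'}" "H2 - S = H2 - {q2, q2'}" using S1 S2 by blast+
  have I: "(c \<circ> g) ` {q1, q1'} = {i}" "(c \<circ> g) ` {q2, q2'} = {i}" using e q by (auto simp: g_def)
  have i: "i < k" using c_less V e by auto
  define j where "j = (if i = 0 then 1 else 0 :: nat)"
  have j: "j \<in> {..<k} - {i}" using F.k_ge by (auto simp: j_def)
  have card: "card (H1 - {q1, q1'}) \<le> card ({..<k} - {i})" "card (H2 - {q2, q2'}) \<le> card ({..<k} - {i})"
    using q i F.card_H F.fin by (auto simp: card_Diff_subset)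
  obtain h1 where h1: "inj_on h1 (H1 - {q1, q1'})" "h1 ` (H1 - {q1, q1'}) \<subseteq> {..<k} - {i}" "h1 p = j"
    using ex_inj_on_with_value[of "H1 - {q1, q1'}" "{..<k} - {i}" p j] card(1) j q F.p_mem F.fin by auto
  obtain h2 where h2: "inj_on h2 (H2 - {q2, q2'})" "h2 ` (H2 - {q2, q2'}) \<subseteq> {..<k} - {i}" "h2 p = j"
    using ex_inj_on_with_value[of "H2 - {q2, q2'}" "{..<k} - {i}" p j] card(2) j q F.p_mem F.fin by auto
  have "embeds VF F.EF V E"
  proof (rule embeds_two_cliques[OF F two_cliques_no_apex, of S g h1 h2])
    show "S \<subseteq> VF" using q by (auto simp: S_def F.VF)
    show "inj_on g S" using q ne V by (auto simp: S_def g_def inj_on_def)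
    show "g ` S \<subseteq> V" using V by (auto simp: S_def g_def)
    show "(g z, g w) \<in> E" if "z \<in> S \<inter> H1" "w \<in> S \<inter> H1" "z \<noteq> w" for z w
      using that e E_sym[OF e(1)] q unfolding S1 by (auto simp: g_def)
    show "(g z, g w) \<in> E" if "z \<in> S \<inter> H2" "w \<in> S \<inter> H2" "z \<noteq> w" for z w
      using that e E_sym[OF e(2)] q unfolding S2 by (auto simp: g_def)
    show "p \<notin> S \<Longrightarrow> h1 p = h2 p" using h1(3) h2(3) by simp
  qed (use h1(1,2) h2(1,2) in \<open>simp_all only: S1 S2 D I\<close>)
  then show False using free by simp
qed

text \<open>With \<open>x\<close> as \<open>p\<close>, the triangle \<open>x u v\<close> starts one
  clique and the edge \<open>x y\<close> the other; each repeats one colour.\<close>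

lemma two_cliques_in_edges_cross:
  assumes e: "(x, y) \<in> E" "(u, v) \<in> E" "c x = c y" "c u = c v" "c u \<noteq> c x" and adj: "(x, u) \<in> E" "(x, v) \<in> E"
  shows False
proof -
  obtain q1 q1' q2 q2' where q: "q1 \<in> H1" "q1' \<in> H1" "q2 \<in> H2" "q2' \<in> H2" "distinct [p, q1, q1', q2, q2']"
    "q1 \<notin> H2" "q1' \<notin> H2" "q2 \<notin> H1" "q2' \<notin> H1" by (rule two_cliques_vertices)
  have V: "x \<in> V" "y \<in> V" "u \<in> V" "v \<in> V" "x \<noteq> y" "u \<noteq> v" using e E_subset E_irrefl by auto
  define S where "S = {p, q1, q1', q2}"
  define g where "g z = (if z = p then x else if z = q1 then u else if z = q1' then v else y)" for z
  have S1: "S \<inter> H1 = {p, q1, q1'}" and S2: "S \<inter> H2 = {p, q2}" using q F.p_mem by (auto simp: S_def)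
  have D: "H1 - S = H1 - {p, q1, q1'}" "H2 - S = H2 - {p, q2}" using S1 S2 by blast+
  have I: "(c \<circ> g) ` {p, q1, q1'} = {c x, c u}" "(c \<circ> g) ` {p, q2} = {c x}" using e q by (auto simp: g_def)
  have cx: "c x < k" "c u < k" using c_less V by simp_all
  obtain h1 where h1: "inj_on h1 (H1 - {p, q1, q1'})" "h1 ` (H1 - {p, q1, q1'}) \<subseteq> {..<k} - {c x, c u}"
    using two_cliques_rest[of "{c x, c u}" H1 "{p, q1, q1'}"] cx q F.p_mem e(5) by auto
  obtain h2 where h2: "inj_on h2 (H2 - {p, q2})" "h2 ` (H2 - {p, q2}) \<subseteq> {..<k} - {c x}"
    using two_cliques_rest[of "{c x}" H2 "{p, q2}"] cx q F.p_mem by auto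
  have "embeds VF F.EF V E"
  proof (rule embeds_two_cliques[OF F two_cliques_no_apex, of S g h1 h2])
    show "S \<subseteq> VF" using q F.p_mem by (auto simp: S_def F.VF)
    show "inj_on g S" using q e V by (auto simp: S_def g_def inj_on_def)
    show "g ` S \<subseteq> V" using V by (auto simp: S_def g_def)
    show "(g z, g w) \<in> E" if "z \<in> S \<inter> H1" "w \<in> S \<inter> H1" "z \<noteq> w" for z w
      using that adj E_sym[OF adj(1)] E_sym[OF adj(2)] e(2) E_sym[OF e(2)] q unfolding S1 by (auto simp: g_def)
    show "(g z, g w) \<in> E" if "z \<in> S \<inter> H2" "w \<in> S \<inter> H2" "z \<noteq> w" for z w
      using that e E_sym[OF e(1)] q unfolding S2 by (auto simp: g_def)
    show "p \<notin> S \<Longrightarrow> h1 p = h2 p" by (simp add: S_def)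
  qed (use h1 h2 in \<open>simp_all only: S1 S2 D I\<close>)
  then show False using free by simp
qed

text \<open>Two edges inside classes must lie in different classes, and then each of their endpoints
  misses an endpoint of the other edge, so that no degree exceeds that of the complete partite graph.\<close>

lemma two_cliques_power_sum_le:
  assumes "2 \<le> card {x \<in> V. c x = 0}"
  shows "\<exists>x\<in>V. \<exists>y\<in>V. x \<noteq> y \<and> c x = c y \<and> power_sum r V E \<le> power_sum r V (multipartite V c \<union> {(x, y), (y, x)})"
proof -
  define D where "D = {(x, y) \<in> E. c x = c y}"
  have D_sym: "(y, x) \<in> D" if "(x, y) \<in> D" for x y using that E_sym by (auto simp: D_def)
  have DV: "x \<in> V" "y \<in> V" "x \<noteq> y" "c x = c y" if "(x, y) \<in> D" for x y
    using that E_subset E_irrefl by (auto simp: D_def)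
  have E_sub: "E \<subseteq> multipartite V c \<union> D" using E_subset by (auto simp: multipartite_def D_def)
  have share: "y1 = y2" if "(x, y1) \<in> D" "(x, y2) \<in> D" for x y1 y2
    using that by (intro two_cliques_in_edges_share[of x y1 y2]) (auto simp: D_def)
  have sg: "sgraph V (multipartite V c \<union> {(x, y), (y, x)})" if "x \<in> V" "y \<in> V" "x \<noteq> y" for x y
    using that finite_V by unfold_locales (auto simp: multipartite_def sym_def irrefl_def)
  consider "D = {}" | x y where "(x, y) \<in> D" "\<forall>(u, v)\<in>D. {u, v} = {x, y}"
    | x y u v where "(x, y) \<in> D" "(u, v) \<in> D" "{u, v} \<noteq> {x, y}" by fast
  then show ?thesis
  proof cases
    case 1
    \<comment> \<open>The target has an edge inside a class even if \<open>E\<close> has none; any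
      pair in class 0 serves.\<close>
    have "finite {x \<in> V. c x = 0}" using finite_V by simp
    then obtain x y where xy: "x \<in> V" "y \<in> V" "x \<noteq> y" "c x = 0" "c y = 0"
      using assms card_le_Suc0_iff_eq[of "{x \<in> V. c x = 0}"] by auto
    then have "power_sum r V E \<le> power_sum r V (multipartite V c \<union> {(x, y), (y, x)})"
      using E_sub 1 by (intro power_sum_mono sg) auto
    then show ?thesis using xy by (intro bexI[of _ x] bexI[of _ y] conjI) simp_all
  next
    case 2
    have "E \<subseteq> multipartite V c \<union> {(x, y), (y, x)}"
    proof -
      have "D \<subseteq> {(x, y), (y, x)}" using 2(2) by (auto simp: doubleton_eq_iff)
      then show ?thesis using E_sub by blast
    qed
    then have "power_sum r V E \<le> power_sum r V (multipartite V c \<union> {(x, y), (y, x)})"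
      using DV[OF 2(1)] by (intro power_sum_mono sg) auto
    then show ?thesis using DV[OF 2(1)] by blast
  next
    case 3
    have cne: "c u \<noteq> c x"
    proof
      assume eq: "c u = c x"
      have "{x, y} \<inter> {u, v} = {}"
        using share[OF 3(1)] share[OF D_sym[OF 3(1)]] D_sym[OF 3(1)] 3 D_sym[OF 3(2)] by blast
      moreover have "(x, y) \<in> E" "(u, v) \<in> E" "c y = c x" "c v = c x"
        using 3(1,2) eq unfolding D_def by simp_all
      ultimately show False using two_cliques_in_edges_disjoint[of x y u v "c x"] eq by blast
    qed
    have deg: "card (E `` {z}) \<le> card (multipartite V c `` {z})" if z: "z \<in> V" for z
    proof -
      interpret mp: sgraph V "multipartite V c" using finite_V by (rule sgraph_multipartite)
      show ?thesis
      proof (cases "\<exists>t. (z, t) \<in> D")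
        case False
        then have "E `` {z} \<subseteq> multipartite V c `` {z}" using E_sub by auto
        then show ?thesis by (intro card_mono) auto
      next
        case True
        then obtain t where t: "(z, t) \<in> D" by blast
        \<comment> \<open>The edges \<open>x y\<close> and \<open>u v\<close> lie in different
          classes, so one of them lies outside the class of \<open>z\<close>.\<close>
        obtain a b where ab: "(a, b) \<in> D" "c a \<noteq> c z" using 3 cne by metis
        then have "\<not> ((z, a) \<in> E \<and> (z, b) \<in> E)"
          using two_cliques_in_edges_cross[of z t a b] t by (auto simp: D_def)
        then obtain w where w: "w \<in> {a, b}" "(z, w) \<notin> E" by blast
        have w': "w \<in> multipartite V c `` {z}"
          using w(1) ab DV[OF ab(1)] z by (auto simp: multipartite_def)
        have "E `` {z} \<subseteq> insert t (multipartite V c `` {z} - {w})"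
          using E_sub share[OF t] w(2) by auto
        then have "card (E `` {z}) \<le> card (insert t (multipartite V c `` {z} - {w}))" by (intro card_mono) auto
        also have "\<dots> \<le> Suc (card (multipartite V c `` {z} - {w}))" by (simp add: card_insert_if)
        also have "\<dots> = card (multipartite V c `` {z})" using w' by (intro card.remove[symmetric]) auto
        finally show ?thesis .
      qed
    qed
    have "power_sum r V E \<le> power_sum r V (multipartite V c)"
      unfolding power_sum_def using deg by (intro sum_mono power_mono) auto
    also have "\<dots> \<le> power_sum r V (multipartite V c \<union> {(x, y), (y, x)})"
      using DV[OF 3(1)] by (intro power_sum_mono sg) auto
    finally show ?thesis using DV[OF 3(1)] by blast
  qed
qed

end

end

theorem (in two_cliques) extremal_one_edge:
  assumes "1 \<le> r"
  shows "\<exists>n0. \<forall>(V :: 'a set) E. extremal r VF EF V E \<longrightarrow> n0 \<le> card V \<longrightarrow>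
    (\<exists>c x y. (\<forall>x\<in>V. c x < k) \<and> (\<forall>i<k. {x \<in> V. c x = i} \<noteq> {}) \<and> x \<in> V \<and> y \<in> V \<and> x \<noteq> y \<and> c x = c y \<and>
      \<not> embeds VF EF V (multipartite V c \<union> {(x, y), (y, x)}) \<and>
      power_sum r V E \<le> power_sum r V (multipartite V c \<union> {(x, y), (y, x)}))"
proof -
  obtain n0 where n0: "\<And>(V :: 'a set) E. extremal r VF EF V E \<Longrightarrow> n0 \<le> card V \<Longrightarrow>
    (\<exists>\<kappa> \<tau> \<beta> \<gamma> c Gd. near_partite V E k (card VF) \<kappa> \<tau> \<beta> \<gamma> c Gd \<and> (\<forall>i<k. 2 \<le> card {x \<in> V. c x = i}))"
    using extremal_near_partite_classes[OF sgraph_EF colorable_Suc not_colorable k_ge assms, where 'a = 'a and m = 2]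
    by blast
  show ?thesis
  proof (intro exI[of _ n0] allI impI)
    fix V :: "'a set" and E
    assume ex: "extremal r VF EF V E" and nn: "n0 \<le> card V"
    obtain \<kappa> \<tau> \<beta> \<gamma> c Gd where np: "near_partite V E k (card VF) \<kappa> \<tau> \<beta> \<gamma> c Gd"
      and classes: "\<forall>i<k. 2 \<le> card {x \<in> V. c x = i}" using n0[OF ex nn] by blast
    interpret near_partite V E k "card VF" \<kappa> \<tau> \<beta> \<gamma> c Gd by (rule np)
    have free: "\<not> embeds VF EF V E" using ex by (simp add: extremal_def)
    have tc: "two_cliques VF H1 H2 p k" by (rule two_cliques_axioms)
    have "2 \<le> card {x \<in> V. c x = 0}" using classes k_ge by simp
    then obtain x y where xy: "x \<in> V" "y \<in> V" "x \<noteq> y" "c x = c y"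
      "power_sum r V E \<le> power_sum r V (multipartite V c \<union> {(x, y), (y, x)})"
      using two_cliques_power_sum_le[OF tc _ free, of r] by auto
    moreover have "\<not> embeds VF EF V (multipartite V c \<union> {(x, y), (y, x)})"
      using c_less xy(3) by (rule not_embeds_one_edge)
    moreover have "{x \<in> V. c x = i} \<noteq> {}" if "i < k" for i
      using classes that by (metis card.empty not_numeral_le_zero)
    ultimately show "\<exists>c x y. (\<forall>x\<in>V. c x < k) \<and> (\<forall>i<k. {x \<in> V. c x = i} \<noteq> {}) \<and> x \<in> V \<and> y \<in> V \<and> x \<noteq> y \<and> c x = c y \<and>
      \<not> embeds VF EF V (multipartite V c \<union> {(x, y), (y, x)}) \<and>
      power_sum r V E \<le> power_sum r V (multipartite V c \<union> {(x, y), (y, x)})"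
      using c_less by blast
  qed
qed

section \<open>Transfer to pair graphs\<close>

lemma sgraph_pair_graph:
  assumes "pair_graph G"
  shows "sgraph (pverts G) (parcs G)"
proof -
  interpret pair_graph G by fact
  show ?thesis
  proof
    show "parcs G \<subseteq> pverts G \<times> pverts G" using in_arcsD1 in_arcsD2 by auto
    show "sym (parcs G)" using arcs_symmetric by (auto intro: symI)
    show "irrefl (parcs G)" using no_loops' by (auto simp: irrefl_def)
  qed simp
qed

lemma pair_graph_sgraph:
  assumes "sgraph V E"
  shows "pair_graph \<lparr>pverts = V, parcs = E\<rparr>"
proof -
  interpret sgraph V E by fact
  show ?thesis
    using finite_V finite_E E_subset E_irrefl sym_E
    by unfold_locales (auto simp: symmetric_def)
qed

lemma deg_eq: "deg G v = card (parcs G `` {v})"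
proof -
  have "out_arcs (with_proj G) v = {v} \<times> (parcs G `` {v})" by (auto simp: out_arcs_def)
  then show ?thesis by (simp add: deg_def out_degree_def card_cartesian_product)
qed

lemma degree_power_sum_eq: "degree_power_sum r G = power_sum r (pverts G) (parcs G)"
  by (simp add: degree_power_sum_def power_sum_def deg_eq)

lemma F_free_iff:
  assumes "pair_graph F" "pair_graph G"
  shows "F_free F G \<longleftrightarrow> \<not> embeds (pverts F) (parcs F) (pverts G) (parcs G)"
  using assms contains_copy_iff[of F G]
  by (auto simp: F_free_def embeds_def pair_graph_def pair_digraph_def pair_fin_digraph_def)

text \<open>As \<open>F\<close> has an edge, the edgeless graph is free of \<open>F\<close>, so the
  maximum is over a nonempty set and is attained.\<close>

lemma ex_power_attained:
  assumes F: "pair_graph F" "parcs F \<noteq> {}"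
  shows "\<exists>(V :: nat set) E. card V = n \<and> extremal r (pverts F) (parcs F) V E \<and> ex_power r n F = power_sum r V E"
proof -
  define S where "S = {degree_power_sum r G | G :: nat pair_pre_digraph. pair_graph G \<and> card (pverts G) = n \<and> F_free F G}"
  have fin: "finite S" unfolding S_def by (rule finite_degree_power_sums)
  have in_S: "power_sum r V E \<in> S" if "sgraph V E" "card V = n" "\<not> embeds (pverts F) (parcs F) V E" for V :: "nat set" and E
    unfolding S_def using that pair_graph_sgraph[OF that(1)] F_free_iff[OF F(1) pair_graph_sgraph[OF that(1)]]
    by (intro CollectI exI[of _ "\<lparr>pverts = V, parcs = E\<rparr>"]) (simp add: degree_power_sum_eq)
  have "power_sum r {..<n} {} \<in> S"
  proof (rule in_S)
    show "sgraph {..<n} {}" by unfold_locales (auto simp: sym_def irrefl_def)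
    show "\<not> embeds (pverts F) (parcs F) {..<n} {}" using F(2) by (auto simp: embeds_def)
  qed simp
  then have "Max S \<in> S" using fin by (intro Max_in) auto
  then obtain G :: "nat pair_pre_digraph" where
    G: "Max S = degree_power_sum r G" "pair_graph G" "card (pverts G) = n" "F_free F G"
    by (auto simp: S_def)
  have "extremal r (pverts F) (parcs F) (pverts G) (parcs G)"
    unfolding extremal_def
  proof (intro conjI allI impI)
    show "sgraph (pverts G) (parcs G)" using G(2) by (rule sgraph_pair_graph)
    show "\<not> embeds (pverts F) (parcs F) (pverts G) (parcs G)" using F_free_iff[OF F(1) G(2)] G(4) by simp
    fix E' assume "sgraph (pverts G) E'" "\<not> embeds (pverts F) (parcs F) (pverts G) E'"
    then have "power_sum r (pverts G) E' \<in> S" using G(3) by (intro in_S)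
    then have "power_sum r (pverts G) E' \<le> Max S" using fin by (intro Max_ge)
    then show "power_sum r (pverts G) E' \<le> power_sum r (pverts G) (parcs G)"
      using G(1) by (simp add: degree_power_sum_eq)
  qed
  moreover have "ex_power r n F = power_sum r (pverts G) (parcs G)"
    using G(1) by (simp add: ex_power_def S_def degree_power_sum_eq)
  ultimately show ?thesis using G(3) by blast
qed

text \<open>The competitor \<open>E'\<close> is free of \<open>F\<close> on the same vertex set, so
  extremality gives the reverse inequality and both power sums coincide.\<close>

lemma ex_power_extremal:
  assumes F: "pair_graph F" "parcs F \<noteq> {}"
    and n0: "\<And>(V :: nat set) E. \<lbrakk>extremal r (pverts F) (parcs F) V E; n0 \<le> card V\<rbrakk> \<Longrightarrow>
      \<exists>E'. Q V E' \<and> sgraph V E' \<and> \<not> embeds (pverts F) (parcs F) V E' \<and> power_sum r V E \<le> power_sum r V E'"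
  shows "\<forall>\<^sub>F n in sequentially. \<exists>V E'. finite V \<and> card V = n \<and> Q V E' \<and> ex_power r n F = power_sum r V E'"
proof -
  have "\<exists>V E'. finite V \<and> card V = n \<and> Q V E' \<and> ex_power r n F = power_sum r V E'" if nn: "n0 \<le> n" for n
  proof -
    obtain V :: "nat set" and E where
      VE: "card V = n" "extremal r (pverts F) (parcs F) V E" "ex_power r n F = power_sum r V E"
      using ex_power_attained[OF F] by blast
    then obtain E' where E': "Q V E'" "sgraph V E'" "\<not> embeds (pverts F) (parcs F) V E'"
      "power_sum r V E \<le> power_sum r V E'" using n0[OF VE(2)] nn by blast
    then have "power_sum r V E = power_sum r V E'"
      using VE(2) unfolding extremal_def by (metis le_antisym)
    then show ?thesis using VE E' sgraph.finite_V[OF E'(2)] by metis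
  qed
  then show ?thesis unfolding eventually_sequentially by blast
qed

lemma colorable_iff: "colorable (pverts G) (parcs G) q \<longleftrightarrow> (\<exists>c. proper_coloring G q c)"
  by (simp add: colorable_def proper_coloring_def)

lemma colorable_mono: "colorable VF EF q \<Longrightarrow> q \<le> q' \<Longrightarrow> colorable VF EF q'"
  unfolding colorable_def by (meson order_less_le_trans)

lemma colorable_chromatic_number:
  assumes "sgraph (pverts G) (parcs G)"
  shows "colorable (pverts G) (parcs G) (chromatic_number G)"
proof -
  interpret sgraph "pverts G" "parcs G" by fact
  obtain c where c: "bij_betw c (pverts G) {0..<card (pverts G)}"
    using ex_bij_betw_finite_nat[OF finite_V] by blast
  have "proper_coloring G (card (pverts G)) c"
    unfolding proper_coloring_def
  proof (intro conjI ballI)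
    fix e assume e: "e \<in> parcs G"
    obtain x y where "e = (x, y)" by (cases e)
    then show "case e of (u, v) \<Rightarrow> c u \<noteq> c v"
      using e E_subset E_irrefl c by (auto simp: bij_betw_def inj_on_def)
  qed (use c in \<open>auto simp: bij_betw_def\<close>)
  then have "\<exists>q. \<exists>c. proper_coloring G q c" by blast
  from LeastI_ex[OF this] show ?thesis unfolding colorable_iff chromatic_number_def .
qed

lemma chromatic_number_le:
  assumes "colorable (pverts G) (parcs G) q"
  shows "chromatic_number G \<le> q"
  using assms unfolding colorable_iff chromatic_number_def by (rule Least_le)

lemma partition_of_coloring:
  fixes c :: "'a \<Rightarrow> nat"
  assumes "\<And>x. x \<in> V \<Longrightarrow> c x < q" "\<And>i. i < q \<Longrightarrow> {x \<in> V. c x = i} \<noteq> {}"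
  defines "A \<equiv> \<lambda>i. {x \<in> V. c x = i}"
  shows "partition_on V (A ` {..<q})" "inj_on A {..<q}" "card (A ` {..<q}) = q"
    "complete_multipartite (A ` {..<q}) = \<lparr>pverts = V, parcs = multipartite V c\<rparr>"
proof -
  have A_eq: "i = j" if "x \<in> A i" "x \<in> A j" for x i j using that by (auto simp: A_def)
  show inj: "inj_on A {..<q}"
  proof (rule inj_onI)
    fix i j assume "i \<in> {..<q}" "A i = A j"
    moreover obtain x where "x \<in> A i" using assms(2)[of i] \<open>i \<in> {..<q}\<close> unfolding A_def by blast
    ultimately show "i = j" using A_eq by blast
  qed
  show "card (A ` {..<q}) = q" using card_image[OF inj] by simp
  have Un: "\<Union> (A ` {..<q}) = V" using assms(1) by (auto simp: A_def)
  show "partition_on V (A ` {..<q})"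
  proof (rule partition_onI)
    show "\<Union> (A ` {..<q}) = V" by (rule Un)
    show "{} \<notin> A ` {..<q}" using assms(2) by (auto simp: A_def)
    show "disjnt B C" if BC: "B \<in> A ` {..<q}" "C \<in> A ` {..<q}" "B \<noteq> C" for B C
    proof -
      obtain i j where "B = A i" "C = A j" using BC(1,2) by auto
      then show ?thesis using BC(3) A_eq unfolding disjnt_iff by metis
    qed
  qed
  have "{(u, v). \<exists>B\<in>A ` {..<q}. \<exists>C\<in>A ` {..<q}. B \<noteq> C \<and> u \<in> B \<and> v \<in> C} = multipartite V c"
  proof (intro set_eqI, clarify, rule iffI)
    fix u v assume "(u, v) \<in> {(u, v). \<exists>B\<in>A ` {..<q}. \<exists>C\<in>A ` {..<q}. B \<noteq> C \<and> u \<in> B \<and> v \<in> C}"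
    then show "(u, v) \<in> multipartite V c" by (auto simp: A_def multipartite_def)
  next
    fix u v assume "(u, v) \<in> multipartite V c"
    then have uv: "u \<in> A (c u)" "v \<in> A (c v)" "c u < q" "c v < q" "c u \<noteq> c v"
      using assms(1) by (auto simp: A_def multipartite_def)
    then have "A (c u) \<noteq> A (c v)" using A_eq by blast
    then show "(u, v) \<in> {(u, v). \<exists>B\<in>A ` {..<q}. \<exists>C\<in>A ` {..<q}. B \<noteq> C \<and> u \<in> B \<and> v \<in> C}"
      using uv by blast
  qed
  then show "complete_multipartite (A ` {..<q}) = \<lparr>pverts = V, parcs = multipartite V c\<rparr>"
    by (simp add: complete_multipartite_def Un)
qed

section \<open>Connected components as reachability classes\<close>

lemma connected_pair_iff:
  assumes "pair_wf_digraph C"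
  shows "Digraph_Component.connected (with_proj C) \<longleftrightarrow>
    pverts C \<noteq> {} \<and> (\<forall>u\<in>pverts C. \<forall>v\<in>pverts C. (u, v) \<in> (parcs C \<union> (parcs C)\<inverse>)\<^sup>*)"
proof -
  interpret C: pair_wf_digraph C by fact
  interpret S: pair_wf_digraph "mk_symmetric (with_proj C)" by (rule C.wellformed_mk_symmetric)
  have "parcs (mk_symmetric (with_proj C)) = parcs C \<union> (parcs C)\<inverse>"
    by (auto simp: parcs_mk_symmetric)
  then show ?thesis
    unfolding Digraph_Component.connected_def strongly_connected_def using S.reachable_conv' by auto
qed

lemma subgraph_pairE:
  assumes "subgraph H (with_proj G)"
  obtains M where "H = with_proj M" "pverts M \<subseteq> pverts G" "parcs M \<subseteq> parcs G" "pair_wf_digraph M"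
proof
  let ?M = "\<lparr>pverts = verts H, parcs = arcs H\<rparr>"
  have "tail H = fst" "head H = snd" using assms by (auto simp: subgraph_def compatible_def)
  then show eq: "H = with_proj ?M" by (simp add: with_proj_def)
  have "wf_digraph H" using assms by (simp add: subgraph_def)
  then show "pair_wf_digraph ?M" using wf_digraph_wp_iff[of ?M] eq by simp
qed (use assms in \<open>auto simp: subgraph_def\<close>)

lemma subgraph_pair_iff:
  "subgraph (with_proj H) (with_proj G) \<longleftrightarrow>
    pverts H \<subseteq> pverts G \<and> parcs H \<subseteq> parcs G \<and> pair_wf_digraph G \<and> pair_wf_digraph H"
  by (auto simp: subgraph_def wf_digraph_wp_iff)

definition component_of :: "'a pair_pre_digraph \<Rightarrow> 'a \<Rightarrow> 'a pair_pre_digraph" where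
  "component_of G x = \<lparr>pverts = {y. (x, y) \<in> (parcs G)\<^sup>*}, parcs = {(u, v) \<in> parcs G. (x, u) \<in> (parcs G)\<^sup>*}\<rparr>"

text \<open>Replaces maximal connected subgraphs by reachability classes, which makes the component
  of a vertex a function that is constant along edges.\<close>

lemma components_eq:
  assumes "pair_graph F"
  shows "components F = component_of F ` pverts F"
proof -
  interpret F: pair_graph F by fact
  have symF: "sym (parcs F)" using F.arcs_symmetric by (auto intro: symI)
  have sym_star: "(y, x) \<in> (parcs F)\<^sup>*" if "(x, y) \<in> (parcs F)\<^sup>*" for x y
    using that sym_rtrancl[OF symF] by (auto dest: symD)
  have reach_V: "y \<in> pverts F" if "(x, y) \<in> (parcs F)\<^sup>*" "x \<in> pverts F" for x y
    using that by (induction rule: rtrancl_induct) (auto dest: F.in_arcsD2)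
  have wf: "pair_wf_digraph (component_of F x)" for x
    by unfold_locales (auto simp: component_of_def intro: rtrancl_into_rtrancl)
  have sub: "pverts (component_of F x) \<subseteq> pverts F" "parcs (component_of F x) \<subseteq> parcs F" if "x \<in> pverts F" for x
    using reach_V that by (auto simp: component_of_def)
  have "component_of F x \<in> components F" if x: "x \<in> pverts F" for x
  proof -
    let ?C = "component_of F x"
    have path: "(x, y) \<in> (parcs ?C)\<^sup>*" if "(x, y) \<in> (parcs F)\<^sup>*" for y
      using that
    proof (induction rule: rtrancl_induct)
      case (step y z)
      then have "(y, z) \<in> parcs ?C" by (auto simp: component_of_def)
      then show ?case using step.IH by (rule rtrancl_into_rtrancl[rotated])
    qed simp
    have symC: "sym ((parcs ?C \<union> (parcs ?C)\<inverse>)\<^sup>*)" by (intro sym_rtrancl) (auto simp: sym_def)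
    have path': "(x, y) \<in> (parcs ?C \<union> (parcs ?C)\<inverse>)\<^sup>*" if "y \<in> pverts ?C" for y
      using path[of y] that rtrancl_mono[of "parcs ?C" "parcs ?C \<union> (parcs ?C)\<inverse>"]
      by (auto simp: component_of_def)
    have "Digraph_Component.connected (with_proj ?C)"
      unfolding connected_pair_iff[OF wf]
    proof (intro conjI ballI)
      show "pverts ?C \<noteq> {}" by (auto simp: component_of_def)
      fix u v assume "u \<in> pverts ?C" "v \<in> pverts ?C"
      then have "(u, x) \<in> (parcs ?C \<union> (parcs ?C)\<inverse>)\<^sup>*" "(x, v) \<in> (parcs ?C \<union> (parcs ?C)\<inverse>)\<^sup>*"
        using path' symC by (auto dest: symD)
      then show "(u, v) \<in> (parcs ?C \<union> (parcs ?C)\<inverse>)\<^sup>*" by (rule rtrancl_trans)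
    qed
    moreover have "subgraph (with_proj ?C) (with_proj F)"
      unfolding subgraph_pair_iff using sub[OF x] wf by auto
    moreover have "\<not> (subgraph H' (with_proj F) \<and> Digraph_Component.connected H')"
      if H': "H' \<noteq> with_proj ?C" "subgraph (with_proj ?C) H'" for H'
    proof
      assume a: "subgraph H' (with_proj F) \<and> Digraph_Component.connected H'"
      then obtain M where M: "H' = with_proj M" "pverts M \<subseteq> pverts F" "parcs M \<subseteq> parcs F" "pair_wf_digraph M"
        by (auto elim: subgraph_pairE)
      interpret M: pair_wf_digraph M by (rule M(4))
      have CM: "pverts ?C \<subseteq> pverts M" "parcs ?C \<subseteq> parcs M" using H'(2) M(1) by (auto simp: subgraph_pair_iff)
      have "x \<in> pverts M" using CM(1) by (auto simp: component_of_def)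
      then have conn: "(x, y) \<in> (parcs M \<union> (parcs M)\<inverse>)\<^sup>*" if "y \<in> pverts M" for y
        using a M(1) connected_pair_iff[OF M(4)] that by auto
      have "parcs M \<union> (parcs M)\<inverse> \<subseteq> parcs F" using M(3) symF by (auto dest: symD)
      then have reach: "(x, y) \<in> (parcs F)\<^sup>*" if "y \<in> pverts M" for y
        using conn[OF that] rtrancl_mono by blast
      have "pverts M = pverts ?C" using CM(1) reach by (auto simp: component_of_def)
      moreover have "parcs M = parcs ?C"
        using CM(2) M(3) reach M.in_arcsD1 by (auto simp: component_of_def)
      ultimately have "M = ?C" by simp
      then show False using H'(1) M(1) by simp
    qed
    ultimately show ?thesis unfolding components_def pre_digraph.max_subgraph_def by blast
  qed
  moreover have "\<exists>x\<in>pverts F. C = component_of F x" if C: "C \<in> components F" for C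
  proof -
    have C': "subgraph (with_proj C) (with_proj F)" "Digraph_Component.connected (with_proj C)"
      and max: "\<And>H'. \<lbrakk>H' \<noteq> with_proj C; subgraph (with_proj C) H'; subgraph H' (with_proj F)\<rbrakk> \<Longrightarrow>
        \<not> Digraph_Component.connected H'"
      using C unfolding components_def pre_digraph.max_subgraph_def by blast+
    have subC: "pverts C \<subseteq> pverts F" "parcs C \<subseteq> parcs F" and wfC: "pair_wf_digraph C"
      using C'(1) by (auto simp: subgraph_pair_iff)
    interpret C: pair_wf_digraph C by (rule wfC)
    obtain x where x: "x \<in> pverts C" using C'(2) connected_pair_iff[OF wfC] by auto
    have conn: "(x, y) \<in> (parcs C \<union> (parcs C)\<inverse>)\<^sup>*" if "y \<in> pverts C" for y
      using C'(2) connected_pair_iff[OF wfC] that x by auto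
    have "parcs C \<union> (parcs C)\<inverse> \<subseteq> parcs F" using subC(2) symF by (auto dest: symD)
    then have reach: "(x, y) \<in> (parcs F)\<^sup>*" if "y \<in> pverts C" for y
      using conn[OF that] rtrancl_mono by blast
    have wfD: "pair_wf_digraph (component_of F x)" by (rule wf)
    have xF: "x \<in> pverts F" using x subC(1) by blast
    have CD: "subgraph (with_proj C) (with_proj (component_of F x))"
      using reach wfC wfD subC(2) C.in_arcsD1 by (auto simp: subgraph_pair_iff component_of_def)
    have DF: "subgraph (with_proj (component_of F x)) (with_proj F)" "Digraph_Component.connected (with_proj (component_of F x))"
      using \<open>\<And>x. x \<in> pverts F \<Longrightarrow> component_of F x \<in> components F\<close>[OF xF]
      unfolding components_def pre_digraph.max_subgraph_def by auto
    have "with_proj (component_of F x) = with_proj C"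
      using max[OF _ CD DF(1)] DF(2) by blast
    then have "component_of F x = C" by (simp add: with_proj_def)
    then show ?thesis using xF by blast
  qed
  ultimately show ?thesis by blast
qed

lemma component_of_arc:
  assumes "sym (parcs F)" "(x, y) \<in> parcs F"
  shows "component_of F x = component_of F y"
proof -
  have "(y, x) \<in> parcs F" using assms by (auto dest: symD)
  then have "(x, z) \<in> (parcs F)\<^sup>* \<longleftrightarrow> (y, z) \<in> (parcs F)\<^sup>*" for z
    using assms(2) by (meson converse_rtrancl_into_rtrancl)
  then show ?thesis by (simp add: component_of_def)
qed

lemma component_of_eqI:
  assumes "sym (parcs F)" "y \<in> pverts (component_of F x)"
  shows "component_of F y = component_of F x"
proof -
  have "(x, y) \<in> (parcs F)\<^sup>*" using assms(2) by (simp add: component_of_def)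
  then show ?thesis
    by (induction rule: rtrancl_induct) (use component_of_arc[OF assms(1)] in auto)
qed

text \<open>Deleting its critical edge makes each component of chromatic number \<open>k + 1\<close>
  colourable with \<open>k\<close> colours. Gluing the colourings of all components gives
  \<open>c0\<close>, whose conflicts can only be the deleted edges.\<close>

lemma critical_components_exist:
  assumes F: "pair_graph F" and s: "card {C \<in> components F. chromatic_number C = k + 1} = s" "0 < s"
    and crit: "\<And>C. \<lbrakk>C \<in> components F; chromatic_number C = k + 1\<rbrakk> \<Longrightarrow> has_color_critical_edge C"
    and other: "\<And>C. \<lbrakk>C \<in> components F; chromatic_number C \<noteq> k + 1\<rbrakk> \<Longrightarrow> chromatic_number C \<le> k"
  shows "\<exists>cp u v c0. critical_components (pverts F) (parcs F) k s cp u v c0"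
proof -
  interpret sgraph "pverts F" "parcs F" using F by (rule sgraph_pair_graph)
  have comp_F: "pverts C \<subseteq> pverts F \<and> parcs C \<subseteq> parcs F \<and> sgraph (pverts C) (parcs C)" if "C \<in> components F" for C
  proof -
    obtain x where x: "x \<in> pverts F" "C = component_of F x" using \<open>C \<in> components F\<close> components_eq[OF F] by auto
    have V: "y \<in> pverts F" if "(x, y) \<in> (parcs F)\<^sup>*" for y
      using that x(1) E_subset by (induction rule: rtrancl_induct) auto
    have "sgraph (pverts C) (parcs C)"
    proof
      show "finite (pverts C)" using V finite_V by (auto simp: x component_of_def intro: finite_subset)
    qed (use sym_E E_irrefl in \<open>auto simp: x component_of_def sym_def irrefl_def intro: rtrancl_into_rtrancl\<close>)
    then show ?thesis using V by (auto simp: x component_of_def)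
  qed
  define crits where "crits = {C \<in> components F. chromatic_number C = k + 1}"
  have ex: "\<exists>u v c. (\<forall>x\<in>pverts C. c x < k) \<and>
    (\<forall>x y. (x, y) \<in> parcs C \<longrightarrow> c x = c y \<longrightarrow> C \<in> crits \<and> {x, y} = {u, v}) \<and> (C \<in> crits \<longrightarrow> (u, v) \<in> parcs C)"
    if C: "C \<in> components F" for C
  proof (cases "C \<in> crits")
    case True
    then have "has_color_critical_edge C" using crit by (simp add: crits_def)
    then obtain u v where uv: "(u, v) \<in> parcs C" "chromatic_number (delete_edge C u v) < chromatic_number C"
      unfolding has_color_critical_edge_def by blast
    interpret C: sgraph "pverts C" "parcs C" using comp_F[OF C] by blast
    have "sgraph (pverts (delete_edge C u v)) (parcs (delete_edge C u v))"
      using C.finite_V C.E_subset C.sym_E C.irrefl_E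
      by unfold_locales (auto simp: delete_edge_def sym_def irrefl_def)
    then have "colorable (pverts (delete_edge C u v)) (parcs (delete_edge C u v)) k"
      using uv(2) True by (intro colorable_mono[OF colorable_chromatic_number]) (auto simp: crits_def)
    then obtain c where c: "\<forall>x\<in>pverts C. c x < k" "\<forall>(x, y)\<in>parcs C - {(u, v), (v, u)}. c x \<noteq> c y"
      by (auto simp: colorable_def delete_edge_def)
    have key: "{x, y} = {u, v}" if "(x, y) \<in> parcs C" "c x = c y" for x y
      using c(2) that by auto
    show ?thesis
      by (rule exI[of _ u], rule exI[of _ v], rule exI[of _ c]) (use key c(1) uv(1) True in blast)
  next
    case False
    then have "chromatic_number C \<le> k" using C other by (simp add: crits_def)
    then have "colorable (pverts C) (parcs C) k"
      using comp_F[OF C] by (intro colorable_mono[OF colorable_chromatic_number]) auto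
    then obtain c where c: "\<forall>x\<in>pverts C. c x < k" "\<forall>(x, y)\<in>parcs C. c x \<noteq> c y" by (auto simp: colorable_def)
    \<comment> \<open>No edge is selected in this case, so its ends are arbitrary.\<close>
    show ?thesis
      by (rule exI[of _ undefined], rule exI[of _ undefined], rule exI[of _ c]) (use c False in blast)
  qed
  obtain uC vC cC where C_props: "\<And>C x. C \<in> components F \<Longrightarrow> x \<in> pverts C \<Longrightarrow> cC C x < k"
    "\<And>C x y. C \<in> components F \<Longrightarrow> (x, y) \<in> parcs C \<Longrightarrow> cC C x = cC C y \<Longrightarrow> C \<in> crits \<and> {x, y} = {uC C, vC C}"
    "\<And>C. C \<in> components F \<Longrightarrow> C \<in> crits \<Longrightarrow> (uC C, vC C) \<in> parcs C"
    using ex by metis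
  have "finite crits" using s unfolding crits_def by (metis card.infinite less_numeral_extra(3))
  then obtain e where e: "bij_betw e {..<s} crits"
    using ex_bij_betw_nat_finite[of crits] s(1) unfolding crits_def by (metis atLeast0LessThan)
  have e_crit: "e i \<in> crits" if "i < s" for i using e that by (auto simp: bij_betw_def)
  have e_inj: "i = j" if "i < s" "j < s" "e i = e j" for i j using e that by (auto simp: bij_betw_def inj_on_def)
  have e_ex: "\<exists>i<s. e i = C" if "C \<in> crits" for C using e that by (auto simp: bij_betw_def)
  have crits_sub: "C \<in> components F" if "C \<in> crits" for C using that by (simp add: crits_def)
  define co where "co = component_of F"
  have co: "co x \<in> components F" "x \<in> pverts (co x)" if "x \<in> pverts F" for x
    using that components_eq[OF F] by (auto simp: co_def component_of_def)
  have co_in: "co x = C" if "x \<in> pverts C" "C \<in> components F" for x C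
  proof -
    obtain y where "C = component_of F y" using \<open>C \<in> components F\<close> components_eq[OF F] by auto
    then show ?thesis using component_of_eqI[OF sym_E] that(1) by (simp add: co_def)
  qed
  have co_arc: "co x = co y" "(x, y) \<in> parcs (co x)" if "(x, y) \<in> parcs F" for x y
    using component_of_arc[OF sym_E that] that by (auto simp: co_def component_of_def)
  \<comment> \<open>All components of chromatic number at most \<open>k\<close> share the number
    \<open>s\<close>, which lies outside the range of the critical ones.\<close>
  define cp where "cp x = (if co x \<in> crits then THE i. i < s \<and> e i = co x else s)" for x
  have cp_eq: "cp x = i \<longleftrightarrow> co x = e i" if "i < s" for x i
  proof
    assume i: "cp x = i"
    then have c: "co x \<in> crits" using that by (auto simp: cp_def split: if_splits)
    then obtain j where "j < s" "e j = co x" using e_ex by blast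
    then have "\<exists>!i. i < s \<and> e i = co x" using e_inj by (intro ex1I[of _ j]) auto
    from theI'[OF this] show "co x = e i" using i c by (simp add: cp_def)
  next
    assume i: "co x = e i"
    have "(THE j. j < s \<and> e j = e i) = i" using that e_inj by (intro the_equality) auto
    then show "cp x = i" using i e_crit[OF that] by (simp add: cp_def)
  qed
  have ev: "pverts (e i) = {x \<in> pverts F. cp x = i}" if "i < s" for i
  proof (intro set_eqI iffI)
    fix x assume x: "x \<in> pverts (e i)"
    have ei: "e i \<in> components F" using crits_sub e_crit[OF that] .
    then show "x \<in> {x \<in> pverts F. cp x = i}"
      using x co_in[OF x ei] comp_F[OF ei] cp_eq[OF that] by auto
  next
    fix x assume "x \<in> {x \<in> pverts F. cp x = i}"
    then show "x \<in> pverts (e i)" using co(2)[of x] cp_eq[OF that] by auto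
  qed
  have ea: "{(x, y) \<in> parcs F. cp x = i} = parcs (e i)" if "i < s" for i
  proof (intro equalityI subrelI)
    fix x y assume "(x, y) \<in> {(x, y) \<in> parcs F. cp x = i}"
    then have xy: "(x, y) \<in> parcs F" "co x = e i" using cp_eq[OF that] by auto
    show "(x, y) \<in> parcs (e i)" using co_arc(2)[OF xy(1)] xy(2) by simp
  next
    fix x y assume xy: "(x, y) \<in> parcs (e i)"
    have ei: "e i \<in> components F" using crits_sub e_crit[OF that] .
    then interpret C: sgraph "pverts (e i)" "parcs (e i)" using comp_F by blast
    have "x \<in> pverts (e i)" using xy C.E_subset by auto
    then show "(x, y) \<in> {(x, y) \<in> parcs F. cp x = i}" using xy comp_F[OF ei] ev[OF that] by auto
  qed
  define u v c0 where "u i = uC (e i)" and "v i = vC (e i)" and "c0 x = cC (co x) x" for i x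
  have "critical_components (pverts F) (parcs F) k s cp u v c0"
  proof
    show "cp x = cp y" if "(x, y) \<in> parcs F" for x y using co_arc(1)[OF that] by (simp add: cp_def)
    show "(u i, v i) \<in> parcs F" "cp (u i) = i" if "i < s" for i
    proof -
      have "(u i, v i) \<in> parcs (e i)"
        using C_props(3)[of "e i"] crits_sub e_crit[OF that] by (simp add: u_def v_def)
      then show "(u i, v i) \<in> parcs F" "cp (u i) = i" using ea[OF that] by auto
    qed
    show "c0 x < k" if "x \<in> pverts F" for x using C_props(1) co[OF that] by (simp add: c0_def)
    show "\<exists>i<s. {x, y} = {u i, v i}" if xy: "(x, y) \<in> parcs F" "c0 x = c0 y" for x y
    proof -
      have "x \<in> pverts F" using xy(1) E_subset by auto
      then have "co x \<in> crits \<and> {x, y} = {uC (co x), vC (co x)}"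
        using C_props(2)[OF co(1) co_arc(2)[OF xy(1)]] xy(2) co_arc(1)[OF xy(1)] by (simp add: c0_def)
      then show ?thesis using e_ex by (metis u_def v_def)
    qed
    show "\<not> colorable {x \<in> pverts F. cp x = i} {(x, y) \<in> parcs F. cp x = i} k" if "i < s" for i
      unfolding ea[OF that] ev[OF that, symmetric]
      using chromatic_number_le[of "e i" k] e_crit[OF that] by (auto simp: crits_def)
  qed (use s(2) in simp)
  then show ?thesis by blast
qed

section \<open>The three cases for pair graphs\<close>

lemma extremal_color_critical:
  fixes F :: "'a pair_pre_digraph"
  assumes "2 \<le> k" "1 \<le> r" and F: "pair_graph F" and cc: "critical_components (pverts F) (parcs F) k s cp u v c0"
  shows "\<forall>\<^sub>F n in sequentially. \<exists>(V :: nat set) P. finite V \<and> card V = n \<and> partition_on V P \<and>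
     card P = s + k - 1 \<and> card {A \<in> P. card A = 1} = s - 1 \<and>
     ex_power r n F = degree_power_sum r (complete_multipartite P)"
proof -
  interpret critical_components "pverts F" "parcs F" k s cp u v c0 by fact
  have ne: "parcs F \<noteq> {}" using uv[OF s_pos] by auto
  define Q :: "nat set \<Rightarrow> nat rel \<Rightarrow> bool" where "Q V E \<longleftrightarrow> (\<exists>P. partition_on V P \<and> card P = s + k - 1 \<and>
    card {A \<in> P. card A = 1} = s - 1 \<and> complete_multipartite P = \<lparr>pverts = V, parcs = E\<rparr>)" for V E
  obtain n0 where n0: "\<And>(V :: nat set) E. extremal r (pverts F) (parcs F) V E \<Longrightarrow> n0 \<le> card V \<Longrightarrow>
    (\<exists>c. (\<forall>x\<in>V. c x < k + (s - 1)) \<and> (\<forall>i<k. 2 \<le> card {x \<in> V. c x = i}) \<and>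
      (\<forall>i. k \<le> i \<longrightarrow> i < k + (s - 1) \<longrightarrow> card {x \<in> V. c x = i} = 1) \<and>
      \<not> embeds (pverts F) (parcs F) V (multipartite V c) \<and> power_sum r V E \<le> power_sum r V (multipartite V c))"
    using extremal_multipartite[OF assms(1,2)] by blast
  have "\<forall>\<^sub>F n in sequentially. \<exists>V E'. finite V \<and> card V = n \<and> Q V E' \<and> ex_power r n F = power_sum r V E'"
  proof (rule ex_power_extremal[OF F ne, of r n0])
    fix V :: "nat set" and E
    assume ex: "extremal r (pverts F) (parcs F) V E" and nn: "n0 \<le> card V"
    from n0[OF this] obtain c where c': "\<forall>x\<in>V. c x < k + (s - 1)" "\<forall>i<k. 2 \<le> card {x \<in> V. c x = i}"
      "\<forall>i. k \<le> i \<longrightarrow> i < k + (s - 1) \<longrightarrow> card {x \<in> V. c x = i} = 1"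
      "\<not> embeds (pverts F) (parcs F) V (multipartite V c)" "power_sum r V E \<le> power_sum r V (multipartite V c)"
      by (elim exE conjE)
    have c: "\<And>x. x \<in> V \<Longrightarrow> c x < k + (s - 1)" "\<And>i. i < k \<Longrightarrow> 2 \<le> card {x \<in> V. c x = i}"
      "\<And>i. k \<le> i \<Longrightarrow> i < k + (s - 1) \<Longrightarrow> card {x \<in> V. c x = i} = 1"
      using c'(1-3) by simp_all
    have fin: "finite V" using ex sgraph.finite_V by (auto simp: extremal_def)
    define A where "A i = {x \<in> V. c x = i}" for i
    have ne: "{x \<in> V. c x = i} \<noteq> {}" if "i < k + (s - 1)" for i
    proof (cases "i < k")
      case True
      then show ?thesis using c(2)[OF True] by (metis card.empty not_numeral_le_zero)
    next
      case False
      then have "card {x \<in> V. c x = i} = 1" using c(3) that by simp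
      then show ?thesis by (metis card.empty zero_neq_one)
    qed
    have A_def': "A = (\<lambda>i. {x \<in> V. c x = i})" by (auto simp: A_def)
    note part = partition_of_coloring[of V c "k + (s - 1)", OF c(1) ne, folded A_def']
    \<comment> \<open>Parts of colour below \<open>k\<close> have at least two vertices, so the
      singletons are exactly the \<open>s - 1\<close> parts of colour \<open>k\<close> or
      more.\<close>
    have "{B \<in> A ` {..<k + (s - 1)}. card B = 1} = A ` {k..<k + (s - 1)}"
    proof (intro equalityI subsetI)
      fix B assume "B \<in> {B \<in> A ` {..<k + (s - 1)}. card B = 1}"
      then obtain i where i: "i < k + (s - 1)" "B = A i" "card (A i) = 1" by auto
      then have "\<not> i < k" using c(2)[of i] by (auto simp: A_def)
      then show "B \<in> A ` {k..<k + (s - 1)}" using i by auto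
    qed (use c(3) in \<open>auto simp: A_def\<close>)
    then have "card {B \<in> A ` {..<k + (s - 1)}. card B = 1} = card (A ` {k..<k + (s - 1)})" by simp
    also have "\<dots> = s - 1" using part(2) by (subst card_image) (auto intro: inj_on_subset)
    finally have "Q V (multipartite V c)"
      unfolding Q_def using part(1,3,4) s_pos by (intro exI[of _ "A ` {..<k + (s - 1)}"]) auto
    then show "\<exists>E'. Q V E' \<and> sgraph V E' \<and> \<not> embeds (pverts F) (parcs F) V E' \<and> power_sum r V E \<le> power_sum r V E'"
      using c'(4,5) sgraph_multipartite[OF fin] by blast
  qed
  then show ?thesis
  proof (rule eventually_mono)
    fix n assume "\<exists>V E'. finite V \<and> card V = n \<and> Q V E' \<and> ex_power r n F = power_sum r V E'"
    then obtain V E' where VE: "finite V" "card V = n" "Q V E'" "ex_power r n F = power_sum r V E'"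
      by (elim exE conjE)
    from VE(3) obtain P where P: "partition_on V P" "card P = s + k - 1" "card {A \<in> P. card A = 1} = s - 1"
      "complete_multipartite P = \<lparr>pverts = V, parcs = E'\<rparr>"
      unfolding Q_def by (elim exE conjE)
    have "ex_power r n F = degree_power_sum r (complete_multipartite P)"
      using VE(4) P(4) by (simp add: degree_power_sum_eq)
    then show "\<exists>(V :: nat set) P. finite V \<and> card V = n \<and> partition_on V P \<and>
     card P = s + k - 1 \<and> card {A \<in> P. card A = 1} = s - 1 \<and>
     ex_power r n F = degree_power_sum r (complete_multipartite P)"
      using VE(1,2) P(1-3) by blast
  qed
qed

lemma complete_1_a_exists:
  assumes "2 \<le> k" "1 \<le> a" "is_K1_a k a F"
  shows "\<exists>\<phi> p. complete_1_a (pverts F) \<phi> p k a \<and> parcs F = multipartite (pverts F) \<phi>"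
proof -
  obtain P A where P: "finite (pverts F)" "partition_on (pverts F) P" "card P = k + 1"
    "A \<in> P" "card A = 1" "\<forall>B\<in>P - {A}. card B = a" "F = complete_multipartite P"
    using assms(3) by (auto simp: is_K1_a_def)
  have finP: "finite P" using P(3) by (metis Suc_eq_plus1 card.infinite nat.distinct(1))
  \<comment> \<open>The parts are numbered so that the singleton \<open>A\<close> receives
    \<open>k\<close>.\<close>
  obtain b where b: "inj_on b P" "b ` P \<subseteq> {..<Suc k}" "b A = k"
    using ex_inj_on_with_value[of P "{..<Suc k}" A k] finP P(3,4) by auto
  have surj: "b ` P = {..<Suc k}"
    using b(1,2) P(3) by (intro card_subset_eq) (auto simp: card_image)
  obtain p where p: "A = {p}" using P(5) card_1_singletonE by blast
  define pt where "pt x = (THE B. B \<in> P \<and> x \<in> B)" for x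
  have V: "pverts F = \<Union> P" using P(2) by (simp add: partition_on_def)
  have disj: "B = C" if "B \<in> P" "C \<in> P" "x \<in> B" "x \<in> C" for B C x
    using P(2) that unfolding partition_on_def disjoint_def by blast
  have pt_eq: "pt x = B" if "B \<in> P" "x \<in> B" for x B
    unfolding pt_def using that disj by (intro the_equality) auto
  have pt_in: "pt x \<in> P" "x \<in> pt x" if "x \<in> pverts F" for x
    using that pt_eq V by auto
  define \<phi> where "\<phi> x = b (pt x)" for x
  have \<phi>_class: "{z \<in> pverts F. \<phi> z = b B} = B" if "B \<in> P" for B
    using that pt_in pt_eq V b(1) by (auto simp: \<phi>_def inj_on_def)
  have "complete_1_a (pverts F) \<phi> p k a"
  proof
    show "p \<in> pverts F" using p P(4) V by auto
    show "\<phi> p = k" using p P(4) b(3) pt_eq[of A p] by (simp add: \<phi>_def)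
    show "\<phi> z < k" if "z \<in> pverts F" "z \<noteq> p" for z
    proof -
      have "pt z \<noteq> A" using pt_in(2)[OF that(1)] that(2) p by auto
      then have "b (pt z) \<noteq> b A" using b(1) pt_in(1)[OF that(1)] P(4) by (auto simp: inj_on_def)
      moreover have "b (pt z) < Suc k" using b(2) pt_in(1)[OF that(1)] by auto
      ultimately show ?thesis using b(3) by (simp add: \<phi>_def)
    qed
    show "card {z \<in> pverts F. \<phi> z = i} = a" if i: "i < k" for i
    proof -
      have "i \<in> b ` P" using i surj by simp
      then obtain B where B: "B \<in> P" "i = b B" by blast
      then have "B \<noteq> A" using b(3) i by auto
      then show ?thesis using \<phi>_class[OF B(1)] B P(6) by simp
    qed
  qed (use assms P(1) in auto)
  moreover have "parcs F = multipartite (pverts F) \<phi>"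
  proof (intro set_eqI, clarify)
    fix x y
    have "(x, y) \<in> parcs F \<longleftrightarrow> (\<exists>B\<in>P. \<exists>C\<in>P. B \<noteq> C \<and> x \<in> B \<and> y \<in> C)"
      unfolding P(7) complete_multipartite_def by simp
    also have "\<dots> \<longleftrightarrow> x \<in> pverts F \<and> y \<in> pverts F \<and> pt x \<noteq> pt y" using pt_eq pt_in V by (metis UnionI)
    also have "\<dots> \<longleftrightarrow> (x, y) \<in> multipartite (pverts F) \<phi>"
      using pt_in(1) b(1) by (auto simp: multipartite_def \<phi>_def inj_on_def)
    finally show "(x, y) \<in> parcs F \<longleftrightarrow> (x, y) \<in> multipartite (pverts F) \<phi>" .
  qed
  ultimately show ?thesis by blast
qed

lemma pair_graphI_sgraph:
  assumes "sgraph (pverts G) (parcs G)"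
  shows "pair_graph G"
proof -
  have eq: "\<lparr>pverts = pverts G, parcs = parcs G\<rparr> = G" by (cases G) simp
  show ?thesis using pair_graph_sgraph[OF assms] unfolding eq .
qed

lemma nearly_regular_iff: "nearly_regular l A H \<longleftrightarrow> almost_regular l \<lparr>pverts = A, parcs = H\<rparr>"
  by (simp add: nearly_regular_def almost_regular_def deg_eq)

lemma extremal_K1_a:
  fixes F :: "'a pair_pre_digraph"
  assumes "1 \<le> r" "complete_1_a (pverts F) \<phi> p k a" "parcs F = multipartite (pverts F) \<phi>"
  shows "\<forall>\<^sub>F n in sequentially. \<exists>T :: nat pair_pre_digraph. T \<in> T0_family n k (a - 1) \<and>
    ex_power r n F = degree_power_sum r T"
proof -
  interpret complete_1_a "pverts F" \<phi> p k a by fact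
  have F: "pair_graph F" using sgraph_EF unfolding assms(3)[symmetric] by (rule pair_graphI_sgraph)
  have ne: "parcs F \<noteq> {}"
  proof
    assume "parcs F = {}"
    then have "colorable (pverts F) (parcs F) k"
      using k_ge unfolding colorable_def by (intro exI[of _ "\<lambda>_. 0"]) auto
    then show False using not_colorable assms(3) by simp
  qed
  define Q :: "nat set \<Rightarrow> nat rel \<Rightarrow> bool" where
    "Q V E \<longleftrightarrow> \<lparr>pverts = V, parcs = E\<rparr> \<in> T0_family (card V) k (a - 1)" for V E
  obtain n0 where n0: "\<And>(V :: nat set) E. extremal r (pverts F) (parcs F) V E \<Longrightarrow> n0 \<le> card V \<Longrightarrow>
    (\<exists>c H. (\<forall>x\<in>V. c x < k) \<and> (\<forall>i<k. {x \<in> V. c x = i} \<noteq> {}) \<and>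
      (\<forall>i<k. sgraph {x \<in> V. c x = i} (H i) \<and> nearly_regular (a - 1) {x \<in> V. c x = i} (H i)) \<and>
      \<not> embeds (pverts F) (parcs F) V (multipartite V c \<union> (\<Union>i<k. H i)) \<and>
      power_sum r V E \<le> power_sum r V (multipartite V c \<union> (\<Union>i<k. H i)))"
    using extremal_T0[OF assms(1)] unfolding assms(3)[symmetric] by blast
  have "\<forall>\<^sub>F n in sequentially. \<exists>V E'. finite V \<and> card V = n \<and> Q V E' \<and> ex_power r n F = power_sum r V E'"
  proof (rule ex_power_extremal[OF F ne, of r n0])
    fix V :: "nat set" and E
    assume ex: "extremal r (pverts F) (parcs F) V E" and nn: "n0 \<le> card V"
    from n0[OF this] obtain c H where c': "\<forall>x\<in>V. c x < k" "\<forall>i<k. {x \<in> V. c x = i} \<noteq> {}"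
      and H': "\<forall>i<k. sgraph {x \<in> V. c x = i} (H i) \<and> nearly_regular (a - 1) {x \<in> V. c x = i} (H i)"
      and T: "\<not> embeds (pverts F) (parcs F) V (multipartite V c \<union> (\<Union>i<k. H i))"
        "power_sum r V E \<le> power_sum r V (multipartite V c \<union> (\<Union>i<k. H i))"
      by (elim exE conjE)
    have c: "\<And>x. x \<in> V \<Longrightarrow> c x < k" "\<And>i. i < k \<Longrightarrow> {x \<in> V. c x = i} \<noteq> {}"
      using c' by simp_all
    have H: "\<And>i. i < k \<Longrightarrow> sgraph {x \<in> V. c x = i} (H i)" "\<And>i. i < k \<Longrightarrow> nearly_regular (a - 1) {x \<in> V. c x = i} (H i)"
      using H' by blast+
    have fin: "finite V" using ex sgraph.finite_V by (auto simp: extremal_def)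
    define A where "A = (\<lambda>i. {x \<in> V. c x = i})"
    note part = partition_of_coloring[of V c k, OF c, folded A_def]
    \<comment> \<open>Recovers the colour of a part, because \<open>T0_family\<close> indexes the
      inner graphs by parts.\<close>
    define J where "J = inv_into {..<k} A"
    have J: "J (A i) = i" if "i < k" for i using part(2) that by (simp add: J_def)
    define HB where "HB B = \<lparr>pverts = B, parcs = H (J B)\<rparr>" for B
    have "Q V (multipartite V c \<union> (\<Union>i<k. H i))"
      unfolding Q_def T0_family_def
    proof (intro CollectI exI conjI)
      show "\<forall>B\<in>A ` {..<k}. pair_graph (HB B) \<and> pverts (HB B) = B \<and> almost_regular (a - 1) (HB B)"
      proof
        fix B assume "B \<in> A ` {..<k}"
        then obtain i where i: "i < k" "B = A i" by auto
        have "sgraph B (H i)" "nearly_regular (a - 1) B (H i)" using H[OF i(1)] i(2) by (simp_all add: A_def)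
        then show "pair_graph (HB B) \<and> pverts (HB B) = B \<and> almost_regular (a - 1) (HB B)"
          using J[OF i(1)] i(2) pair_graph_sgraph by (simp add: HB_def nearly_regular_iff)
      qed
      show "\<lparr>pverts = V, parcs = multipartite V c \<union> (\<Union>i<k. H i)\<rparr> =
        \<lparr>pverts = V, parcs = parcs (complete_multipartite (A ` {..<k})) \<union> (\<Union>B\<in>A ` {..<k}. parcs (HB B))\<rparr>"
        using J by (auto simp: part(4) HB_def)
    qed (use fin part in auto)
    moreover have "sgraph V (multipartite V c \<union> (\<Union>i<k. H i))"
    proof -
      have sub: "H i \<subseteq> V \<times> V" "sym (H i)" "irrefl (H i)" if "i < k" for i
        using H(1)[OF that] unfolding sgraph_def by blast+
      show ?thesis
      proof
        show "sym (multipartite V c \<union> (\<Union>i<k. H i))"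
          using sub(2) by (auto simp: multipartite_def sym_def)
        show "multipartite V c \<union> (\<Union>i<k. H i) \<subseteq> V \<times> V" using sub(1) by (auto simp: multipartite_def)
        show "irrefl (multipartite V c \<union> (\<Union>i<k. H i))" using sub(3) by (auto simp: multipartite_def irrefl_def)
      qed (rule fin)
    qed
    ultimately show "\<exists>E'. Q V E' \<and> sgraph V E' \<and> \<not> embeds (pverts F) (parcs F) V E' \<and> power_sum r V E \<le> power_sum r V E'"
      using T by blast
  qed
  then show ?thesis
  proof (rule eventually_mono)
    fix n assume "\<exists>V E'. finite V \<and> card V = n \<and> Q V E' \<and> ex_power r n F = power_sum r V E'"
    then obtain V E' where "card V = n" "Q V E'" "ex_power r n F = power_sum r V E'" by blast
    then show "\<exists>T :: nat pair_pre_digraph. T \<in> T0_family n k (a - 1) \<and> ex_power r n F = degree_power_sum r T"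
      unfolding Q_def by (intro exI[of _ "\<lparr>pverts = V, parcs = E'\<rparr>"]) (simp add: degree_power_sum_eq)
  qed
qed

lemma two_cliques_exists:
  assumes "2 \<le> k" "is_B1 (k + 1) F"
  shows "\<exists>H1 H2 p. two_cliques (pverts F) H1 H2 p k \<and> parcs F = two_cliques.EF H1 H2"
proof -
  obtain H1 H2 :: "'a pair_pre_digraph" where
    H: "complete_digraph (k + 1) (with_proj H1)" "complete_digraph (k + 1) (with_proj H2)"
      "card (pverts H1 \<inter> pverts H2) = 1"
      "F = \<lparr>pverts = pverts H1 \<union> pverts H2, parcs = parcs H1 \<union> parcs H2\<rparr>"
    using assms(2) by (auto simp: is_B1_def)
  obtain p where p: "pverts H1 \<inter> pverts H2 = {p}" using H(3) card_1_singletonE by blast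
  have tc: "two_cliques (pverts F) (pverts H1) (pverts H2) p k"
    using assms(1) H p by unfold_locales (auto simp: complete_digraph_pair_def)
  have "parcs F = two_cliques.EF (pverts H1) (pverts H2)"
    unfolding two_cliques.EF_def[OF tc] using H by (auto simp: complete_digraph_pair_def)
  then show ?thesis using tc by blast
qed

lemma extremal_B1:
  fixes F :: "'a pair_pre_digraph"
  assumes "1 \<le> r" "two_cliques (pverts F) H1 H2 p k" "parcs F = two_cliques.EF H1 H2"
  shows "\<forall>\<^sub>F n in sequentially. \<exists>(V :: nat set) P A u v. finite V \<and> card V = n \<and> partition_on V P \<and> card P = k \<and>
    A \<in> P \<and> u \<in> A \<and> v \<in> A \<and> u \<noteq> v \<and>
    ex_power r n F = degree_power_sum r (add_edge (complete_multipartite P) u v)"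
proof -
  interpret two_cliques "pverts F" H1 H2 p k by fact
  have F: "pair_graph F" using sgraph_EF unfolding assms(3)[symmetric] by (rule pair_graphI_sgraph)
  have ne: "parcs F \<noteq> {}"
  proof
    assume "parcs F = {}"
    then have "colorable (pverts F) (parcs F) k"
      using k_ge unfolding colorable_def by (intro exI[of _ "\<lambda>_. 0"]) auto
    then show False using not_colorable assms(3) by simp
  qed
  define Q :: "nat set \<Rightarrow> nat rel \<Rightarrow> bool" where "Q V E \<longleftrightarrow> (\<exists>P A u v. partition_on V P \<and> card P = k \<and>
    A \<in> P \<and> u \<in> A \<and> v \<in> A \<and> u \<noteq> v \<and> add_edge (complete_multipartite P) u v = \<lparr>pverts = V, parcs = E\<rparr>)" for V E
  obtain n0 where n0: "\<And>(V :: nat set) E. extremal r (pverts F) (parcs F) V E \<Longrightarrow> n0 \<le> card V \<Longrightarrow>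
    (\<exists>c x y. (\<forall>x\<in>V. c x < k) \<and> (\<forall>i<k. {x \<in> V. c x = i} \<noteq> {}) \<and> x \<in> V \<and> y \<in> V \<and> x \<noteq> y \<and> c x = c y \<and>
      \<not> embeds (pverts F) (parcs F) V (multipartite V c \<union> {(x, y), (y, x)}) \<and>
      power_sum r V E \<le> power_sum r V (multipartite V c \<union> {(x, y), (y, x)}))"
    using extremal_one_edge[OF assms(1)] unfolding assms(3)[symmetric] by blast
  have "\<forall>\<^sub>F n in sequentially. \<exists>V E'. finite V \<and> card V = n \<and> Q V E' \<and> ex_power r n F = power_sum r V E'"
  proof (rule ex_power_extremal[OF F ne, of r n0])
    fix V :: "nat set" and E
    assume ex: "extremal r (pverts F) (parcs F) V E" and nn: "n0 \<le> card V"
    from n0[OF this] obtain c x y where c': "\<forall>x\<in>V. c x < k" "\<forall>i<k. {x \<in> V. c x = i} \<noteq> {}"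
      and xy: "x \<in> V" "y \<in> V" "x \<noteq> y" "c x = c y"
      and T: "\<not> embeds (pverts F) (parcs F) V (multipartite V c \<union> {(x, y), (y, x)})"
        "power_sum r V E \<le> power_sum r V (multipartite V c \<union> {(x, y), (y, x)})"
      by (elim exE conjE)
    have c: "\<And>x. x \<in> V \<Longrightarrow> c x < k" "\<And>i. i < k \<Longrightarrow> {x \<in> V. c x = i} \<noteq> {}"
      using c' by simp_all
    have fin: "finite V" using ex sgraph.finite_V by (auto simp: extremal_def)
    define A where "A = (\<lambda>i. {x \<in> V. c x = i})"
    note part = partition_of_coloring[of V c k, OF c, folded A_def]
    have "Q V (multipartite V c \<union> {(x, y), (y, x)})"
      unfolding Q_def
    proof (intro exI conjI)
      show "A (c x) \<in> A ` {..<k}" using c(1)[OF xy(1)] by simp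
      show "x \<in> A (c x)" "y \<in> A (c x)" using xy by (auto simp: A_def)
      show "add_edge (complete_multipartite (A ` {..<k})) x y =
        \<lparr>pverts = V, parcs = multipartite V c \<union> {(x, y), (y, x)}\<rparr>"
        by (simp add: add_edge_def part(4))
    qed (use part xy(3) in auto)
    moreover have "sgraph V (multipartite V c \<union> {(x, y), (y, x)})"
      using xy fin by unfold_locales (auto simp: multipartite_def sym_def irrefl_def)
    ultimately show "\<exists>E'. Q V E' \<and> sgraph V E' \<and> \<not> embeds (pverts F) (parcs F) V E' \<and> power_sum r V E \<le> power_sum r V E'"
      using T by blast
  qed
  then show ?thesis
  proof (rule eventually_mono)
    fix n assume "\<exists>V E'. finite V \<and> card V = n \<and> Q V E' \<and> ex_power r n F = power_sum r V E'"
    then obtain V E' where VE: "finite V" "card V = n" "Q V E'" "ex_power r n F = power_sum r V E'"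
      by (elim exE conjE)
    from VE(3) obtain P A u v where P: "partition_on V P" "card P = k" "A \<in> P" "u \<in> A" "v \<in> A" "u \<noteq> v"
      "add_edge (complete_multipartite P) u v = \<lparr>pverts = V, parcs = E'\<rparr>"
      unfolding Q_def by (elim exE conjE)
    have "ex_power r n F = degree_power_sum r (add_edge (complete_multipartite P) u v)"
      using VE(4) P(7) by (simp add: degree_power_sum_eq)
    then show "\<exists>(V :: nat set) P A u v. finite V \<and> card V = n \<and> partition_on V P \<and> card P = k \<and>
      A \<in> P \<and> u \<in> A \<and> v \<in> A \<and> u \<noteq> v \<and>
      ex_power r n F = degree_power_sum r (add_edge (complete_multipartite P) u v)"
      using VE(1,2) P(1-6) by blast
  qed
qed

theorem theorem1p8:
  fixes k r :: nat
  assumes "k \<ge> 2" and "r \<ge> 1"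
  shows
    "(\<forall>(s :: nat) (F :: 'a pair_pre_digraph).
        s > 1 \<and> pair_graph F \<and>
        card {C \<in> components F. chromatic_number C = k + 1} = s \<and>
        (\<forall>C\<in>components F. chromatic_number C = k + 1 \<longrightarrow> has_color_critical_edge C) \<and>
        (\<forall>C\<in>components F. chromatic_number C \<noteq> k + 1 \<longrightarrow> chromatic_number C \<le> k) \<longrightarrow>
        (\<forall>\<^sub>F n in sequentially.
           \<exists>(V :: nat set) P. finite V \<and> card V = n \<and> partition_on V P \<and>
             card P = s + k - 1 \<and> card {A \<in> P. card A = 1} = s - 1 \<and>
             ex_power r n F = degree_power_sum r (complete_multipartite P))) \<and>
     (\<forall>(a :: nat) (F :: 'a pair_pre_digraph).
        a \<ge> 1 \<and> is_K1_a k a F \<longrightarrow>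
        (\<forall>\<^sub>F n in sequentially.
           \<exists>T :: nat pair_pre_digraph. T \<in> T0_family n k (a - 1) \<and>
             ex_power r n F = degree_power_sum r T)) \<and>
     (\<forall>F :: 'a pair_pre_digraph.
        is_B1 (k + 1) F \<longrightarrow>
        (\<forall>\<^sub>F n in sequentially.
           \<exists>(V :: nat set) P A u v. finite V \<and> card V = n \<and> partition_on V P \<and> card P = k \<and>
             A \<in> P \<and> u \<in> A \<and> v \<in> A \<and> u \<noteq> v \<and>
             ex_power r n F = degree_power_sum r (add_edge (complete_multipartite P) u v)))"
proof (intro conjI allI impI)
  fix s :: nat and F :: "'a pair_pre_digraph"
  assume a: "s > 1 \<and> pair_graph F \<and>
        card {C \<in> components F. chromatic_number C = k + 1} = s \<and>
        (\<forall>C\<in>components F. chromatic_number C = k + 1 \<longrightarrow> has_color_critical_edge C) \<and>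
        (\<forall>C\<in>components F. chromatic_number C \<noteq> k + 1 \<longrightarrow> chromatic_number C \<le> k)"
  then obtain cp u v c0 where "critical_components (pverts F) (parcs F) k s cp u v c0"
    using critical_components_exist[of F k s] by auto
  then show "\<forall>\<^sub>F n in sequentially.
           \<exists>(V :: nat set) P. finite V \<and> card V = n \<and> partition_on V P \<and>
             card P = s + k - 1 \<and> card {A \<in> P. card A = 1} = s - 1 \<and>
             ex_power r n F = degree_power_sum r (complete_multipartite P)"
    using a by (intro extremal_color_critical[OF assms]) auto
next
  fix a :: nat and F :: "'a pair_pre_digraph"
  assume "a \<ge> 1 \<and> is_K1_a k a F"
  then obtain \<phi> p where "complete_1_a (pverts F) \<phi> p k a" "parcs F = multipartite (pverts F) \<phi>"
    using complete_1_a_exists[OF assms(1)] by blast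
  then show "\<forall>\<^sub>F n in sequentially.
           \<exists>T :: nat pair_pre_digraph. T \<in> T0_family n k (a - 1) \<and>
             ex_power r n F = degree_power_sum r T"
    by (rule extremal_K1_a[OF assms(2)])
next
  fix F :: "'a pair_pre_digraph"
  assume "is_B1 (k + 1) F"
  then obtain H1 H2 p where "two_cliques (pverts F) H1 H2 p k" "parcs F = two_cliques.EF H1 H2"
    using two_cliques_exists[OF assms(1)] by blast
  then show "\<forall>\<^sub>F n in sequentially.
           \<exists>(V :: nat set) P A u v. finite V \<and> card V = n \<and> partition_on V P \<and> card P = k \<and>
             A \<in> P \<and> u \<in> A \<and> v \<in> A \<and> u \<noteq> v \<and>
             ex_power r n F = degree_power_sum r (add_edge (complete_multipartite P) u v)"
    by (rule extremal_B1[OF assms(2)])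
qed

end
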